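(* Let $-A$ be the generator of a $C_0$-semigroup $(T(t))_{t\ge0}$ on a Banach space $X$ such that $\mathbb{C}_-\subseteq\rho(A)$. Let $\omega,M_\omega\ge1$ be such that $\|T(t)\|_{\mathcal{L}(X)}\le M_\omega e^{t(\omega-1)}$ for all $t\ge0$, and set $M:=\sup\{\|T(t)\|_{\mathcal{L}(X)}:t\in[0,2]\}$. Let $Y\hookrightarrow X$ be a continuously embedded Banach space satisfying the following conditions: (1) there exists a $C_T\ge0$ such that $T(t)\in\mathcal{L}(Y)$ for all $t\ge0$, with $\|T(t)\|_{\mathcal{L}(Y)}\le C_T\|T(t)\|_{\mathcal{L}(X)}$; (2) there exists a continuously and densely embedded Banach space $Y_0\hookrightarrow Y$ such that $[t\mapsto e^{-at}\|T(t)\|_{\mathcal{L}(Y_0,X)}]\in L^1(0,\infty)$ for all $a\in(0,\infty)$. Suppose that there exist $p\in[1,\infty]$, $q\in[p,\infty]$ and a nondecreasing $g:(0,\infty)\to(0,\infty)$ such that $(a+i\cdot+A)^{-1}\in\mathcal{M}_{p,q}(\mathbb{R};\mathcal{L}(Y,X))$ for all $a\in(0,\infty)$, with $$\|(a+i\cdot+A)^{-1}\|_{\mathcal{M}_{p,q}(\mathbb{R};\mathcal{L}(Y,X))}\le g(1/a).$$ Then $\|T(t)\|_{\mathcal{L}(Y,X)}\le C_q(g(t)+1)$ for all $t>0$. Here $C_q=eC_TC_YM_\omega(1+2M\omega)$ for $q<\infty$, $C_\infty=eC_TC_YM_\omega(1+\omega)$, and $C_Y=\max(1,\|I_Y\|_{\mathcal{L}(Y,X)})$,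 where $I_Y:Y\to X$ is the inclusion.
   Context: Banach spaces are nonzero and over $\mathbb{C}$. $\mathcal{L}(Y,X)$ denotes the bounded operators from $Y$ to $X$, $\mathcal{L}(X)=\mathcal{L}(X,X)$; $\mathbb{C}_-=\{\mathrm{Re}(\lambda)<0\}$; $\rho(A)$ is the resolvent set. The Fourier transform is $\mathcal{F}f(\xi)=\hat f(\xi)=\int_{\mathbb{R}}e^{-i\xi t}f(t)\,dt$. $(a+i\cdot+A)^{-1}$ denotes the map $\xi\mapsto(a+i\xi+A)^{-1}$, restricted to $Y$. Fourier multipliers: a map $m:\mathbb{R}\to\mathcal{L}(Y,X)$ is $Y$-strongly measurable if $\xi\mapsto m(\xi)y$ is strongly measurable for all $y\in Y$, and of moderate growth if there are $\beta\in(0,\infty)$ and $h\in L^1(\mathbb{R})$ with $(1+|\xi|)^{-\beta}\|m(\xi)\|_{\mathcal{L}(Y,X)}\le h(\xi)$ for $\xi\in\mathbb{R}$. For such $m$ define $T_m:\mathcal{S}(\mathbb{R};Y)\to\mathcal{S}'(\mathbb{R};X)$, $T_mf=\mathcal{F}^{-1}(m\hat f)$, where $\mathcal{S}$ and $\mathcal{S}'$ are vector-valued Schwartz functions and tempered distributions. For $p\in[1,\infty)$ and $q\in[1,\infty]$, $\mathcal{M}_{p,q}(\mathbb{R};\mathcal{L}(Y,X))$ is the set of all such $m$ for which $T_m$ extends to a bounded operator from $L^p(\mathbb{R};Y)$ to $L^q(\mathbb{R};X)$, with norm $\|m\|_{\mathcal{M}_{p,q}}=\|T_m\|_{\mathcal{L}(L^p(\mathbb{R};Y),L^q(\mathbb{R};X))}$.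 For $p=q=\infty$: $m\in\mathcal{M}_{\infty,\infty}(\mathbb{R};\mathcal{L}(Y,X))$ if (in addition to being $Y$-strongly measurable of moderate growth) there is a $Y$-strongly measurable $K:\mathbb{R}\to\mathcal{L}(Y,X)$ with $K(\cdot)y\in L^1(\mathbb{R};X)$ and $m(\xi)y=\mathcal{F}(K(\cdot)y)(\xi)$ for all $y\in Y$, $\xi\in\mathbb{R}$, and a constant $C\ge0$ such that $T_mf(t):=\int_{\mathbb{R}}K(t-s)f(s)\,ds$ satisfies $\|T_mf\|_{L^\infty(\mathbb{R};X)}\le C\|f\|_{L^\infty(\mathbb{R};Y)}$ for all $Y$-valued simple functions $f$; the norm $\|m\|_{\mathcal{M}_{\infty,\infty}}$ is the minimal such $C$. *)

theory Defs
  imports "HOL-Analysis.Analysis" "HOL-Probability.Essential_Supremum"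
begin

section \<open>Complex Banach spaces and bounded operators\<close>

class complex_normed_vector = real_normed_vector +
  fixes scaleC :: "complex \<Rightarrow> 'a \<Rightarrow> 'a"  (infixr \<open>*\<^sub>C\<close> 75)
  assumes scaleC_add_right: "c *\<^sub>C (x + y) = c *\<^sub>C x + c *\<^sub>C y"
    and scaleC_add_left: "(c + d) *\<^sub>C x = c *\<^sub>C x + d *\<^sub>C x"
    and scaleC_scaleC: "c *\<^sub>C d *\<^sub>C x = (c * d) *\<^sub>C x"
    and scaleC_of_real: "complex_of_real r *\<^sub>C x = r *\<^sub>R x"
    and norm_scaleC: "norm (c *\<^sub>C x) = cmod c * norm x"

class cbanach = complex_normed_vector + banach

instantiation complex :: cbanach
begin
definition "c *\<^sub>C (z::complex) = c * z"
instance
  by standard (simp_all add: scaleC_complex_def algebra_simps scaleR_conv_of_real norm_mult)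
end

text \<open>The norm of a bounded operator is the library's \<^const>\<open>onorm\<close>; it depends only on the
  norms of the two spaces, so no complex version is needed.\<close>

definition bounded_clinear ::
    "('a::complex_normed_vector \<Rightarrow> 'b::complex_normed_vector) \<Rightarrow> bool" where
  "bounded_clinear f \<longleftrightarrow> bounded_linear f \<and> (\<forall>c x. f (c *\<^sub>C x) = c *\<^sub>C f x)"

text \<open>A Banach space continuously embedded in another one is a type together with its
  inclusion map.\<close>

definition continuous_embedding ::
    "('a::complex_normed_vector \<Rightarrow> 'b::complex_normed_vector) \<Rightarrow> bool" where
  "continuous_embedding i \<longleftrightarrow> bounded_clinear i \<and> inj i"


section \<open>Semigroups, generators and resolvents\<close>

definition C0_semigroup :: "(real \<Rightarrow> 'a::complex_normed_vector \<Rightarrow> 'a) \<Rightarrow> bool" where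
  "C0_semigroup T \<longleftrightarrow>
     (\<forall>t\<ge>0. bounded_clinear (T t)) \<and>
     T 0 = id \<and>
     (\<forall>s\<ge>0. \<forall>t\<ge>0. T (s + t) = T s \<circ> T t) \<and>
     (\<forall>x. continuous_on {0..} (\<lambda>t. T t x))"

text \<open>An unbounded operator is given by its domain \<open>D\<close> and a map whose values
  outside \<open>D\<close> are irrelevant.\<close>

definition is_generator ::
    "'a::complex_normed_vector set \<Rightarrow> ('a \<Rightarrow> 'a) \<Rightarrow> (real \<Rightarrow> 'a \<Rightarrow> 'a) \<Rightarrow> bool" where
  "is_generator D G T \<longleftrightarrow>
     D = {x. \<exists>y. ((\<lambda>t. (T t x - x) /\<^sub>R t) \<longlongrightarrow> y) (at_right 0)} \<and>
     (\<forall>x\<in>D. ((\<lambda>t. (T t x - x) /\<^sub>R t) \<longlongrightarrow> G x) (at_right 0))"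

definition resolvent_set ::
    "'a::complex_normed_vector set \<Rightarrow> ('a \<Rightarrow> 'a) \<Rightarrow> complex set" where
  "resolvent_set D A =
     {z. bij_betw (\<lambda>x. z *\<^sub>C x - A x) D UNIV \<and>
         bounded_clinear (inv_into D (\<lambda>x. z *\<^sub>C x - A x))}"


section \<open>Bochner integral and Lebesgue spaces on the real line\<close>

text \<open>The library's Bochner integral is restricted to second countable spaces. The definitions
  below follow it without that restriction, with strong measurability (with respect to the
  complete Lebesgue measure) in place of Borel measurability.\<close>

definition strongly_measurable :: "(real \<Rightarrow> 'a::real_normed_vector) \<Rightarrow> bool" where
  "strongly_measurable f \<longleftrightarrow>
     (\<exists>s. (\<forall>n. simple_function lebesgue (s n)) \<and>
          (AE t in lebesgue. (\<lambda>n. s n t) \<longlonglongrightarrow> f t))"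

definition has_bochner ::
    "(real \<Rightarrow> 'a::real_normed_vector) \<Rightarrow> 'a \<Rightarrow> bool" where
  "has_bochner f x \<longleftrightarrow>
     strongly_measurable f \<and>
     (\<exists>s. (\<forall>n. Bochner_Integration.simple_bochner_integrable lebesgue (s n)) \<and>
          (\<lambda>n. \<integral>\<^sup>+t. ennreal (norm (f t - s n t)) \<partial>lebesgue) \<longlonglongrightarrow> 0 \<and>
          (\<lambda>n. Bochner_Integration.simple_bochner_integral lebesgue (s n)) \<longlonglongrightarrow> x)"

definition bochner :: "(real \<Rightarrow> 'a::real_normed_vector) \<Rightarrow> 'a" where
  "bochner f = (if \<exists>x. has_bochner f x then THE x. has_bochner f x else 0)"

definition Lp :: "ennreal \<Rightarrow> (real \<Rightarrow> 'a::real_normed_vector) set" where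
  "Lp p = {f. strongly_measurable f \<and>
     (if p = \<infinity> then esssup lebesgue (\<lambda>t. ereal (norm (f t))) < \<infinity>
      else (\<integral>\<^sup>+t. ennreal (norm (f t) powr enn2real p) \<partial>lebesgue) < \<infinity>)}"

text \<open>Meaningful only for members of \<^const>\<open>Lp\<close>.\<close>

definition Lp_norm :: "ennreal \<Rightarrow> (real \<Rightarrow> 'a::real_normed_vector) \<Rightarrow> real" where
  "Lp_norm p f =
     (if p = \<infinity> then real_of_ereal (esssup lebesgue (\<lambda>t. ereal (norm (f t))))
      else enn2real (\<integral>\<^sup>+t. ennreal (norm (f t) powr enn2real p) \<partial>lebesgue) powr (1 / enn2real p))"


section \<open>Schwartz functions, Fourier transform and tempered distributions\<close>

definition schwartz :: "(real \<Rightarrow> 'a::real_normed_vector) set" where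
  "schwartz = {f. \<exists>D. D 0 = f \<and>
     (\<forall>n t. (D n has_vector_derivative D (Suc n) t) (at t)) \<and>
     (\<forall>k n. bounded (range (\<lambda>t. t ^ k *\<^sub>R D n t)))}"

definition fourier :: "(real \<Rightarrow> 'a::complex_normed_vector) \<Rightarrow> real \<Rightarrow> 'a" where
  "fourier f \<xi> = bochner (\<lambda>t. exp (- \<i> * of_real \<xi> * of_real t) *\<^sub>C f t)"

definition inv_fourier :: "(real \<Rightarrow> 'a::complex_normed_vector) \<Rightarrow> real \<Rightarrow> 'a" where
  "inv_fourier f t =
     (1 / (2 * pi)) *\<^sub>R bochner (\<lambda>\<xi>. exp (\<i> * of_real \<xi> * of_real t) *\<^sub>C f \<xi>)"

text \<open>Vector-valued tempered distributions are maps on scalar Schwartz functions; only their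
  values on \<^const>\<open>schwartz\<close> matter.\<close>

type_synonym 'a distribution = "(real \<Rightarrow> complex) \<Rightarrow> 'a"

definition regular_dist :: "(real \<Rightarrow> 'a::complex_normed_vector) \<Rightarrow> 'a distribution" where
  "regular_dist u \<phi> = bochner (\<lambda>t. \<phi> t *\<^sub>C u t)"

definition inv_fourier_dist :: "'a distribution \<Rightarrow> 'a distribution" where
  "inv_fourier_dist U \<phi> = U (inv_fourier \<phi>)"


section \<open>Fourier multipliers\<close>

definition pointwise_strongly_measurable ::
    "(real \<Rightarrow> 'y \<Rightarrow> 'x::real_normed_vector) \<Rightarrow> bool" where
  "pointwise_strongly_measurable m \<longleftrightarrow> (\<forall>y. strongly_measurable (\<lambda>\<xi>. m \<xi> y))"

definition moderate_growth ::
    "(real \<Rightarrow> 'y::real_normed_vector \<Rightarrow> 'x::real_normed_vector) \<Rightarrow> bool" where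
  "moderate_growth m \<longleftrightarrow>
     (\<exists>\<beta>>0. \<exists>h. integrable lebesgue h \<and>
        (\<forall>\<xi>. (1 + \<bar>\<xi>\<bar>) powr (- \<beta>) * onorm (m \<xi>) \<le> h \<xi>))"

definition multiplier_op ::
    "(real \<Rightarrow> 'y::complex_normed_vector \<Rightarrow> 'x::complex_normed_vector) \<Rightarrow>
     (real \<Rightarrow> 'y) \<Rightarrow> 'x distribution" where
  "multiplier_op m f = inv_fourier_dist (regular_dist (\<lambda>\<xi>. m \<xi> (fourier f \<xi>)))"

text \<open>\<open>C\<close> bounds an extension \<open>U\<close> of the multiplier operator to a linear operator from \<open>L\<^sup>p\<close>
  to \<open>L\<^sup>q\<close>. As \<open>U\<close> acts on functions rather than on classes, its linearity is required almost
  everywhere; with the bound, this makes \<open>U\<close> well-defined on classes.\<close>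

definition extension_bound ::
    "ennreal \<Rightarrow> ennreal \<Rightarrow>
     (real \<Rightarrow> 'y::complex_normed_vector \<Rightarrow> 'x::complex_normed_vector) \<Rightarrow> real \<Rightarrow> bool" where
  "extension_bound p q m C \<longleftrightarrow> C \<ge> 0 \<and>
     (\<exists>U. (\<forall>f\<in>Lp p. U f \<in> Lp q \<and> Lp_norm q (U f) \<le> C * Lp_norm p f) \<and>
          (\<forall>f\<in>Lp p. \<forall>g\<in>Lp p. \<forall>c. AE t in lebesgue.
             U (\<lambda>s. c *\<^sub>C f s + g s) t = c *\<^sub>C U f t + U g t) \<and>
          (\<forall>f\<in>schwartz. \<forall>\<phi>\<in>schwartz. regular_dist (U f) \<phi> = multiplier_op m f \<phi>))"

definition convolution_bound ::
    "(real \<Rightarrow> 'y::complex_normed_vector \<Rightarrow> 'x::complex_normed_vector) \<Rightarrow> real \<Rightarrow> bool" where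
  "convolution_bound m C \<longleftrightarrow> C \<ge> 0 \<and>
     (\<exists>K. (\<forall>t. bounded_clinear (K t)) \<and> pointwise_strongly_measurable K \<and>
          (\<forall>y. (\<lambda>t. K t y) \<in> Lp 1 \<and> (\<forall>\<xi>. m \<xi> y = fourier (\<lambda>t. K t y) \<xi>)) \<and>
          (\<forall>f. simple_function lebesgue f \<longrightarrow>
             (\<lambda>t. bochner (\<lambda>s. K (t - s) (f s))) \<in> Lp \<infinity> \<and>
             Lp_norm \<infinity> (\<lambda>t. bochner (\<lambda>s. K (t - s) (f s))) \<le> C * Lp_norm \<infinity> f))"

text \<open>The only pair with \<open>p = \<infinity>\<close> is \<open>p = q = \<infinity>\<close>.\<close>

definition multiplier_bound ::
    "ennreal \<Rightarrow> ennreal \<Rightarrow>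
     (real \<Rightarrow> 'y::complex_normed_vector \<Rightarrow> 'x::complex_normed_vector) \<Rightarrow> real \<Rightarrow> bool" where
  "multiplier_bound p q m C \<longleftrightarrow>
     (if p = \<infinity> then q = \<infinity> \<and> convolution_bound m C else extension_bound p q m C)"

definition fourier_multipliers ::
    "ennreal \<Rightarrow> ennreal \<Rightarrow>
     (real \<Rightarrow> 'y::complex_normed_vector \<Rightarrow> 'x::complex_normed_vector) set" where
  "fourier_multipliers p q = {m. (\<forall>\<xi>. bounded_clinear (m \<xi>)) \<and>
     pointwise_strongly_measurable m \<and> moderate_growth m \<and> (\<exists>C. multiplier_bound p q m C)}"

definition multiplier_norm ::
    "ennreal \<Rightarrow> ennreal \<Rightarrow>
     (real \<Rightarrow> 'y::complex_normed_vector \<Rightarrow> 'x::complex_normed_vector) \<Rightarrow> real" where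
  "multiplier_norm p q m = Inf {C. multiplier_bound p q m C}"

end

theory Submission
  imports Defs "HOL-Probability.Probability"
begin

text \<open>
Let \<open>S s = exp (- a s) T s\<close> for \<open>s \<ge> 0\<close> and \<open>f s = exp (- (\<omega> + a) s) T s y\<close>. The semigroup law
collapses the convolution of the two:
\<open>(S * f) t = exp (- a t) ((1 - exp (- \<omega> t)) / \<omega>) T t y\<close>.
The resolvent \<open>\<xi> \<mapsto> (a + \<i> \<xi> + A)\<^sup>-\<^sup>1\<close> is the Fourier transform of \<open>S\<close>, so that \<open>S * f\<close> is the image of \<open>f\<close>
under the Fourier multiplier, and its \<open>L\<^sup>q\<close> norm is at most \<open>g (1 / a)\<close> times the \<open>L\<^sup>p\<close> norm of \<open>f\<close>,
which is at most \<open>C\<^sub>T M\<^sub>\<omega> (norm y)\<close> for every \<open>p\<close>. Now let \<open>a = 1 / t\<close>. If \<open>q = \<infinity>\<close>, the estimate holds at the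
point \<open>t\<close> by continuity, and the missing part \<open>exp (- \<omega> t) T t y\<close> is bounded by the exponential growth
bound. If \<open>q < \<infinity>\<close>, times \<open>t \<le> 2\<close> are covered by \<open>M\<close>, and for \<open>t > 2\<close> one writes
\<open>T t y = T (t - u) T u y\<close> and averages over \<open>u\<close> in \<open>[t - 1, t]\<close>, where \<open>1 - exp (- \<omega> u) \<ge> 1 / 2\<close>.

Three points need work. First, the orbit of \<open>y\<close> need not be measurable as a function with values
in the smaller space, and \<open>S\<close> is known to be integrable only on the image of \<open>j\<close>. Therefore \<open>f\<close> is
replaced by step functions with values in that image, which approximate \<open>f\<close> at grid points; the
semigroup law and strong continuity on the larger space identify the limit as the mesh tends to
zero (\<open>orbit_window_bound\<close>).

Second, for \<open>p < \<infinity>\<close> the multiplier operator is given through tempered distributions. Indicators of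
intervals smoothed by Gaussians are Schwartz functions with explicit Fourier transforms, both as
components of the argument and as test functions. On them the operator is an absolutely convergent
integral, and as the smoothing is removed, Parseval's identity in the form of
\<open>gauss_overlap_limit\<close> turns it into the convolution with \<open>S\<close>. The same identity shows for \<open>p = \<infinity>\<close>
that any kernel with the right Fourier transform acts on step functions like \<open>S\<close>. Both cases are
combined in \<open>step_bound\<close>.

Third, the spaces need not be separable. All vector-valued identities are tested with complex
functionals from the Hahn-Banach theorem, whereby they become identities for complex-valued
integrals; in particular \<open>laplace_transform_resolvent\<close> is the Fourier representation of the resolvent.
The passage from averages over windows to values of the orbit is \<open>orbit_pointwise_bound\<close>.
\<close>

section \<open>Norming functionals\<close>

definition sublinear_below_norm :: "('a::real_normed_vector \<Rightarrow> real) \<Rightarrow> bool" where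
  "sublinear_below_norm p \<longleftrightarrow> (\<forall>x y. p (x + y) \<le> p x + p y) \<and> (\<forall>c\<ge>0. \<forall>x. p (c *\<^sub>R x) = c * p x) \<and>
     (\<forall>x. p x \<le> norm x)"

lemma sublinear_ge: 
  assumes "sublinear_below_norm p" shows "- norm x \<le> p x" "- p (- x) \<le> p x" "p 0 = 0"
proof -
  have z: "p (0 *\<^sub>R 0) = 0 * p 0" using assms unfolding sublinear_below_norm_def by blast
  then show "p 0 = 0" by simp
  have "p (x + - x) \<le> p x + p (- x)" using assms unfolding sublinear_below_norm_def by blast
  then show *: "- p (- x) \<le> p x" using z by simp
  have "p (- x) \<le> norm (- x)" using assms unfolding sublinear_below_norm_def by blast
  with * show "- norm x \<le> p x" by simp
qed

text \<open>The infimum of \<open>p (x + c *\<^sub>R y) - c * p y\<close> over \<open>c \<ge> 0\<close> is again sublinear and lies below \<open>p\<close>;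
at \<open>- y\<close> the choice \<open>c = 1\<close> gives the bound. So a minimal \<open>p\<close> satisfies \<open>p (- y) \<le> - p y\<close> for
every \<open>y\<close>, that is, it is linear.\<close>

lemma sublinear_shift:
  assumes p: "sublinear_below_norm p"
  obtains q where "sublinear_below_norm q" "\<And>x. q x \<le> p x" "q (- y) \<le> - p y"
proof -
  have padd: "p (x + z) \<le> p x + p z" for x z using p unfolding sublinear_below_norm_def by blast
  have pmul: "c \<ge> 0 \<Longrightarrow> p (c *\<^sub>R x) = c * p x" for x c using p unfolding sublinear_below_norm_def by blast
  define S where "S x = {p (x + c *\<^sub>R y) - c * p y | c. c \<ge> 0}" for x
  define q where "q x = Inf (S x)" for x
  have low: "- p (- x) \<le> p (x + c *\<^sub>R y) - c * p y" if "c \<ge> 0" for c x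
  proof -
    have "p (c *\<^sub>R y) \<le> p (x + c *\<^sub>R y) + p (- x)" using padd[of "x + c *\<^sub>R y" "- x"] by simp
    then show ?thesis using pmul[OF that] by simp
  qed
  have bdd: "bdd_below (S x)" for x
    using low by (auto simp: S_def bdd_below_def)
  have ne: "S x \<noteq> {}" for x by (auto simp: S_def intro: exI[of _ 0])
  have up: "q x \<le> p (x + c *\<^sub>R y) - c * p y" if "c \<ge> 0" for c x
    unfolding q_def by (rule cInf_lower[OF _ bdd]) (use that in \<open>auto simp: S_def\<close>)
  have qp: "q x \<le> p x" for x using up[of 0 x] by simp
  have qadd: "q (x + z) \<le> q x + q z" for x z
  proof (rule field_le_epsilon)
    fix e :: real assume e: "e > 0"
    have "\<exists>s\<in>S x. s < q x + e/2" for x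
      unfolding q_def using cInf_lessD[OF ne, of x "Inf (S x) + e/2"] e by auto
    then obtain s s' where s: "s \<in> S x" "s < q x + e/2" "s' \<in> S z" "s' < q z + e/2" by meson
    then obtain c d where cd: "c \<ge> 0" "d \<ge> 0" "s = p (x + c *\<^sub>R y) - c * p y" "s' = p (z + d *\<^sub>R y) - d * p y"
      by (auto simp: S_def)
    have "q (x + z) \<le> p (x + z + (c + d) *\<^sub>R y) - (c + d) * p y" using up[of "c + d"] cd by simp
    also have "p (x + z + (c + d) *\<^sub>R y) \<le> p (x + c *\<^sub>R y) + p (z + d *\<^sub>R y)"
      using padd[of "x + c *\<^sub>R y" "z + d *\<^sub>R y"] by (simp add: algebra_simps)
    finally show "q (x + z) \<le> q x + q z + e" using s cd by (simp add: algebra_simps)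
  qed
  have qle: "q (b *\<^sub>R x) \<le> b * q x" if b: "b > 0" for b x
  proof -
    have "q (b *\<^sub>R x) / b \<le> q x" unfolding q_def[of x]
    proof (rule cInf_greatest[OF ne])
      fix s assume "s \<in> S x"
      then obtain c where c: "c \<ge> 0" "s = p (x + c *\<^sub>R y) - c * p y" by (auto simp: S_def)
      have "q (b *\<^sub>R x) \<le> p (b *\<^sub>R x + (b * c) *\<^sub>R y) - (b * c) * p y" using up b c by simp
      also have "b *\<^sub>R x + (b * c) *\<^sub>R y = b *\<^sub>R (x + c *\<^sub>R y)" by (simp add: algebra_simps)
      also have "p (b *\<^sub>R (x + c *\<^sub>R y)) = b * p (x + c *\<^sub>R y)" using pmul b by simp
      finally have "q (b *\<^sub>R x) \<le> b * s" by (simp add: c(2) algebra_simps)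
      then show "q (b *\<^sub>R x) / b \<le> s" using b by (simp add: field_simps)
    qed
    then show ?thesis using b by (simp add: field_simps)
  qed
  have q0: "q 0 = 0"
  proof (rule antisym)
    show "q 0 \<le> 0" using qp[of 0] sublinear_ge(3)[OF p] by simp
    show "0 \<le> q 0" unfolding q_def by (rule cInf_greatest[OF ne]) (auto simp: S_def pmul)
  qed
  have qmul: "q (b *\<^sub>R x) = b * q x" if "b \<ge> 0" for b x
  proof (cases "b = 0")
    case False
    then have b: "b > 0" using that by simp
    have "q ((1/b) *\<^sub>R (b *\<^sub>R x)) \<le> (1/b) * q (b *\<^sub>R x)" by (rule qle) (use b in simp)
    then have "b * q x \<le> q (b *\<^sub>R x)" using b by (simp add: field_simps)
    with qle[OF b, of x] show ?thesis by simp
  qed (simp add: q0)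
  show ?thesis
  proof
    show "sublinear_below_norm q" unfolding sublinear_below_norm_def
      using qadd qmul order_trans[OF qp] p unfolding sublinear_below_norm_def by blast
    show "q x \<le> p x" for x by (rule qp)
    show "q (- y) \<le> - p y" using up[of 1 "- y"] sublinear_ge(3)[OF p] by simp
  qed
qed

text \<open>A minimal sublinear functional below the norm is linear, and Zorn's lemma provides one. The shift
of the norm in the direction of \<open>x0\<close> forces the value \<open>norm x0\<close> at \<open>x0\<close>.\<close>

lemma Hahn_Banach_real:
  fixes x0 :: "'a::real_normed_vector"
  obtains f :: "'a \<Rightarrow> real" where "bounded_linear f" "\<And>x. \<bar>f x\<bar> \<le> norm x" "f x0 = norm x0"
proof -
  define A where "A = {p :: 'a \<Rightarrow> real. sublinear_below_norm p \<and> p (- x0) \<le> - norm x0}"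
  define P where "P = (\<lambda>p q :: 'a \<Rightarrow> real. q \<le> p)"
  have po: "partial_order_on A (relation_of P A)"
    unfolding partial_order_on_def preorder_on_def refl_on_def trans_def antisym_def relation_of_def P_def
    by auto
  have nonempty: "\<exists>p. p \<in> A"
  proof -
    have n: "sublinear_below_norm (norm :: 'a \<Rightarrow> real)" unfolding sublinear_below_norm_def by (auto intro: norm_triangle_ineq)
    then show ?thesis using sublinear_shift[OF n, of x0] unfolding A_def by auto
  qed
  have "\<exists>m\<in>A. \<forall>a\<in>A. P m a \<longrightarrow> a = m"
  proof (rule predicate_Zorn[OF po])
    fix C assume C: "C \<in> Chains (relation_of P A)"
    then have CA: "C \<subseteq> A" and lin: "\<And>p q. p \<in> C \<Longrightarrow> q \<in> C \<Longrightarrow> p \<le> q \<or> q \<le> p"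
      unfolding Chains_def relation_of_def P_def by auto
    show "\<exists>u\<in>A. \<forall>a\<in>C. P a u"
    proof (cases "C = {}")
      case True then show ?thesis using nonempty by auto
    next
      case False
      (* The pointwise infimum of a chain is finite because every member lies above the negative norm. *)
      define u where "u x = (INF p\<in>C. p x)" for x
      have sub: "p \<in> C \<Longrightarrow> sublinear_below_norm p" for p using CA by (auto simp: A_def)
      have bdd: "bdd_below ((\<lambda>p. p x) ` C)" for x
        using sublinear_ge(1)[OF sub] by (auto simp: bdd_below_def)
      have up: "p \<in> C \<Longrightarrow> u x \<le> p x" for p x unfolding u_def by (rule cINF_lower[OF bdd])
      have ex: "\<exists>p\<in>C. p x < u x + e" if "e > 0" for x e
        using cINF_less_iff[OF False bdd, of x "u x + e"] that unfolding u_def by auto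
      have add: "u (x + z) \<le> u x + u z" for x z
      proof (rule field_le_epsilon)
        fix e :: real assume e: "e > 0"
        obtain p q where pq: "p \<in> C" "p x < u x + e/2" "q \<in> C" "q z < u z + e/2"
          using ex[of "e/2" x] ex[of "e/2" z] e by auto
        obtain r where r: "r \<in> C" "r x \<le> p x" "r z \<le> q z"
          using lin[OF pq(1,3)] pq by (auto simp: le_fun_def)
        have "u (x + z) \<le> r x + r z" using up[OF r(1), of "x+z"] sub[OF r(1)]
          unfolding sublinear_below_norm_def by (meson order_trans)
        then show "u (x + z) \<le> u x + u z + e" using r pq by simp
      qed
      have mul: "u (c *\<^sub>R x) = c * u x" if "c \<ge> 0" for c x
      proof -
        have "u (c *\<^sub>R x) = (INF p\<in>C. c * p x)"
          unfolding u_def by (rule INF_cong) (use sub that in \<open>auto simp: sublinear_below_norm_def\<close>)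
        also have "\<dots> = c * (INF p\<in>C. p x)"
        proof (cases "c = 0")
          case True then show ?thesis using False by simp
        next
          case c: False
          with that have "c > 0" by simp
          show ?thesis
          proof (rule antisym)
            have "(INF p\<in>C. c * p x) / c \<le> (INF p\<in>C. p x)"
            proof (rule cINF_greatest[OF False])
              fix p assume "p \<in> C"
              moreover have "bdd_below ((\<lambda>p. c * p x) ` C)"
                using sublinear_ge(1)[OF sub] \<open>c > 0\<close>
                by (intro bdd_belowI2[where m="c * - norm x"] mult_left_mono) auto
              ultimately have "(INF p\<in>C. c * p x) \<le> c * p x" by (intro cINF_lower)
              then show "(INF p\<in>C. c * p x) / c \<le> p x" using \<open>c > 0\<close> by (simp add: field_simps)
            qed
            then show "(INF p\<in>C. c * p x) \<le> c * (INF p\<in>C. p x)" using \<open>c > 0\<close> by (simp add: field_simps)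
            show "c * (INF p\<in>C. p x) \<le> (INF p\<in>C. c * p x)"
              by (rule cINF_greatest[OF False]) (use \<open>c > 0\<close> cINF_lower[OF bdd] in auto)
          qed
        qed
        finally show ?thesis by (simp add: u_def)
      qed
      have "sublinear_below_norm u" unfolding sublinear_below_norm_def
        using add mul up sub False unfolding sublinear_below_norm_def by (meson ex_in_conv order_trans)
      moreover have "u (- x0) \<le> - norm x0" using up CA False unfolding A_def
        by (smt (verit) ex_in_conv mem_Collect_eq subsetD)
      ultimately show ?thesis using up by (auto simp: A_def P_def le_fun_def)
    qed
  qed
  then obtain m where m: "m \<in> A" "\<And>a. a \<in> A \<Longrightarrow> a \<le> m \<Longrightarrow> a = m" unfolding P_def by blast
  have sm: "sublinear_below_norm m" and mx: "m (- x0) \<le> - norm x0" using m(1) by (auto simp: A_def)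
  (* Shifting a minimal element cannot decrease it. *)
  have neg: "m (- y) = - m y" for y
  proof -
    obtain q where q: "sublinear_below_norm q" "\<And>x. q x \<le> m x" "q (- y) \<le> - m y"
      using sublinear_shift[OF sm, of y] by blast
    have "q \<in> A" using q(1) order_trans[OF q(2)[of "- x0"] mx] by (simp add: A_def)
    then have "q = m" using q(2) by (intro m(2)) (auto simp: le_fun_def)
    then show ?thesis using q(3) sublinear_ge(2)[OF sm, of "- y"] sublinear_ge(2)[OF sm, of "y"] by simp
  qed
  have madd: "m (x + y) = m x + m y" for x y
  proof (rule antisym)
    show 1: "m (x + y) \<le> m x + m y" for x y using sm unfolding sublinear_below_norm_def by blast
    show "m x + m y \<le> m (x + y)" using 1[of "- x" "- y"] neg[of "x + y"] neg by simp
  qed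
  have mmul: "m (c *\<^sub>R x) = c * m x" for c x
  proof (cases "c \<ge> 0")
    case True then show ?thesis using sm unfolding sublinear_below_norm_def by blast
  next
    case False
    then have "m ((- c) *\<^sub>R x) = (- c) * m x"
      using sm unfolding sublinear_below_norm_def by (metis linear neg_0_le_iff_le)
    then show ?thesis using neg[of "c *\<^sub>R x"] by simp
  qed
  have le: "\<bar>m x\<bar> \<le> norm x" for x
    using sm neg[of x] sublinear_ge(1)[OF sm, of x] unfolding sublinear_below_norm_def by (simp add: abs_le_iff)
  show ?thesis
  proof
    show "bounded_linear m" by (rule bounded_linear_intro[where K=1]) (use madd mmul le in auto)
    show "\<bar>m x\<bar> \<le> norm x" for x by (rule le)
    show "m x0 = norm x0" using mx neg[of x0] le[of x0] by (simp add: abs_le_iff)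
  qed
qed

lemma bounded_clinear_scaleC: "bounded_clinear f \<Longrightarrow> f (c *\<^sub>C x) = c *\<^sub>C f x"
  and bounded_clinear_scaleR: "bounded_clinear f \<Longrightarrow> f (r *\<^sub>R x) = r *\<^sub>R f x"
  and bounded_clinear_bounded_linear: "bounded_clinear f \<Longrightarrow> bounded_linear f"
  by (auto simp: bounded_clinear_def linear_simps)

text \<open>The real functional \<open>g\<close> is the real part of the complex functional \<open>x \<mapsto> g x - \<i> g (\<i> x)\<close>;
rotating \<open>x\<close> until the value is real shows that the norm bound survives.\<close>

lemma Hahn_Banach_complex:
  fixes x0 :: "'a::complex_normed_vector"
  obtains f :: "'a \<Rightarrow> complex" where "bounded_clinear f" "\<And>x. norm (f x) \<le> norm x" "f x0 = norm x0"
proof -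
  obtain g :: "'a \<Rightarrow> real" where g: "bounded_linear g" "\<And>x. \<bar>g x\<bar> \<le> norm x" "g x0 = norm x0"
    using Hahn_Banach_real by blast
  define f where "f x = Complex (g x) (- g (\<i> *\<^sub>C x))" for x
  have ga: "g (x + y) = g x + g y" and gm: "g (r *\<^sub>R x) = r * g x" for x y r
    using g(1) by (auto simp: linear_simps)
  have fa: "f (x + y) = f x + f y" for x y
    by (simp add: f_def ga scaleC_add_right complex_eq_iff)
  have split: "c *\<^sub>C x = Re c *\<^sub>R x + Im c *\<^sub>R (\<i> *\<^sub>C x)" for c and x :: 'a
  proof -
    have "c = complex_of_real (Re c) + complex_of_real (Im c) * \<i>" by (simp add: complex_eq_iff)
    then have "c *\<^sub>C x = (complex_of_real (Re c) + complex_of_real (Im c) * \<i>) *\<^sub>C x" by metis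
    also have "\<dots> = Re c *\<^sub>R x + Im c *\<^sub>R (\<i> *\<^sub>C x)"
      by (simp only: scaleC_add_left scaleC_scaleC[symmetric] scaleC_of_real)
    finally show ?thesis .
  qed
  have ii: "\<i> *\<^sub>C \<i> *\<^sub>C x = - x" for x :: 'a
    using scaleC_scaleC[of \<i> \<i> x] scaleC_of_real[of "-1" x] by simp
  have fc: "f (c *\<^sub>C x) = c *\<^sub>C f x" for c x
  proof -
    have 1: "g (c *\<^sub>C x) = Re c * g x + Im c * g (\<i> *\<^sub>C x)" for c x by (subst split) (simp add: ga gm)
    have "g (\<i> *\<^sub>C c *\<^sub>C x) = g ((\<i> * c) *\<^sub>C x)" by (simp add: scaleC_scaleC)
    also have "\<dots> = - Im c * g x + Re c * g (\<i> *\<^sub>C x)" by (subst 1) simp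
    finally show ?thesis by (simp add: f_def 1[of c x] scaleC_complex_def complex_eq_iff)
  qed
  have fn: "norm (f x) \<le> norm x" for x
  proof (cases "f x = 0")
    case False
    define c where "c = cnj (sgn (f x))"
    have c1: "norm c = 1" using False by (simp add: c_def norm_sgn)
    have "c * f x = norm (f x)"
    proof -
      have "c * f x = cnj (f x) * f x / norm (f x)" by (simp add: c_def sgn_eq)
      also have "\<dots> = norm (f x) ^ 2 / norm (f x)"
        by (metis complex_norm_square mult.commute of_real_divide)
      finally show ?thesis by (simp add: power2_eq_square)
    qed
    then have "f (c *\<^sub>C x) = norm (f x)" using fc[of c x] by (simp add: scaleC_complex_def)
    then have "g (c *\<^sub>C x) = norm (f x)" by (simp add: f_def complex_eq_iff)
    then have "norm (f x) \<le> norm (c *\<^sub>C x)" using g(2)[of "c *\<^sub>C x"] by simp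
    then show ?thesis using c1 by (simp add: norm_scaleC)
  qed simp
  have fr: "f (r *\<^sub>R x) = r *\<^sub>R f x" for r x
    using fc[of "complex_of_real r" x] by (simp add: scaleC_of_real)
  show ?thesis
  proof
    show "bounded_clinear f" unfolding bounded_clinear_def
      using bounded_linear_intro[where K=1 and f=f] fa fr fn fc by simp
    show "norm (f x) \<le> norm x" for x by (rule fn)
    have "Re (f x0) = norm x0" by (simp add: f_def g)
    moreover have "Im (f x0) = 0"
    proof -
      have "(Re (f x0))\<^sup>2 + (Im (f x0))\<^sup>2 \<le> (norm x0)\<^sup>2"
        using fn[of x0] by (metis cmod_power2 norm_ge_zero power_mono)
      then show ?thesis using \<open>Re (f x0) = norm x0\<close> by simp
    qed
    ultimately show "f x0 = norm x0" by (simp add: complex_eq_iff)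
  qed
qed

section \<open>Bochner integrals tested by functionals\<close>

lemma bounded_bilinear_scaleC:
  "bounded_bilinear (scaleC :: complex \<Rightarrow> 'a::complex_normed_vector \<Rightarrow> 'a)"
proof (unfold_locales)
  fix a b :: complex and r :: real and x y :: 'a
  show "(a + b) *\<^sub>C x = a *\<^sub>C x + b *\<^sub>C x" "a *\<^sub>C (x + y) = a *\<^sub>C x + a *\<^sub>C y"
    by (rule scaleC_add_left, rule scaleC_add_right)
  show "(r *\<^sub>R a) *\<^sub>C x = r *\<^sub>R a *\<^sub>C x"
    by (metis scaleC_of_real scaleC_scaleC scaleR_conv_of_real)
  show "a *\<^sub>C r *\<^sub>R x = r *\<^sub>R a *\<^sub>C x"
    by (metis scaleC_of_real scaleC_scaleC mult.commute)
  show "\<exists>K. \<forall>a (x::'a). norm (a *\<^sub>C x) \<le> norm a * norm x * K"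
    by (intro exI[of _ 1]) (simp add: norm_scaleC)
qed

text \<open>Lebesgue measure is complete, so changing a function on a null set keeps it measurable. Strong
measurability is only an almost everywhere statement, and this lemma converts it into Borel
measurability of functions with values in a separable space.\<close>

lemma borel_measurable_lebesgue_AE_eq:
  fixes f g :: "real \<Rightarrow> 'b::topological_space"
  assumes g: "g \<in> borel_measurable lebesgue" and ae: "AE t in lebesgue. f t = g t"
  shows "f \<in> borel_measurable lebesgue"
proof (rule measurableI)
  fix S :: "'b set" assume S: "S \<in> sets borel"
  obtain N where N: "{t. f t \<noteq> g t} \<subseteq> N" "N \<in> null_sets lebesgue"
    using ae by (auto elim!: AE_E simp: null_sets_def)
  have "{t. f t \<in> S \<and> t \<in> N} \<in> sets lebesgue"
    using N(2) by (rule completion.complete[rotated]) auto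
  moreover have "g -` S \<in> sets lebesgue" using measurable_sets[OF g S] by simp
  moreover have "f -` S = (g -` S - N) \<union> {t. f t \<in> S \<and> t \<in> N}" using N(1) by auto
  ultimately show "f -` S \<inter> space lebesgue \<in> sets lebesgue" using N(2) by auto
qed simp

lemma strongly_measurable_compose2:
  assumes f: "strongly_measurable f" and g: "strongly_measurable g"
    and h: "\<And>a b x y. a \<longlonglongrightarrow> x \<Longrightarrow> b \<longlonglongrightarrow> y \<Longrightarrow> (\<lambda>n. h (a n) (b n)) \<longlonglongrightarrow> h x y"
  shows "strongly_measurable (\<lambda>t. h (f t) (g t))"
proof -
  obtain s r where s: "\<And>n. simple_function lebesgue (s n)" "AE t in lebesgue. (\<lambda>n. s n t) \<longlonglongrightarrow> f t"
    and r: "\<And>n. simple_function lebesgue (r n)" "AE t in lebesgue. (\<lambda>n. r n t) \<longlonglongrightarrow> g t"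
    using f g unfolding strongly_measurable_def by blast
  have "AE t in lebesgue. (\<lambda>n. h (s n t) (r n t)) \<longlonglongrightarrow> h (f t) (g t)"
    using s(2) r(2) by eventually_elim (rule h)
  then show ?thesis unfolding strongly_measurable_def
    using simple_function_compose2[OF s(1) r(1), where h=h]
    by (intro exI[of _ "\<lambda>n t. h (s n t) (r n t)"]) auto
qed

lemma strongly_measurable_simple: "simple_function lebesgue f \<Longrightarrow> strongly_measurable f"
  unfolding strongly_measurable_def by (intro exI[of _ "\<lambda>n. f"]) auto

lemma strongly_measurable_const: "strongly_measurable (\<lambda>t. c)"
  by (rule strongly_measurable_simple) simp

lemma strongly_measurable_borel:
  fixes f :: "real \<Rightarrow> 'b::{real_normed_vector, second_countable_topology}"
  assumes "f \<in> borel_measurable lebesgue"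
  shows "strongly_measurable f"
proof -
  obtain F where "\<And>i. simple_function lebesgue (F i)" "\<And>x. (\<lambda>i. F i x) \<longlonglongrightarrow> f x"
    using borel_measurable_implies_sequence_metric[OF assms, of 0] by (auto simp del: fun_upd_apply)
  then show ?thesis unfolding strongly_measurable_def by blast
qed

lemma strongly_measurable_add:
  "strongly_measurable f \<Longrightarrow> strongly_measurable g \<Longrightarrow> strongly_measurable (\<lambda>t. f t + g t)"
  by (rule strongly_measurable_compose2) (auto intro: tendsto_add)

lemma strongly_measurable_diff:
  "strongly_measurable f \<Longrightarrow> strongly_measurable g \<Longrightarrow> strongly_measurable (\<lambda>t. f t - g t)"
  by (rule strongly_measurable_compose2) (auto intro: tendsto_diff)

lemma strongly_measurable_sum:
  "(\<And>k. k \<in> S \<Longrightarrow> strongly_measurable (f k)) \<Longrightarrow> strongly_measurable (\<lambda>t. \<Sum>k\<in>S. f k t)"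
  by (induction S rule: infinite_finite_induct)
     (auto intro: strongly_measurable_add strongly_measurable_const)

lemma strongly_measurable_scaleC:
  "f \<in> borel_measurable lebesgue \<Longrightarrow> strongly_measurable g \<Longrightarrow> strongly_measurable (\<lambda>t. f t *\<^sub>C g t)"
  by (rule strongly_measurable_compose2[OF strongly_measurable_borel])
     (auto intro: bounded_bilinear.tendsto[OF bounded_bilinear_scaleC])

lemma borel_measurable_strongly_measurable:
  fixes \<phi> :: "'a::real_normed_vector \<Rightarrow> 'b::{metric_space, second_countable_topology}"
  assumes f: "strongly_measurable f" and \<phi>: "\<And>x. isCont \<phi> x"
  shows "(\<lambda>t. \<phi> (f t)) \<in> borel_measurable lebesgue"
proof -
  obtain s where s: "\<And>n. simple_function lebesgue (s n)" "AE t in lebesgue. (\<lambda>n. s n t) \<longlonglongrightarrow> f t"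
    using f unfolding strongly_measurable_def by blast
  obtain N where N: "{t. \<not> (\<lambda>n. s n t) \<longlonglongrightarrow> f t} \<subseteq> N" "N \<in> null_sets lebesgue"
    using s(2) by (auto elim!: AE_E simp: null_sets_def)
  define g where "g t = (if t \<in> N then \<phi> 0 else \<phi> (f t))" for t
  have Nm: "N \<in> sets lebesgue" using N(2) by auto
  have 1: "(\<lambda>t. \<phi> (s n t)) \<in> borel_measurable lebesgue" for n
    by (rule borel_measurable_simple_function) (rule simple_function_compose1[OF s(1)])
  have "g \<in> borel_measurable lebesgue"
  proof (rule borel_measurable_LIMSEQ_metric)
    show "(\<lambda>t. if t \<in> N then \<phi> 0 else \<phi> (s n t)) \<in> borel_measurable lebesgue" for n
      using 1 Nm by (intro measurable_If_set) auto
    show "(\<lambda>n. if t \<in> N then \<phi> 0 else \<phi> (s n t)) \<longlonglongrightarrow> g t" for t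
      using N(1) isCont_tendsto_compose[OF \<phi>] by (auto simp: g_def)
  qed
  moreover have "AE t in lebesgue. \<phi> (f t) = g t"
    using AE_not_in[OF N(2)] by eventually_elim (auto simp: g_def)
  ultimately show ?thesis by (rule borel_measurable_lebesgue_AE_eq)
qed

lemma strongly_measurable_norm: "strongly_measurable f \<Longrightarrow> (\<lambda>t. norm (f t)) \<in> borel_measurable lebesgue"
  by (rule borel_measurable_strongly_measurable) auto

lemma strongly_measurable_bounded_linear:
  fixes l :: "'a::real_normed_vector \<Rightarrow> 'b::{real_normed_vector, second_countable_topology}"
  shows "strongly_measurable f \<Longrightarrow> bounded_linear l \<Longrightarrow> (\<lambda>t. l (f t)) \<in> borel_measurable lebesgue"
  by (rule borel_measurable_strongly_measurable) (auto intro: linear_continuous_at)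

text \<open>Bounded functionals map the approximating simple functions to approximating simple functions.
With norming functionals this turns identities between vector-valued integrals into identities
between complex-valued integrals, to which Fubini and dominated convergence apply even if the
space itself is not separable.\<close>

lemma has_bochner_bounded_linear:
  fixes f :: "real \<Rightarrow> 'a::real_normed_vector"
    and l :: "'a \<Rightarrow> 'b::{banach, second_countable_topology}"
  assumes f: "has_bochner f x" and l: "bounded_linear l"
  shows "has_bochner_integral lebesgue (\<lambda>t. l (f t)) (l x)"
proof -
  obtain s where fm: "strongly_measurable f"
    and s: "\<And>n. Bochner_Integration.simple_bochner_integrable lebesgue (s n)"
      "(\<lambda>n. \<integral>\<^sup>+t. ennreal (norm (f t - s n t)) \<partial>lebesgue) \<longlonglongrightarrow> 0"
      "(\<lambda>n. Bochner_Integration.simple_bochner_integral lebesgue (s n)) \<longlonglongrightarrow> x"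
    using f unfolding has_bochner_def by blast
  interpret l: bounded_linear l by fact
  obtain K where K: "K > 0" "\<And>x. norm (l x) \<le> norm x * K" using l.pos_bounded by blast
  have sm: "simple_function lebesgue (s n)" for n
    using s(1) by (auto elim: Bochner_Integration.simple_bochner_integrable.cases)
  show ?thesis
  proof (rule has_bochner_integral.intros)
    show "(\<lambda>t. l (f t)) \<in> borel_measurable lebesgue"
      by (rule strongly_measurable_bounded_linear[OF fm l])
    show "Bochner_Integration.simple_bochner_integrable lebesgue (\<lambda>t. l (s n t))" for n
      by (rule Bochner_Integration.simple_bochner_integrable_compose2[OF _ s(1)[of n] s(1)[of n], where p="\<lambda>a b. l a"])
        (rule l.zero)
    show "(\<lambda>n. Bochner_Integration.simple_bochner_integral lebesgue (\<lambda>t. l (s n t))) \<longlonglongrightarrow> l x"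
      by (subst Bochner_Integration.simple_bochner_integral_linear[OF l.linear_axioms s(1)]) (rule l.tendsto[OF s(3)])
    have "(\<lambda>n. ennreal K * (\<integral>\<^sup>+t. ennreal (norm (f t - s n t)) \<partial>lebesgue)) \<longlonglongrightarrow> ennreal K * 0"
      by (intro ennreal_tendsto_cmult s(2)) simp
    then have lim: "(\<lambda>n. ennreal K * (\<integral>\<^sup>+t. ennreal (norm (f t - s n t)) \<partial>lebesgue)) \<longlonglongrightarrow> 0" by simp
    show "(\<lambda>n. \<integral>\<^sup>+t. ennreal (norm (l (f t) - l (s n t))) \<partial>lebesgue) \<longlonglongrightarrow> 0"
    proof (rule tendsto_sandwich[OF _ _ tendsto_const lim])
      show "\<forall>\<^sub>F n in sequentially. (\<integral>\<^sup>+t. ennreal (norm (l (f t) - l (s n t))) \<partial>lebesgue)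
            \<le> ennreal K * (\<integral>\<^sup>+t. ennreal (norm (f t - s n t)) \<partial>lebesgue)"
      proof (rule always_eventually, rule allI)
        fix n
        have meas: "(\<lambda>t. norm (f t - s n t)) \<in> borel_measurable lebesgue"
          by (intro strongly_measurable_norm strongly_measurable_diff fm strongly_measurable_simple sm)
        have "(\<integral>\<^sup>+t. ennreal (norm (l (f t) - l (s n t))) \<partial>lebesgue)
            \<le> (\<integral>\<^sup>+t. ennreal K * ennreal (norm (f t - s n t)) \<partial>lebesgue)"
          using K(2) K(1) by (intro nn_integral_mono)
            (auto simp: l.diff[symmetric] mult.commute ennreal_mult[symmetric] intro!: ennreal_leI)
        also have "\<dots> = ennreal K * (\<integral>\<^sup>+t. ennreal (norm (f t - s n t)) \<partial>lebesgue)"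
          by (rule nn_integral_cmult) (use meas in measurable)
        finally show "(\<integral>\<^sup>+t. ennreal (norm (l (f t) - l (s n t))) \<partial>lebesgue)
            \<le> ennreal K * (\<integral>\<^sup>+t. ennreal (norm (f t - s n t)) \<partial>lebesgue)" .
      qed
    qed auto
  qed
qed

lemma functionals_separate:
  fixes x y :: "'a::complex_normed_vector"
  assumes "\<And>l :: 'a \<Rightarrow> complex. bounded_clinear l \<Longrightarrow> l x = l y"
  shows "x = y"
proof -
  obtain l :: "'a \<Rightarrow> complex" where l: "bounded_clinear l" "l (x - y) = norm (x - y)"
    using Hahn_Banach_complex by blast
  have "l (x - y) = 0"
    using assms[OF l(1)] bounded_clinear_bounded_linear[OF l(1)] by (simp add: linear_simps)
  with l(2) show ?thesis by simp
qed

lemma has_bochner_unique: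
  fixes f :: "real \<Rightarrow> 'a::complex_normed_vector"
  assumes "has_bochner f x" "has_bochner f y" shows "x = y"
proof (rule functionals_separate)
  fix l :: "'a \<Rightarrow> complex" assume "bounded_clinear l"
  then have "bounded_linear l" by (rule bounded_clinear_bounded_linear)
  then show "l x = l y"
    using has_bochner_bounded_linear[OF assms(1), of l] has_bochner_bounded_linear[OF assms(2), of l]
    by (metis has_bochner_integral_eq)
qed

lemma bochner_eq:
  fixes f :: "real \<Rightarrow> 'a::complex_normed_vector"
  assumes "has_bochner f x" shows "bochner f = x"
proof -
  have "(THE x. has_bochner f x) = x" using assms has_bochner_unique[OF _ assms] by (rule the_equality)
  with assms show ?thesis unfolding bochner_def by auto
qed

text \<open>The usual argument: the approximating simple functions can be truncated so that they are
dominated by \<open>2 * norm (f t)\<close>, and dominated convergence makes their integrals a Cauchy sequence.\<close>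

lemma has_bochner_bochner:
  fixes f :: "real \<Rightarrow> 'a::cbanach"
  assumes fm: "strongly_measurable f" and fin: "(\<integral>\<^sup>+t. ennreal (norm (f t)) \<partial>lebesgue) < \<infinity>"
  shows "has_bochner f (bochner f)"
proof -
  let ?I = "Bochner_Integration.simple_bochner_integral lebesgue"
  obtain s where s: "\<And>n. simple_function lebesgue (s n)" "AE t in lebesgue. (\<lambda>n. s n t) \<longlonglongrightarrow> f t"
    using fm unfolding strongly_measurable_def by blast
  (* Where f t is not zero the truncation is void for large n; where f t = 0 it forces the value 0. *)
  define r where "r n t = (if norm (s n t) \<le> 2 * norm (f t) then s n t else 0)" for n t
  have nf[measurable]: "(\<lambda>t. norm (f t)) \<in> borel_measurable lebesgue" by (rule strongly_measurable_norm[OF fm])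
  have ns[measurable]: "(\<lambda>t. norm (s n t)) \<in> borel_measurable lebesgue" for n
    by (rule strongly_measurable_norm, rule strongly_measurable_simple, rule s(1))
  have r: "simple_function lebesgue (r n)" for n
    unfolding r_def by (rule simple_function_If[OF s(1)]) (simp, measurable)
  have rle: "norm (r n t) \<le> 2 * norm (f t)" for n t by (simp add: r_def)
  have finr: "(\<integral>\<^sup>+t. ennreal (norm (r n t)) \<partial>lebesgue) < \<infinity>" for n
  proof -
    have "(\<integral>\<^sup>+t. ennreal (norm (r n t)) \<partial>lebesgue) \<le> (\<integral>\<^sup>+t. 2 * ennreal (norm (f t)) \<partial>lebesgue)"
      using rle by (intro nn_integral_mono) (auto simp: ennreal_mult'[symmetric] simp flip: ennreal_numeral intro!: ennreal_leI)
    also have "\<dots> = 2 * (\<integral>\<^sup>+t. ennreal (norm (f t)) \<partial>lebesgue)" by (rule nn_integral_cmult) measurable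
    also have "\<dots> < \<infinity>" using fin by (simp add: ennreal_mult_less_top)
    finally show ?thesis .
  qed
  have rb: "Bochner_Integration.simple_bochner_integrable lebesgue (r n)" for n
    by (rule simple_bochner_integrableI_bounded[OF r finr])
  have rlim: "AE t in lebesgue. (\<lambda>n. r n t) \<longlonglongrightarrow> f t"
    using s(2)
  proof eventually_elim
    fix t assume *: "(\<lambda>n. s n t) \<longlonglongrightarrow> f t"
    show "(\<lambda>n. r n t) \<longlonglongrightarrow> f t"
    proof (cases "f t = 0")
      case True then show ?thesis by (auto simp: r_def intro!: tendsto_eventually)
    next
      case False
      then have "\<forall>\<^sub>F n in sequentially. norm (s n t) < 2 * norm (f t)"
        by (intro order_tendstoD(2)[OF tendsto_norm[OF *]]) simp
      then have "\<forall>\<^sub>F n in sequentially. s n t = r n t"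
        by eventually_elim (simp add: r_def)
      then show ?thesis using * by (rule Lim_transform_eventually[rotated])
    qed
  qed
  have dm[measurable]: "(\<lambda>t. norm (f t - r n t)) \<in> borel_measurable lebesgue" for n
    by (intro strongly_measurable_norm strongly_measurable_diff fm strongly_measurable_simple r)
  have lim0: "(\<lambda>n. \<integral>\<^sup>+t. ennreal (norm (f t - r n t)) \<partial>lebesgue) \<longlonglongrightarrow> (\<integral>\<^sup>+(t::real). 0 \<partial>lebesgue)"
  proof (rule nn_integral_dominated_convergence[where w="\<lambda>t. ennreal (3 * norm (f t))"])
    show "AE t in lebesgue. ennreal (norm (f t - r n t)) \<le> ennreal (3 * norm (f t))" for n
    proof (rule AE_I2)
      fix t show "ennreal (norm (f t - r n t)) \<le> ennreal (3 * norm (f t))"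
        using norm_triangle_ineq4[of "f t" "r n t"] rle[of n t] by (intro ennreal_leI) linarith
    qed
    have "(\<integral>\<^sup>+t. ennreal (3 * norm (f t)) \<partial>lebesgue) = (\<integral>\<^sup>+t. 3 * ennreal (norm (f t)) \<partial>lebesgue)"
      by (simp add: ennreal_mult')
    also have "\<dots> = 3 * (\<integral>\<^sup>+t. ennreal (norm (f t)) \<partial>lebesgue)" by (rule nn_integral_cmult) measurable
    also have "\<dots> < \<infinity>" using fin by (simp add: ennreal_mult_less_top)
    finally show "(\<integral>\<^sup>+t. ennreal (3 * norm (f t)) \<partial>lebesgue) < \<infinity>" .
    show "AE t in lebesgue. (\<lambda>n. ennreal (norm (f t - r n t))) \<longlonglongrightarrow> 0"
      using rlim
    proof eventually_elim
      fix t assume "(\<lambda>n. r n t) \<longlonglongrightarrow> f t"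
      then have "(\<lambda>n. norm (f t - r n t)) \<longlonglongrightarrow> norm (f t - f t)" by (intro tendsto_intros)
      then show "(\<lambda>n. ennreal (norm (f t - r n t))) \<longlonglongrightarrow> 0"
        using tendsto_ennrealI by fastforce
    qed
  qed measurable
  have bound: "ennreal (norm (?I (r n) -
        ?I (r m)))
      \<le> (\<integral>\<^sup>+t. ennreal (norm (f t - r n t)) \<partial>lebesgue) + (\<integral>\<^sup>+t. ennreal (norm (f t - r m t)) \<partial>lebesgue)"
    for n m
  proof -
    have d: "Bochner_Integration.simple_bochner_integrable lebesgue (\<lambda>t. r n t - r m t)"
      using Bochner_Integration.simple_bochner_integrable_compose2[OF _ rb[of n] rb[of m], where p="\<lambda>a b. a - b"] by simp
    then have d': "Bochner_Integration.simple_bochner_integrable lebesgue (\<lambda>t. norm (r n t - r m t))"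
      using Bochner_Integration.simple_bochner_integrable_compose2[OF _ d d, where p="\<lambda>a b. norm a"] by simp
    have "norm (?I (r n) -
        ?I (r m))
        \<le> ?I (\<lambda>t. norm (r n t - r m t))"
      unfolding Bochner_Integration.simple_bochner_integral_diff[OF rb rb, symmetric]
      by (rule Bochner_Integration.simple_bochner_integral_norm_bound[OF d])
    then have "ennreal (norm (?I (r n) -
        ?I (r m)))
      \<le> ennreal (?I (\<lambda>t. norm (r n t - r m t)))"
      by (rule ennreal_leI)
    also have "\<dots> = (\<integral>\<^sup>+t. ennreal (norm (r n t - r m t)) \<partial>lebesgue)"
      by (rule Bochner_Integration.simple_bochner_integral_eq_nn_integral[OF d']) simp
    also have "\<dots> \<le> (\<integral>\<^sup>+t. ennreal (norm (f t - r n t)) + ennreal (norm (f t - r m t)) \<partial>lebesgue)"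
    proof (rule nn_integral_mono)
      fix t
      show "ennreal (norm (r n t - r m t)) \<le> ennreal (norm (f t - r n t)) + ennreal (norm (f t - r m t))"
        using norm_triangle_ineq4[of "f t - r m t" "f t - r n t"]
        by (simp add: ennreal_plus[symmetric] algebra_simps del: ennreal_plus) 
    qed
    also have "\<dots> = (\<integral>\<^sup>+t. ennreal (norm (f t - r n t)) \<partial>lebesgue) + (\<integral>\<^sup>+t. ennreal (norm (f t - r m t)) \<partial>lebesgue)"
      by (rule nn_integral_add) measurable
    finally show ?thesis .
  qed
  have "Cauchy (\<lambda>n. ?I (r n))"
  proof (rule metric_CauchyI)
    fix e :: real assume e: "e > 0"
    have "\<forall>\<^sub>F n in sequentially. (\<integral>\<^sup>+t. ennreal (norm (f t - r n t)) \<partial>lebesgue) < ennreal (e/2)"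
      using lim0 e by (intro order_tendstoD(2)[OF lim0]) auto
    then obtain N where N: "\<And>n. n \<ge> N \<Longrightarrow> (\<integral>\<^sup>+t. ennreal (norm (f t - r n t)) \<partial>lebesgue) < ennreal (e/2)"
      by (auto simp: eventually_sequentially)
    show "\<exists>N. \<forall>m\<ge>N. \<forall>n\<ge>N. dist (?I (r m))
        (?I (r n)) < e"
    proof (intro exI[of _ N] allI impI)
      fix m n assume "N \<le> m" "N \<le> n"
      then have "ennreal (norm (?I (r m) -
        ?I (r n))) < ennreal (e/2) + ennreal (e/2)"
        by (intro le_less_trans[OF bound] add_strict_mono N) auto
      also have "\<dots> = ennreal e" using e by (simp add: ennreal_plus[symmetric] del: ennreal_plus)
      finally show "dist (?I (r m))
        (?I (r n)) < e"
        by (simp add: dist_norm ennreal_less_iff)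
    qed
  qed
  then obtain x where x: "(\<lambda>n. ?I (r n)) \<longlonglongrightarrow> x"
    using Cauchy_convergent_iff convergent_def by blast
  have "has_bochner f x"
    unfolding has_bochner_def using fm rb lim0 x by (auto intro!: exI[of _ r])
  then show ?thesis using bochner_eq by metis
qed

lemma bochner_functional:
  fixes f :: "real \<Rightarrow> 'a::cbanach" and l :: "'a \<Rightarrow> 'b::{banach, second_countable_topology}"
  assumes "strongly_measurable f" "(\<integral>\<^sup>+t. ennreal (norm (f t)) \<partial>lebesgue) < \<infinity>" "bounded_linear l"
  shows "integrable lebesgue (\<lambda>t. l (f t))" "l (bochner f) = (\<integral>t. l (f t) \<partial>lebesgue)"
  using has_bochner_bounded_linear[OF has_bochner_bochner[OF assms(1,2)] assms(3)]
  by (auto simp: has_bochner_integral_iff)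

lemma bochner_sum_scaleC:
  fixes z :: "'k \<Rightarrow> 'a::cbanach"
  assumes "\<And>k. k \<in> S \<Longrightarrow> integrable lebesgue (\<phi> k)"
  shows "bochner (\<lambda>t. \<Sum>k\<in>S. \<phi> k t *\<^sub>C z k) = (\<Sum>k\<in>S. (\<integral>t. \<phi> k t \<partial>lebesgue) *\<^sub>C z k)"
proof (rule functionals_separate)
  fix l :: "'a \<Rightarrow> complex" assume l: "bounded_clinear l"
  have m: "strongly_measurable (\<lambda>t. \<Sum>k\<in>S. \<phi> k t *\<^sub>C z k)"
    by (intro strongly_measurable_sum strongly_measurable_scaleC strongly_measurable_const
          borel_measurable_integrable assms)
  have ls: "l (\<Sum>k\<in>S. w k *\<^sub>C z k) = (\<Sum>k\<in>S. w k * l (z k))" for w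
    using bounded_clinear_bounded_linear[OF l]
    by (simp add: linear_sum bounded_linear.linear bounded_clinear_scaleC[OF l] scaleC_complex_def)
  have "(\<integral>\<^sup>+t. ennreal (norm (\<Sum>k\<in>S. \<phi> k t *\<^sub>C z k)) \<partial>lebesgue)
      \<le> (\<integral>\<^sup>+t. ennreal (\<Sum>k\<in>S. norm (\<phi> k t) * norm (z k)) \<partial>lebesgue)"
    by (intro nn_integral_mono ennreal_leI) (auto intro!: norm_sum[THEN order_trans] simp: norm_scaleC)
  also have "\<dots> = ennreal (\<integral>t. (\<Sum>k\<in>S. norm (\<phi> k t) * norm (z k)) \<partial>lebesgue)"
    by (intro nn_integral_eq_integral Bochner_Integration.integrable_sum integrable_mult_left
        integrable_norm assms) (auto intro!: sum_nonneg)
  also have "\<dots> < \<infinity>" by simp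
  finally have "l (bochner (\<lambda>t. \<Sum>k\<in>S. \<phi> k t *\<^sub>C z k)) = (\<integral>t. l (\<Sum>k\<in>S. \<phi> k t *\<^sub>C z k) \<partial>lebesgue)"
    by (intro bochner_functional m bounded_clinear_bounded_linear l)
  also have "\<dots> = (\<Sum>k\<in>S. \<integral>t. \<phi> k t * l (z k) \<partial>lebesgue)"
    unfolding ls by (intro Bochner_Integration.integral_sum integrable_mult_left assms)
  also have "\<dots> = l (\<Sum>k\<in>S. (\<integral>t. \<phi> k t \<partial>lebesgue) *\<^sub>C z k)"
    unfolding ls by simp
  finally show "l (bochner (\<lambda>t. \<Sum>k\<in>S. \<phi> k t *\<^sub>C z k)) = l (\<Sum>k\<in>S. (\<integral>t. \<phi> k t \<partial>lebesgue) *\<^sub>C z k)" .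
qed

section \<open>Fubini identities and Gaussian smoothing\<close>

lemma integrable_mult_bounded:
  fixes f h :: "real \<Rightarrow> complex"
  assumes f: "integrable M f" and h: "h \<in> borel_measurable M" "\<And>x. norm (h x) \<le> C"
  shows "integrable M (\<lambda>x. f x * h x)"
proof (rule Bochner_Integration.integrable_bound[of _ "\<lambda>x. C * norm (f x)"])
  show "AE x in M. norm (f x * h x) \<le> norm (C * norm (f x))"
  proof (rule AE_I2)
    fix x show "norm (f x * h x) \<le> norm (C * norm (f x))"
      using mult_left_mono[OF h(2)[of x], of "norm (f x)"] order_trans[OF norm_ge_zero h(2)[of x]]
      by (simp add: norm_mult mult.commute)
  qed
qed (use assms in auto)

lemma integrable_lborel_shift:
  fixes G :: "real \<Rightarrow> complex"
  assumes "integrable lborel G"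
  shows "integrable lborel (\<lambda>t. G (t - u))" "(LBINT t. norm (G (t - u))) = (LBINT t. norm (G t))"
  using lborel_integrable_real_affine[OF assms, of 1 "-u"]
    lborel_integral_real_affine[of 1 "\<lambda>t. norm (G t)" "-u"]
  by (simp_all add: algebra_simps)

text \<open>The parameter \<open>c\<close> covers both product kernels (\<open>c = 0\<close>) and convolutions (\<open>c = 1\<close>).\<close>

lemma integrable_kernel_product:
  fixes f G :: "real \<Rightarrow> complex" and h :: "real \<Rightarrow> real \<Rightarrow> complex"
  assumes f: "integrable lborel f" and G: "integrable lborel G"
    and h: "case_prod h \<in> borel_measurable (lborel \<Otimes>\<^sub>M lborel)" "\<And>x y. norm (h x y) \<le> C"
  shows "integrable (lborel \<Otimes>\<^sub>M lborel) (\<lambda>(x, y). f x * (G (y - c * x) * h x y))"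
proof (rule lborel_pair.Fubini_integrable)
  have [measurable]: "f \<in> borel_measurable borel" "G \<in> borel_measurable borel"
    using f G by auto
  have [measurable]: "(\<lambda>(x, y). h x y) \<in> borel_measurable (lborel \<Otimes>\<^sub>M lborel)" using h(1) by simp
  show "(\<lambda>(x, y). f x * (G (y - c * x) * h x y)) \<in> borel_measurable (lborel \<Otimes>\<^sub>M lborel)" by measurable
  have hy: "(\<lambda>y. h x y) \<in> borel_measurable lborel" for x
    using measurable_compose[OF measurable_Pair1' h(1), of x] by simp
  have Gh: "integrable lborel (\<lambda>y. G (y - c * x) * h x y)" for x
    by (rule integrable_mult_bounded[OF integrable_lborel_shift(1)[OF G] hy h(2)])
  have bd: "(LBINT y. norm (G (y - c * x) * h x y)) \<le> C * (LBINT y. norm (G y))" for x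
  proof -
    have "(LBINT y. norm (G (y - c * x) * h x y)) \<le> (LBINT y. C * norm (G (y - c * x)))"
    proof (rule integral_mono[OF integrable_norm[OF Gh]])
      show "norm (G (y - c * x) * h x y) \<le> C * norm (G (y - c * x))" for y
        using mult_right_mono[OF h(2)[of x y], of "norm (G (y - c * x))"] by (simp add: norm_mult mult.commute)
    qed (use integrable_lborel_shift(1)[OF G] in auto)
    then show ?thesis by (simp add: integrable_lborel_shift(2)[OF G])
  qed
  have "integrable lborel (\<lambda>x. norm (f x) * (LBINT y. norm (G (y - c * x) * h x y)))"
  proof (rule Bochner_Integration.integrable_bound[of _ "\<lambda>x. norm (f x) * (C * (LBINT y. norm (G y)))"])
    have "(\<lambda>x. LBINT y. norm (G (y - c * x) * h x y)) \<in> borel_measurable lborel"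
      by (rule lborel.borel_measurable_lebesgue_integral) measurable
    then show "(\<lambda>x. norm (f x) * (LBINT y. norm (G (y - c * x) * h x y))) \<in> borel_measurable lborel" by measurable
    have "0 \<le> (LBINT y. norm (G (y - c * x) * h x y))" for x by simp
    then show "AE x in lborel. norm (norm (f x) * (LBINT y. norm (G (y - c * x) * h x y)))
        \<le> norm (norm (f x) * (C * (LBINT y. norm (G y))))"
      using bd unfolding norm_mult[of "norm (f _)"]
      by (intro AE_I2 mult_left_mono) (auto intro!: order_trans[OF bd abs_ge_self])
  qed (use f in auto)
  then show "integrable lborel (\<lambda>x. LBINT y. norm (case (x, y) of (x, y) \<Rightarrow> f x * (G (y - c * x) * h x y)))"
    by (simp add: norm_mult mult.assoc)
  show "AE x in lborel. integrable lborel (\<lambda>y. case (x, y) of (x, y) \<Rightarrow> f x * (G (y - c * x) * h x y))"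
    using Gh by (auto intro!: AE_I2 integrable_mult_right)
qed

lemma Fubini_bounded_kernel:
  fixes f g :: "real \<Rightarrow> complex" and h :: "real \<Rightarrow> real \<Rightarrow> complex"
  assumes f: "integrable lborel f" and g: "integrable lborel g"
    and h: "case_prod h \<in> borel_measurable (lborel \<Otimes>\<^sub>M lborel)" "\<And>x y. norm (h x y) \<le> C"
  shows "(LBINT x. f x * (LBINT y. g y * h x y)) = (LBINT y. g y * (LBINT x. f x * h x y))"
proof -
  have "integrable (lborel \<Otimes>\<^sub>M lborel) (\<lambda>(x, y). f x * (g y * h x y))"
    using integrable_kernel_product[OF f g h, of 0] by simp
  from lborel_pair.Fubini_integral[OF this]
  have "(LBINT x. f x * (LBINT y. g y * h x y)) = (LBINT y. (LBINT x. f x * (g y * h x y)))"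
    by simp
  also have "(\<lambda>y. LBINT x. f x * (g y * h x y)) = (\<lambda>y. g y * (LBINT x. f x * h x y))"
    unfolding integral_mult_right_zero[symmetric] by (simp only: mult.left_commute)
  finally show ?thesis .
qed

lemma Fubini_convolution:
  fixes f G h :: "real \<Rightarrow> complex"
  assumes f: "integrable lborel f" and G: "integrable lborel G"
    and h: "h \<in> borel_measurable lborel" "\<And>x. norm (h x) \<le> C"
  shows "(LBINT t. h t * (LBINT u. f u * G (t - u))) = (LBINT u. f u * (LBINT t. h t * G (t - u)))"
    and "integrable lborel (\<lambda>t. LBINT u. f u * G (t - u))"
proof -
  have "integrable (lborel \<Otimes>\<^sub>M lborel) (\<lambda>(u, t). f u * (G (t - u) * h t))"
    using integrable_kernel_product[OF f G, of "\<lambda>u t. h t" C 1] h by (simp add: case_prod_unfold)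
  from lborel_pair.Fubini_integral[OF this]
  have "(LBINT t. (LBINT u. f u * (G (t - u) * h t))) = (LBINT u. f u * (LBINT t. h t * G (t - u)))"
    by (simp add: mult.commute)
  moreover have "(\<lambda>t. LBINT u. f u * (G (t - u) * h t)) = (\<lambda>t. h t * (LBINT u. f u * G (t - u)))"
    unfolding integral_mult_right_zero[symmetric] by (simp only: mult_ac)
  ultimately show "(LBINT t. h t * (LBINT u. f u * G (t - u))) = (LBINT u. f u * (LBINT t. h t * G (t - u)))"
    by simp
  have "integrable (lborel \<Otimes>\<^sub>M lborel) (\<lambda>(u, t). f u * G (t - u))"
    using integrable_kernel_product[OF f G, of "\<lambda>u t. 1" 1 1] by (simp add: case_prod_unfold)
  then show "integrable lborel (\<lambda>t. LBINT u. f u * G (t - u))"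
    using lborel_pair.integrable_snd by fastforce
qed

lemma fourier_normal_density:
  assumes s: "s > 0"
  shows "integrable lborel (\<lambda>x. of_real (normal_density 0 s x) :: complex)"
    "(LBINT x. of_real (normal_density 0 s x) * iexp (c * x)) = of_real (exp (- (s\<^sup>2 * c\<^sup>2 / 2)))"
proof -
  show "integrable lborel (\<lambda>x. of_real (normal_density 0 s x) :: complex)"
    using integrable_normal_density[OF s] by (rule integrable_of_real)
  have "(LBINT x. of_real (normal_density 0 s x) * iexp (c * x))
      = \<bar>s\<bar> *\<^sub>R (LBINT x. of_real (normal_density 0 s (0 + s * x)) * iexp (c * (0 + s * x)))"
    by (rule lborel_integral_real_affine) (use s in simp)
  also have "\<dots> = (LBINT x. of_real (\<bar>s\<bar> * normal_density 0 s (s * x)) * iexp (c * s * x))"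
    by (simp add: scaleR_conv_of_real mult.assoc flip: integral_mult_right_zero)
  also have "(\<lambda>x. \<bar>s\<bar> * normal_density 0 s (s * x)) = std_normal_density"
    using s by (intro ext) (simp add: normal_density_def power_mult_distrib real_sqrt_mult)
  also have "(LBINT x. of_real (std_normal_density x) * iexp (c * s * x)) = char std_normal_distribution (c * s)"
    unfolding char_def by (subst integral_density) (auto simp: scaleR_conv_of_real)
  also have "\<dots> = of_real (exp (- (s\<^sup>2 * c\<^sup>2 / 2)))"
    unfolding char_std_normal_distribution by (simp add: power_mult_distrib mult.commute exp_of_real)
  finally show "(LBINT x. of_real (normal_density 0 s x) * iexp (c * x)) = of_real (exp (- (s\<^sup>2 * c\<^sup>2 / 2)))" .
qed

lemma fourier_gaussian:
  assumes r: "r > 0"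
  shows "integrable lborel (\<lambda>\<xi>. of_real (exp (- (r\<^sup>2 * \<xi>\<^sup>2 / 2))) :: complex)"
    "(LBINT \<xi>. of_real (exp (- (r\<^sup>2 * \<xi>\<^sup>2 / 2))) * iexp (x * \<xi>)) = of_real (2 * pi * normal_density 0 r x)"
proof -
  have eq: "exp (- (r\<^sup>2 * \<xi>\<^sup>2 / 2)) = (sqrt (2 * pi) / r) * normal_density 0 (1/r) \<xi>" for \<xi>
    using r by (simp add: normal_density_def real_sqrt_divide power_divide field_simps)
  have i: "integrable lborel (\<lambda>x. of_real (normal_density 0 (1/r) x) :: complex)"
    using fourier_normal_density(1)[of "1/r"] r by simp
  show "integrable lborel (\<lambda>\<xi>. of_real (exp (- (r\<^sup>2 * \<xi>\<^sup>2 / 2))) :: complex)"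
    unfolding eq using integrable_mult_right[OF i, of "of_real (sqrt (2 * pi) / r)"] by simp
  have "(LBINT \<xi>. of_real (exp (- (r\<^sup>2 * \<xi>\<^sup>2 / 2))) * iexp (x * \<xi>))
      = of_real (sqrt (2 * pi) / r) * (LBINT \<xi>. of_real (normal_density 0 (1/r) \<xi>) * iexp (x * \<xi>))"
    unfolding eq by (simp add: mult.assoc)
  also have "\<dots> = of_real (sqrt (2 * pi) / r * exp (- ((1/r)\<^sup>2 * x\<^sup>2 / 2)))"
    using fourier_normal_density(2)[of "1/r" x] r by (simp add: exp_of_real)
  also have "sqrt (2 * pi) / r * exp (- ((1/r)\<^sup>2 * x\<^sup>2 / 2)) = 2 * pi * normal_density 0 r x"
  proof -
    have "2 * pi = sqrt (2 * pi) * sqrt (2 * pi)" by simp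
    then have "2 * pi * normal_density 0 r x = sqrt (2 * pi) * (sqrt (2 * pi) * normal_density 0 r x)"
      by (metis mult.assoc)
    also have "sqrt (2 * pi) * normal_density 0 r x = exp (- ((1/r)\<^sup>2 * x\<^sup>2 / 2)) / r"
      using r by (simp add: normal_density_def real_sqrt_mult power_divide)
    finally show ?thesis by simp
  qed
  finally show "(LBINT \<xi>. of_real (exp (- (r\<^sup>2 * \<xi>\<^sup>2 / 2))) * iexp (x * \<xi>)) = of_real (2 * pi * normal_density 0 r x)" .
qed

text \<open>The indicator of an interval, convolved with the Gaussian density of standard deviation \<open>s\<close>. It is
a Schwartz function with an explicit Fourier transform and tends to the indicator as \<open>s\<close> tends to
zero.\<close>

definition smooth_ind :: "real \<Rightarrow> real \<Rightarrow> real \<Rightarrow> real \<Rightarrow> real" where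
  "smooth_ind s \<alpha> \<beta> t = (LBINT u. indicator {\<alpha>..<\<beta>} u * normal_density 0 s (t - u))"

text \<open>The scalar Fourier transform as an integral with respect to \<open>lborel\<close>; it is the one to which all
vector-valued transforms are reduced by functionals.\<close>

definition ft :: "(real \<Rightarrow> complex) \<Rightarrow> real \<Rightarrow> complex" where
  "ft f \<xi> = (LBINT x. f x * iexp (- (\<xi> * x)))"

text \<open>The length of the set of those \<open>u\<close> in the first interval whose translate \<open>u + r\<close> lies in the
second one. Integrating \<open>k\<close> against it is the same as integrating \<open>k (t - s)\<close> over \<open>s\<close> in the
first and \<open>t\<close> in the second interval.\<close>

definition overlap :: "real \<Rightarrow> real \<Rightarrow> real \<Rightarrow> real \<Rightarrow> real \<Rightarrow> complex" where
  "overlap \<alpha> \<beta> \<gamma> \<delta> r = (LBINT u. indicator {\<alpha>..<\<beta>} u * indicator {\<gamma>..<\<delta>} (u + r))"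

lemma integrable_indicator_ico: "integrable lborel (indicator {\<alpha>..<\<beta>::real} :: real \<Rightarrow> complex)"
  "integrable lborel (indicator {\<alpha>..<\<beta>::real} :: real \<Rightarrow> real)"
proof -
  have *: "emeasure lborel {\<alpha>..<\<beta>} < \<infinity>"
    by (cases "\<alpha> \<le> \<beta>") (auto simp: emeasure_lborel_Ico)
  show r: "integrable lborel (indicator {\<alpha>..<\<beta>::real} :: real \<Rightarrow> real)"
    using * by (intro integrable_real_indicator) auto
  have "(indicator {\<alpha>..<\<beta>::real} :: real \<Rightarrow> complex) = (\<lambda>x. of_real (indicator {\<alpha>..<\<beta>} x))"
    by (auto simp: indicator_def)
  then show "integrable lborel (indicator {\<alpha>..<\<beta>::real} :: real \<Rightarrow> complex)"
    using integrable_of_real[OF r] by simp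
qed

lemma norm_ft_le:
  assumes "integrable lborel f" shows "norm (ft f \<xi>) \<le> (LBINT x. norm (f x))"
  unfolding ft_def by (rule integral_norm_bound[THEN order_trans]) (simp add: norm_mult)

lemma ft_measurable [measurable]:
  assumes "integrable lborel f" shows "ft f \<in> borel_measurable borel"
proof -
  have [measurable]: "f \<in> borel_measurable borel" using assms by auto
  have "ft f \<in> borel_measurable lborel"
    unfolding ft_def[abs_def] by (rule lborel.borel_measurable_lebesgue_integral) measurable
  then show ?thesis by simp
qed

lemma smooth_ind_alt:
  assumes s: "s > 0"
  shows "smooth_ind s \<gamma> \<delta> y = (LBINT n. std_normal_density n * indicator {\<gamma>..<\<delta>} (y - s * n))"
proof -
  have "smooth_ind s \<gamma> \<delta> y = \<bar>-s\<bar> *\<^sub>R (LBINT n. indicator {\<gamma>..<\<delta>} (y + (-s) * n) * normal_density 0 s (y - (y + (-s) * n)))"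
    unfolding smooth_ind_def by (rule lborel_integral_real_affine) (use s in simp)
  also have "\<dots> = (LBINT n. (\<bar>s\<bar> * normal_density 0 s (s * n)) * indicator {\<gamma>..<\<delta>} (y - s * n))"
    by (simp add: mult.assoc mult.commute flip: integral_mult_right_zero)
  also have "(\<lambda>x. \<bar>s\<bar> * normal_density 0 s (s * x)) = std_normal_density"
    using s by (intro ext) (simp add: normal_density_def power_mult_distrib real_sqrt_mult)
  finally show ?thesis .
qed

lemma smooth_ind_nonneg: "smooth_ind s \<alpha> \<beta> t \<ge> 0"
  unfolding smooth_ind_def by (rule integral_nonneg_AE) auto

lemma integrable_std_normal_mult:
  assumes [measurable]: "f \<in> borel_measurable borel" and "\<And>x. \<bar>f x\<bar> \<le> 1"
  shows "integrable lborel (\<lambda>n. std_normal_density n * f n)"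
  by (rule Bochner_Integration.integrable_bound[of _ std_normal_density])
     (use assms in \<open>auto simp: abs_mult mult_left_le intro!: integrable_normal_density\<close>)

lemma smooth_ind_le_1:
  assumes s: "s > 0" shows "smooth_ind s \<alpha> \<beta> t \<le> 1"
proof -
  have "smooth_ind s \<alpha> \<beta> t \<le> (LBINT n. std_normal_density n)"
    unfolding smooth_ind_alt[OF s]
    by (rule integral_mono) (auto intro!: integrable_std_normal_mult integrable_normal_density mult_left_le simp: indicator_def)
  then show ?thesis by simp
qed

lemma smooth_ind_tendsto:
  assumes s: "\<And>n. s n > 0" "s \<longlonglongrightarrow> 0" and y: "y \<noteq> \<gamma>" "y \<noteq> \<delta>"
  shows "(\<lambda>n. smooth_ind (s n) \<gamma> \<delta> y) \<longlonglongrightarrow> indicator {\<gamma>..<\<delta>} y"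
proof -
  have "(\<lambda>n. LBINT x. std_normal_density x * indicator {\<gamma>..<\<delta>} (y - s n * x))
      \<longlonglongrightarrow> (LBINT x. std_normal_density x * indicator {\<gamma>..<\<delta>} y)"
  proof (rule integral_dominated_convergence[where w = std_normal_density])
    show "AE x in lborel. (\<lambda>n. std_normal_density x * indicator {\<gamma>..<\<delta>} (y - s n * x))
        \<longlonglongrightarrow> std_normal_density x * indicator {\<gamma>..<\<delta>} y"
    proof (rule AE_I2)
      fix x :: real
      have l: "(\<lambda>n. y - s n * x) \<longlonglongrightarrow> y - 0 * x" by (intro tendsto_intros s)
      have "\<forall>\<^sub>F n in sequentially. indicator {\<gamma>..<\<delta>} (y - s n * x) = (indicator {\<gamma>..<\<delta>} y :: real)"
      proof -
        consider "y < \<gamma>" | "y > \<delta>" | "\<gamma> < y" "y < \<delta>" using y by linarith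
        then show ?thesis
        proof cases
          case 1
          then have "\<forall>\<^sub>F n in sequentially. y - s n * x < \<gamma>" using l by (intro order_tendstoD) auto
          then show ?thesis by eventually_elim (use 1 in \<open>auto simp: indicator_def\<close>)
        next
          case 2
          then have "\<forall>\<^sub>F n in sequentially. y - s n * x > \<delta>" using l by (intro order_tendstoD) auto
          then show ?thesis by eventually_elim (use 2 in \<open>auto simp: indicator_def\<close>)
        next
          case 3
          then have "\<forall>\<^sub>F n in sequentially. y - s n * x > \<gamma>" "\<forall>\<^sub>F n in sequentially. y - s n * x < \<delta>"
            using l by (auto intro: order_tendstoD)
          then show ?thesis by eventually_elim (use 3 in \<open>auto simp: indicator_def\<close>)
        qed
      qed
      then have "\<forall>\<^sub>F n in sequentially. std_normal_density x * indicator {\<gamma>..<\<delta>} (y - s n * x)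
          = std_normal_density x * indicator {\<gamma>..<\<delta>} y" by eventually_elim simp
      then show "(\<lambda>n. std_normal_density x * indicator {\<gamma>..<\<delta>} (y - s n * x))
        \<longlonglongrightarrow> std_normal_density x * indicator {\<gamma>..<\<delta>} y" by (rule tendsto_eventually)
    qed
    show "AE x in lborel. norm (std_normal_density x * indicator {\<gamma>..<\<delta>} (y - s n * x)) \<le> std_normal_density x" for n
      by (auto simp: indicator_def)
  qed (auto intro!: integrable_normal_density)
  then show ?thesis by (simp add: smooth_ind_alt[OF s(1)])
qed

lemma smooth_ind_complex:
  "complex_of_real (smooth_ind s \<alpha> \<beta> t) = (LBINT u. indicator {\<alpha>..<\<beta>} u * of_real (normal_density 0 s (t - u)))"
proof -
  have "complex_of_real (smooth_ind s \<alpha> \<beta> t) = (LBINT u. complex_of_real (indicator {\<alpha>..<\<beta>} u * normal_density 0 s (t - u)))"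
    unfolding smooth_ind_def by (rule integral_complex_of_real[symmetric])
  also have "\<dots> = (LBINT u. indicator {\<alpha>..<\<beta>} u * of_real (normal_density 0 s (t - u)))"
    by (rule Bochner_Integration.integral_cong) (auto simp: indicator_def)
  finally show ?thesis .
qed

lemma smooth_ind_integrable:
  assumes s: "s > 0"
  shows "integrable lborel (\<lambda>t. complex_of_real (smooth_ind s \<alpha> \<beta> t))"
    "integrable lborel (smooth_ind s \<alpha> \<beta>)"
proof -
  show 1: "integrable lborel (\<lambda>t. complex_of_real (smooth_ind s \<alpha> \<beta> t))"
    unfolding smooth_ind_complex
    by (rule Fubini_convolution(2)[OF integrable_indicator_ico(1) fourier_normal_density(1)[OF s], of "\<lambda>_. 0" 0]) auto
  show "integrable lborel (smooth_ind s \<alpha> \<beta>)"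
    using integrable_bounded_linear[OF bounded_linear_Re 1] by simp
qed

text \<open>A convolution turns into a product, and the Gaussian density has a Gaussian as its transform.\<close>

lemma ft_smooth_ind:
  assumes s: "s > 0"
  shows "ft (\<lambda>t. of_real (smooth_ind s \<alpha> \<beta> t)) \<xi> = of_real (exp (- (s\<^sup>2 * \<xi>\<^sup>2 / 2))) * ft (indicator {\<alpha>..<\<beta>}) \<xi>"
proof -
  let ?G = "\<lambda>x. of_real (normal_density 0 s x) :: complex"
  have "ft (\<lambda>t. of_real (smooth_ind s \<alpha> \<beta> t)) \<xi> = (LBINT t. iexp (- (\<xi> * t)) * (LBINT u. indicator {\<alpha>..<\<beta>} u * ?G (t - u)))"
    unfolding ft_def smooth_ind_complex by (simp add: mult.commute)
  also have "\<dots> = (LBINT u. indicator {\<alpha>..<\<beta>} u * (LBINT t. iexp (- (\<xi> * t)) * ?G (t - u)))"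
    by (rule Fubini_convolution(1)[OF integrable_indicator_ico(1) fourier_normal_density(1)[OF s], of _ 1]) auto
  also have "(\<lambda>u. LBINT t. iexp (- (\<xi> * t)) * ?G (t - u)) = (\<lambda>u. iexp (- (\<xi> * u)) * of_real (exp (- (s\<^sup>2 * \<xi>\<^sup>2 / 2))))"
  proof
    fix u
    have "(LBINT t. iexp (- (\<xi> * t)) * ?G (t - u)) = (LBINT t. iexp (- (\<xi> * (u + 1 * t))) * ?G (u + 1 * t - u))"
      by (subst lborel_integral_real_affine[of 1 _ u]) auto
    also have "\<dots> = (LBINT t. iexp (- (\<xi> * u)) * (?G t * iexp ((- \<xi>) * t)))"
      by (rule Bochner_Integration.integral_cong) (auto simp: algebra_simps exp_add[symmetric])
    also have "\<dots> = iexp (- (\<xi> * u)) * of_real (exp (- (s\<^sup>2 * \<xi>\<^sup>2 / 2)))"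
      using fourier_normal_density(2)[OF s, of "- \<xi>"] by simp
    finally show "(LBINT t. iexp (- (\<xi> * t)) * ?G (t - u)) = iexp (- (\<xi> * u)) * of_real (exp (- (s\<^sup>2 * \<xi>\<^sup>2 / 2)))" .
  qed
  finally have "ft (\<lambda>t. of_real (smooth_ind s \<alpha> \<beta> t)) \<xi>
      = (LBINT u. indicator {\<alpha>..<\<beta>} u * iexp (- (\<xi> * u)) * of_real (exp (- (s\<^sup>2 * \<xi>\<^sup>2 / 2))))"
    by (simp only: mult.assoc)
  then show ?thesis unfolding ft_def integral_mult_left_zero by (simp only: mult.commute)
qed

lemma integral_smooth_ind:
  assumes s: "s > 0" and ab: "\<alpha> \<le> \<beta>"
  shows "(LBINT t. smooth_ind s \<alpha> \<beta> t) = \<beta> - \<alpha>"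
proof -
  have "complex_of_real (LBINT t. smooth_ind s \<alpha> \<beta> t) = ft (\<lambda>t. of_real (smooth_ind s \<alpha> \<beta> t)) 0"
    unfolding ft_def by simp
  also have "\<dots> = ft (indicator {\<alpha>..<\<beta>}) 0" unfolding ft_smooth_ind[OF s] by simp
  also have "\<dots> = complex_of_real (\<beta> - \<alpha>)"
  proof -
    have "ft (indicator {\<alpha>..<\<beta>}) 0 = (LBINT u. complex_of_real (indicator {\<alpha>..<\<beta>} u))"
      unfolding ft_def by (rule Bochner_Integration.integral_cong) (auto simp: indicator_def)
    also have "\<dots> = complex_of_real (LBINT u. indicator {\<alpha>..<\<beta>} u)" by (rule integral_complex_of_real)
    also have "(LBINT u. indicator {\<alpha>..<\<beta>} u) = \<beta> - \<alpha>" using ab by simp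
    finally show ?thesis .
  qed
  finally show ?thesis by (simp only: of_real_eq_iff)
qed

text \<open>This is Parseval's identity for the convolution of \<open>k\<close> with an interval, paired with a second
interval. The Gaussian factor makes all integrals absolutely convergent. Moving the Fourier
transform from \<open>k\<close> to the other factor replaces the latter by the overlap with a smoothed
interval, and this tends to the overlap function boundedly and pointwise. The integral of any
integrable \<open>k\<close> against an overlap function is thus determined by its Fourier transform.\<close>

lemma gauss_overlap_limit:
  fixes k :: "real \<Rightarrow> complex"
  assumes k: "integrable lborel k" and r: "\<And>n. r n > 0" "r \<longlonglongrightarrow> 0"
  shows "(\<lambda>n. LBINT \<xi>. of_real (exp (- ((r n)\<^sup>2 * \<xi>\<^sup>2 / 2))) * (ft (indicator {\<gamma>..<\<delta>}) (- \<xi>) * ft (indicator {\<alpha>..<\<beta>}) \<xi>) * ft k \<xi>)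
    \<longlonglongrightarrow> of_real (2 * pi) * (LBINT x. k x * overlap \<alpha> \<beta> \<gamma> \<delta> x)"
proof -
  let ?I = "indicator {\<alpha>..<\<beta>} :: real \<Rightarrow> complex" and ?J = "indicator {\<gamma>..<\<delta>} :: real \<Rightarrow> complex"
  have [measurable]: "k \<in> borel_measurable borel" using k by auto
  have [measurable]: "ft ?I \<in> borel_measurable borel" "ft ?J \<in> borel_measurable borel"
    by (rule ft_measurable[OF integrable_indicator_ico(1)])+
  define E :: "nat \<Rightarrow> real \<Rightarrow> complex" where "E n \<xi> = of_real (exp (- ((r n)\<^sup>2 * \<xi>\<^sup>2 / 2)))" for n \<xi>
  have E: "integrable lborel (E n)" for n unfolding E_def by (rule fourier_gaussian(1)[OF r(1)])
  have [measurable]: "E n \<in> borel_measurable borel" for n using E[of n] by auto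
  have EJ: "integrable lborel (\<lambda>\<xi>. E n \<xi> * ft ?J (- \<xi>))" for n
    by (rule integrable_mult_bounded[OF E _ norm_ft_le[OF integrable_indicator_ico(1)]]) measurable
  define W where "W n \<xi> = E n \<xi> * ft ?J (- \<xi>) * ft ?I \<xi>" for n \<xi>
  have W: "integrable lborel (W n)" for n
    unfolding W_def by (rule integrable_mult_bounded[OF EJ _ norm_ft_le[OF integrable_indicator_ico(1)]]) measurable
  have 2: "(LBINT \<xi>. (E n \<xi> * iexp (- (\<xi> * y))) * ft ?J (- \<xi>)) = of_real (2 * pi) * of_real (smooth_ind (r n) \<gamma> \<delta> y)" for n y
  proof -
    have i: "integrable lborel (\<lambda>\<xi>. E n \<xi> * iexp (- (\<xi> * y)))"
      by (rule integrable_mult_bounded[OF E, of _ 1]) auto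
    have "(LBINT \<xi>. (E n \<xi> * iexp (- (\<xi> * y))) * ft ?J (- \<xi>))
        = (LBINT v. ?J v * (LBINT \<xi>. (E n \<xi> * iexp (- (\<xi> * y))) * iexp (- (- \<xi> * v))))"
      unfolding ft_def by (rule Fubini_bounded_kernel[OF i integrable_indicator_ico(1), of _ 1]) (auto, measurable)
    also have "\<dots> = (LBINT v. ?J v * of_real (2 * pi * normal_density 0 (r n) (y - v)))"
    proof (rule Bochner_Integration.integral_cong[OF refl], rule arg_cong[where f="\<lambda>x. _ * x"])
      fix v
      have "(LBINT \<xi>. (E n \<xi> * iexp (- (\<xi> * y))) * iexp (- (- \<xi> * v))) = (LBINT \<xi>. E n \<xi> * iexp ((v - y) * \<xi>))"
        by (rule Bochner_Integration.integral_cong) (auto simp: mult.assoc exp_add[symmetric] algebra_simps)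
      also have "\<dots> = of_real (2 * pi * normal_density 0 (r n) (v - y))"
        unfolding E_def by (rule fourier_gaussian(2)[OF r(1)])
      also have "normal_density 0 (r n) (v - y) = normal_density 0 (r n) (y - v)"
        by (simp add: normal_density_def power2_commute)
      finally show "(LBINT \<xi>. (E n \<xi> * iexp (- (\<xi> * y))) * iexp (- (- \<xi> * v))) = of_real (2 * pi * normal_density 0 (r n) (y - v))" .
    qed
    also have "\<dots> = of_real (2 * pi) * of_real (smooth_ind (r n) \<gamma> \<delta> y)"
      unfolding smooth_ind_complex integral_mult_right_zero[symmetric]
      by (rule Bochner_Integration.integral_cong) auto
    finally show ?thesis .
  qed
  define T where "T n x = (LBINT u. ?I u * of_real (smooth_ind (r n) \<gamma> \<delta> (u + x)))" for n x
  have 3: "(LBINT \<xi>. W n \<xi> * iexp (- (\<xi> * x))) = of_real (2 * pi) * T n x" for n x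
  proof -
    have i: "integrable lborel (\<lambda>\<xi>. E n \<xi> * ft ?J (- \<xi>) * iexp (- (\<xi> * x)))"
      by (rule integrable_mult_bounded[OF EJ, of _ 1]) auto
    have "(LBINT \<xi>. W n \<xi> * iexp (- (\<xi> * x)))
       = (LBINT \<xi>. (E n \<xi> * ft ?J (- \<xi>) * iexp (- (\<xi> * x))) * (LBINT u. ?I u * iexp (- (\<xi> * u))))"
      unfolding W_def ft_def[of ?I] by (simp add: mult_ac)
    also have "\<dots> = (LBINT u. ?I u * (LBINT \<xi>. (E n \<xi> * ft ?J (- \<xi>) * iexp (- (\<xi> * x))) * iexp (- (\<xi> * u))))"
      by (rule Fubini_bounded_kernel[OF i integrable_indicator_ico(1), of _ 1]) (auto, measurable)
    also have "\<dots> = (LBINT u. ?I u * (of_real (2 * pi) * of_real (smooth_ind (r n) \<gamma> \<delta> (u + x))))"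
    proof (rule Bochner_Integration.integral_cong[OF refl], rule arg_cong[where f="\<lambda>x. _ * x"])
      fix u
      have "(LBINT \<xi>. (E n \<xi> * ft ?J (- \<xi>) * iexp (- (\<xi> * x))) * iexp (- (\<xi> * u)))
        = (LBINT \<xi>. (E n \<xi> * iexp (- (\<xi> * (u + x)))) * ft ?J (- \<xi>))"
        by (rule Bochner_Integration.integral_cong) (auto simp: algebra_simps exp_add[symmetric])
      then show "(LBINT \<xi>. (E n \<xi> * ft ?J (- \<xi>) * iexp (- (\<xi> * x))) * iexp (- (\<xi> * u)))
        = of_real (2 * pi) * of_real (smooth_ind (r n) \<gamma> \<delta> (u + x))" by (simp only: 2)
    qed
    also have "\<dots> = of_real (2 * pi) * T n x"
      unfolding T_def integral_mult_right_zero[symmetric]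
      by (rule Bochner_Integration.integral_cong) auto
    finally show ?thesis .
  qed
  have [measurable]: "smooth_ind (r n) \<gamma> \<delta> \<in> borel_measurable borel" for n
    using smooth_ind_integrable(2)[OF r(1)] by auto
  have Tm[measurable]: "T n \<in> borel_measurable borel" for n
  proof -
    have "T n \<in> borel_measurable lborel"
      unfolding T_def by (rule lborel.borel_measurable_lebesgue_integral) measurable
    then show ?thesis by simp
  qed
  have Om[measurable]: "overlap \<alpha> \<beta> \<gamma> \<delta> \<in> borel_measurable borel"
  proof -
    have "overlap \<alpha> \<beta> \<gamma> \<delta> \<in> borel_measurable lborel"
      unfolding overlap_def by (rule lborel.borel_measurable_lebesgue_integral) measurable
    then show ?thesis by simp
  qed
  have bnd: "norm (?I u * of_real (smooth_ind (r n) \<gamma> \<delta> (u + x))) \<le> indicator {\<alpha>..<\<beta>} u" for n u x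
    using smooth_ind_nonneg[of "r n" \<gamma> \<delta> "u+x"] smooth_ind_le_1[OF r(1)[of n], of \<gamma> \<delta> "u+x"]
    by (auto simp: indicator_def)
  have Tlim: "(\<lambda>n. T n x) \<longlonglongrightarrow> overlap \<alpha> \<beta> \<gamma> \<delta> x" for x
    unfolding T_def overlap_def
  proof (rule integral_dominated_convergence[where w="indicator {\<alpha>..<\<beta>}"])
    (* At the end points of the interval the smoothed indicator tends to 1/2; they form a null set. *)
    have "AE u in lborel. u \<noteq> \<gamma> - x \<and> u \<noteq> \<delta> - x"
      using AE_lborel_singleton[of "\<gamma> - x"] AE_lborel_singleton[of "\<delta> - x"] by (intro AE_conjI) auto
    then show "AE u in lborel. (\<lambda>n. ?I u * of_real (smooth_ind (r n) \<gamma> \<delta> (u + x))) \<longlonglongrightarrow> ?I u * ?J (u + x)"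
    proof eventually_elim
      fix u assume u: "u \<noteq> \<gamma> - x \<and> u \<noteq> \<delta> - x"
      have "(\<lambda>n. smooth_ind (r n) \<gamma> \<delta> (u + x)) \<longlonglongrightarrow> indicator {\<gamma>..<\<delta>} (u + x)"
        by (rule smooth_ind_tendsto[OF r]) (use u in auto)
      then have "(\<lambda>n. ?I u * complex_of_real (smooth_ind (r n) \<gamma> \<delta> (u + x))) \<longlonglongrightarrow> ?I u * complex_of_real (indicator {\<gamma>..<\<delta>} (u + x))"
        by (intro tendsto_intros)
      moreover have "complex_of_real (indicator {\<gamma>..<\<delta>} (u + x)) = ?J (u + x)" by (simp add: indicator_def)
      ultimately show "(\<lambda>n. ?I u * of_real (smooth_ind (r n) \<gamma> \<delta> (u + x))) \<longlonglongrightarrow> ?I u * ?J (u + x)" by simp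
    qed
  qed (use bnd integrable_indicator_ico in \<open>auto\<close>)
  have Tb: "norm (T n x) \<le> (LBINT u. indicator {\<alpha>..<\<beta>} u)" for n x
  proof -
    have "norm (T n x) \<le> (LBINT u. norm (?I u * of_real (smooth_ind (r n) \<gamma> \<delta> (u + x))))"
      unfolding T_def by (rule integral_norm_bound)
    also have "\<dots> \<le> (LBINT u. indicator {\<alpha>..<\<beta>} u)"
    proof (rule integral_mono[OF _ integrable_indicator_ico(2) bnd], rule Bochner_Integration.integrable_bound[OF integrable_indicator_ico(2)])
      show "AE u in lborel. norm (norm (?I u * of_real (smooth_ind (r n) \<gamma> \<delta> (u + x)))) \<le> norm (indicat_real {\<alpha>..<\<beta>} u)"
        using bnd by (auto intro!: AE_I2)
    qed measurable
    finally show ?thesis .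
  qed
  have "(\<lambda>n. LBINT x. k x * T n x) \<longlonglongrightarrow> (LBINT x. k x * overlap \<alpha> \<beta> \<gamma> \<delta> x)"
  proof (rule integral_dominated_convergence[where w="\<lambda>x. norm (k x) * (LBINT u. indicator {\<alpha>..<\<beta>} u)"])
    show "AE x in lborel. (\<lambda>n. k x * T n x) \<longlonglongrightarrow> k x * overlap \<alpha> \<beta> \<gamma> \<delta> x"
      by (intro AE_I2 tendsto_intros Tlim)
    show "AE x in lborel. norm (k x * T n x) \<le> norm (k x) * (LBINT u. indicator {\<alpha>..<\<beta>} u)" for n
      unfolding norm_mult by (intro AE_I2 mult_left_mono Tb) auto
  qed (use k in auto)
  then have "(\<lambda>n. of_real (2 * pi) * (LBINT x. k x * T n x)) \<longlonglongrightarrow> of_real (2 * pi) * (LBINT x. k x * overlap \<alpha> \<beta> \<gamma> \<delta> x)"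
    by (intro tendsto_intros)
  moreover have "(LBINT \<xi>. W n \<xi> * ft k \<xi>) = of_real (2 * pi) * (LBINT x. k x * T n x)" for n
  proof -
    have "(LBINT \<xi>. W n \<xi> * ft k \<xi>) = (LBINT x. k x * (LBINT \<xi>. W n \<xi> * iexp (- (\<xi> * x))))"
      unfolding ft_def by (rule Fubini_bounded_kernel[OF W k, of _ 1]) (auto, measurable)
    also have "\<dots> = of_real (2 * pi) * (LBINT x. k x * T n x)"
      unfolding 3 integral_mult_right_zero[symmetric]
      by (rule Bochner_Integration.integral_cong) auto
    finally show ?thesis .
  qed
  ultimately show ?thesis unfolding W_def E_def by (simp add: mult.assoc)
qed

lemma integral_overlap:
  assumes k: "integrable lborel k"
  shows "(LBINT t. indicator {\<gamma>..<\<delta>} t * (LBINT s. indicator {\<alpha>..<\<beta>} s * k (t - s)))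
    = (LBINT r. k r * overlap \<alpha> \<beta> \<gamma> \<delta> r)"
proof -
  let ?I = "indicator {\<alpha>..<\<beta>} :: real \<Rightarrow> complex" and ?J = "indicator {\<gamma>..<\<delta>} :: real \<Rightarrow> complex"
  have "(LBINT t. ?J t * (LBINT s. ?I s * k (t - s))) = (LBINT s. ?I s * (LBINT t. ?J t * k (t - s)))"
    by (rule Fubini_convolution(1)[OF integrable_indicator_ico(1) k, of _ 1]) (auto simp: indicator_def)
  also have "(\<lambda>s. LBINT t. ?J t * k (t - s)) = (\<lambda>s. LBINT r. k r * ?J (s + r))"
  proof
    fix s
    show "(LBINT t. ?J t * k (t - s)) = (LBINT r. k r * ?J (s + r))"
      by (subst lborel_integral_real_affine[of 1 _ s]) (auto simp: mult.commute)
  qed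
  also have "(LBINT s. ?I s * (LBINT r. k r * ?J (s + r))) = (LBINT r. k r * (LBINT s. ?I s * ?J (s + r)))"
    by (rule Fubini_bounded_kernel[OF integrable_indicator_ico(1) k, of _ 1]) (auto simp: indicator_def, measurable)
  finally show ?thesis by (simp add: overlap_def)
qed

section \<open>Smoothed indicators are Schwartz functions\<close>

lemma bounded_poly_gaussian:
  fixes p :: "real poly"
  assumes s: "s > 0"
  obtains B where "\<And>x. \<bar>poly p x * exp (- (x\<^sup>2 / (2 * s\<^sup>2)))\<bar> \<le> B"
proof -
  have mono: "\<bar>x ^ n * exp (- (x\<^sup>2 / (2 * s\<^sup>2)))\<bar> \<le> 1 + (2 * s\<^sup>2) ^ n * fact n" for n x
  proof -
    define y where "y = x\<^sup>2 / (2 * s\<^sup>2)"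
    have y: "y \<ge> 0" by (simp add: y_def)
    have "y ^ n / fact n \<le> exp y"
    proof -
      have "(\<Sum>k\<in>{n}. y ^ k /\<^sub>R fact k) \<le> (\<Sum>k. y ^ k /\<^sub>R fact k)"
        by (rule sum_le_suminf[OF summable_exp_generic]) (use y in auto)
      then show ?thesis by (simp add: exp_def field_simps)
    qed
    then have yn: "y ^ n * exp (- y) \<le> fact n" by (simp add: exp_minus field_simps)
    have e1: "exp (- y) \<le> 1" using y by simp
    have xx: "x\<^sup>2 = 2 * s\<^sup>2 * y" using s by (simp add: y_def)
    (* The even power is a power of y, and a power of y is dominated by exp y. *)
    have "\<bar>x ^ n\<bar> \<le> 1 + (x ^ n)\<^sup>2"
      using zero_le_power2[of "\<bar>x ^ n\<bar> - 1"] by (simp add: power2_eq_square algebra_simps) 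
    also have "(x ^ n)\<^sup>2 = (2 * s\<^sup>2) ^ n * y ^ n"
      by (metis power_mult_distrib power_commutes power_even_eq power_mult xx mult.commute)
    finally have "\<bar>x ^ n\<bar> * exp (- y) \<le> (1 + (2 * s\<^sup>2) ^ n * y ^ n) * exp (- y)"
      by (rule mult_right_mono) simp
    also have "\<dots> = exp (- y) + (2 * s\<^sup>2) ^ n * (y ^ n * exp (- y))" by (simp add: algebra_simps)
    also have "\<dots> \<le> 1 + (2 * s\<^sup>2) ^ n * fact n"
      using e1 yn by (intro add_mono mult_left_mono) auto
    finally show ?thesis by (simp add: y_def abs_mult)
  qed
  have "\<exists>B. \<forall>x. \<bar>poly p x * exp (- (x\<^sup>2 / (2 * s\<^sup>2)))\<bar> \<le> B"
  proof (intro exI allI)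
    fix x
    have "poly p x * exp (- (x\<^sup>2 / (2 * s\<^sup>2))) = (\<Sum>i\<le>degree p. coeff p i * (x ^ i * exp (- (x\<^sup>2 / (2 * s\<^sup>2)))))"
      by (simp add: poly_altdef sum_distrib_right mult.assoc)
    also have "\<bar>\<dots>\<bar> \<le> (\<Sum>i\<le>degree p. \<bar>coeff p i\<bar> * (1 + (2 * s\<^sup>2) ^ i * fact i))"
      by (intro sum_abs[THEN order_trans] sum_mono) (unfold abs_mult[of "coeff _ _"], intro mult_left_mono mono, simp)
    finally show "\<bar>poly p x * exp (- (x\<^sup>2 / (2 * s\<^sup>2)))\<bar> \<le> (\<Sum>i\<le>degree p. \<bar>coeff p i\<bar> * (1 + (2 * s\<^sup>2) ^ i * fact i))" .
  qed
  then show ?thesis using that by blast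
qed

text \<open>The polynomial factor of the derivatives of the Gaussian density (a Hermite polynomial up to
scaling).\<close>

primrec gauss_poly :: "real \<Rightarrow> nat \<Rightarrow> real poly" where
  "gauss_poly s 0 = 1"
| "gauss_poly s (Suc n) = pderiv (gauss_poly s n) - smult (1 / s\<^sup>2) ([:0, 1:] * gauss_poly s n)"

definition gauss_deriv :: "real \<Rightarrow> nat \<Rightarrow> real \<Rightarrow> real" where
  "gauss_deriv s n x = poly (gauss_poly s n) x * normal_density 0 s x"

lemma gauss_deriv_has_derivative:
  assumes s: "s > 0"
  shows "((\<lambda>x. gauss_deriv s n (x - c)) has_vector_derivative gauss_deriv s (Suc n) (t - c)) (at t)"
proof -
  have "((\<lambda>x. gauss_deriv s n (x - c)) has_field_derivative gauss_deriv s (Suc n) (t - c)) (at t)"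
    unfolding gauss_deriv_def normal_density_def
    by (rule derivative_eq_intros refl poly_DERIV[THEN DERIV_chain2] | use s in \<open>simp add: algebra_simps power2_eq_square; fail\<close>)+
      (use s in \<open>simp add: field_simps power2_eq_square\<close>)
  then show ?thesis by (simp add: has_real_derivative_iff_has_vector_derivative)
qed

lemma smooth_ind_has_derivative:
  assumes s: "s > 0" and ab: "\<alpha> \<le> \<beta>"
  shows "(smooth_ind s \<alpha> \<beta> has_vector_derivative gauss_deriv s 0 (t - \<alpha>) - gauss_deriv s 0 (t - \<beta>)) (at t)"
proof -
  have cont: "isCont (normal_density 0 s) x" for x
    unfolding normal_density_def using s by (intro continuous_intros) auto
  obtain F where F: "\<And>x. (F has_vector_derivative normal_density 0 s x) (at x)"
    using einterval_antiderivative[of "-\<infinity>" "\<infinity>" "normal_density 0 s"] cont by auto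
  have F': "(F has_field_derivative normal_density 0 s x) (at x)" for x
    using F by (simp add: has_real_derivative_iff_has_vector_derivative)
  have eq: "smooth_ind s \<alpha> \<beta> = (\<lambda>t. F (t - \<alpha>) - F (t - \<beta>))"
  proof
    fix t
    have "(LBINT u. normal_density 0 s (t - u) * indicator {\<alpha>..\<beta>} u) = (- F (t - \<beta>)) - (- F (t - \<alpha>))"
    proof (rule integral_FTC_Icc_real[OF ab])
      show "((\<lambda>u. - F (t - u)) has_real_derivative normal_density 0 s (t - u)) (at u)" for u
        by (rule derivative_eq_intros DERIV_chain2[OF F'] refl | simp)+
      show "isCont (\<lambda>u. normal_density 0 s (t - u)) u" for u
        by (rule isCont_o2[OF _ cont]) simp
    qed
    moreover have "smooth_ind s \<alpha> \<beta> t = (LBINT u. normal_density 0 s (t - u) * indicator {\<alpha>..\<beta>} u)"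
      unfolding smooth_ind_def
    proof (rule integral_cong_AE)
      show "AE u in lborel. indicator {\<alpha>..<\<beta>} u * normal_density 0 s (t - u) = normal_density 0 s (t - u) * indicator {\<alpha>..\<beta>} u"
        using AE_lborel_singleton[of \<beta>] by eventually_elim (auto simp: indicator_def)
    qed auto
    ultimately show "smooth_ind s \<alpha> \<beta> t = F (t - \<alpha>) - F (t - \<beta>)" by simp
  qed
  have "((\<lambda>t. F (t - \<alpha>) - F (t - \<beta>)) has_field_derivative normal_density 0 s (t - \<alpha>) - normal_density 0 s (t - \<beta>)) (at t)"
    by (rule derivative_eq_intros DERIV_chain2[OF F'] refl | simp)+
  then show ?thesis unfolding eq gauss_deriv_def
    by (simp add: has_real_derivative_iff_has_vector_derivative)
qed

lemma bounded_gauss_deriv: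
  assumes s: "s > 0"
  shows "bounded (range (\<lambda>t. t ^ k * gauss_deriv s n (t - c)))"
proof -
  obtain B where B: "\<And>x. \<bar>poly ([:c, 1:] ^ k * gauss_poly s n) x * exp (- (x\<^sup>2 / (2 * s\<^sup>2)))\<bar> \<le> B"
    using bounded_poly_gaussian[OF s] by blast
  have "norm (t ^ k * gauss_deriv s n (t - c)) \<le> 1 / sqrt (2 * pi * s\<^sup>2) * B" for t
  proof -
    have "t ^ k * gauss_deriv s n (t - c) = 1 / sqrt (2 * pi * s\<^sup>2) *
       (poly ([:c, 1:] ^ k * gauss_poly s n) (t - c) * exp (- ((t - c)\<^sup>2 / (2 * s\<^sup>2))))"
      by (simp add: gauss_deriv_def normal_density_def poly_power)
    then show ?thesis using mult_left_mono[OF B[of "t - c"], of "1 / sqrt (2 * pi * s\<^sup>2)"]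
      by (simp add: abs_mult)
  qed
  then show ?thesis by (auto simp: bounded_iff)
qed

lemma bounded_smooth_ind:
  assumes s: "s > 0" and ab: "\<alpha> \<le> \<beta>"
  shows "bounded (range (\<lambda>t. t ^ k * smooth_ind s \<alpha> \<beta> t))"
proof -
  define R where "R = \<bar>\<alpha>\<bar> + \<bar>\<beta>\<bar>"
  obtain B where B: "\<And>x. \<bar>poly ([:R, 1:] ^ k) x * exp (- (x\<^sup>2 / (2 * s\<^sup>2)))\<bar> \<le> B"
    using bounded_poly_gaussian[OF s] by blast
  define C where "C = 1 / sqrt (2 * pi * s\<^sup>2) * B"
  have C: "\<bar>t\<bar> ^ k * normal_density 0 s (t - u) \<le> C" if u: "u \<in> {\<alpha>..<\<beta>}" for t u
  proof -
    have "\<bar>t\<bar> ^ k \<le> (R + \<bar>t - u\<bar>) ^ k" by (rule power_mono) (use u in \<open>auto simp: R_def\<close>)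
    then have "\<bar>t\<bar> ^ k * normal_density 0 s (t - u) \<le> (R + \<bar>t - u\<bar>) ^ k * normal_density 0 s (t - u)"
      by (rule mult_right_mono) simp
    also have "\<dots> = 1 / sqrt (2 * pi * s\<^sup>2) * (poly ([:R, 1:] ^ k) \<bar>t - u\<bar> * exp (- (\<bar>t - u\<bar>\<^sup>2 / (2 * s\<^sup>2))))"
      by (simp add: normal_density_def poly_power)
    also have "\<dots> \<le> C" unfolding C_def using B[of "\<bar>t - u\<bar>"] by (intro mult_left_mono) (auto simp: abs_le_iff)
    finally show ?thesis .
  qed
  have C0: "C \<ge> 0" unfolding C_def using B[of 0] by auto
  have "norm (t ^ k * smooth_ind s \<alpha> \<beta> t) \<le> (\<beta> - \<alpha>) * C" for t
  proof -
    have "norm (t ^ k * smooth_ind s \<alpha> \<beta> t) = (LBINT u. indicator {\<alpha>..<\<beta>} u * (\<bar>t\<bar> ^ k * normal_density 0 s (t - u)))"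
    proof -
      have "norm (t ^ k * smooth_ind s \<alpha> \<beta> t) = \<bar>t\<bar> ^ k * smooth_ind s \<alpha> \<beta> t"
        using smooth_ind_nonneg[of s \<alpha> \<beta> t] by (simp add: abs_mult power_abs)
      also have "\<dots> = (LBINT u. indicator {\<alpha>..<\<beta>} u * (\<bar>t\<bar> ^ k * normal_density 0 s (t - u)))"
        unfolding smooth_ind_def integral_mult_right_zero[symmetric]
        by (rule Bochner_Integration.integral_cong) auto
      finally show ?thesis .
    qed
    also have "\<dots> \<le> (LBINT u. indicator {\<alpha>..<\<beta>} u * C)"
    proof (rule integral_mono)
      show i: "integrable lborel (\<lambda>u. indicator {\<alpha>..<\<beta>} u * C)"
        by (intro integrable_mult_left integrable_indicator_ico)
      show "integrable lborel (\<lambda>u. indicator {\<alpha>..<\<beta>} u * (\<bar>t\<bar> ^ k * normal_density 0 s (t - u)))"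
        by (rule Bochner_Integration.integrable_bound[OF i]) (use C C0 in \<open>auto simp: indicator_def intro!: AE_I2\<close>)
    qed (use C in \<open>auto simp: indicator_def\<close>)
    also have "\<dots> = (\<beta> - \<alpha>) * C" using ab by simp
    finally show ?thesis .
  qed
  then show ?thesis by (auto simp: bounded_iff)
qed

text \<open>From the first derivative on, the derivatives are differences of translated derivatives of the
Gaussian. Only the decay of the function itself needs the averaging form of the definition.\<close>

lemma smooth_ind_schwartz:
  assumes s: "s > 0" and ab: "\<alpha> \<le> \<beta>"
  shows "smooth_ind s \<alpha> \<beta> \<in> schwartz"
proof -
  define D where "D n = (case n of 0 \<Rightarrow> smooth_ind s \<alpha> \<beta> | Suc m \<Rightarrow> (\<lambda>t. gauss_deriv s m (t - \<alpha>) - gauss_deriv s m (t - \<beta>)))" for n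
  have "(D n has_vector_derivative D (Suc n) t) (at t)" for n t
    by (cases n) (auto simp: D_def intro!: smooth_ind_has_derivative[OF s ab]
      has_vector_derivative_diff gauss_deriv_has_derivative[OF s])
  moreover have "bounded (range (\<lambda>t. t ^ k *\<^sub>R D n t))" for k n
  proof (cases n)
    case 0 then show ?thesis using bounded_smooth_ind[OF s ab] by (simp add: D_def)
  next
    case (Suc m)
    have "bounded (range (\<lambda>t. t ^ k * gauss_deriv s m (t - \<alpha>) - t ^ k * gauss_deriv s m (t - \<beta>)))"
      by (rule bounded_minus_comp[OF bounded_gauss_deriv[OF s] bounded_gauss_deriv[OF s]])
    then show ?thesis by (simp add: D_def Suc right_diff_distrib)
  qed
  moreover have "D 0 = smooth_ind s \<alpha> \<beta>" by (simp add: D_def)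
  ultimately show ?thesis unfolding schwartz_def by blast
qed

lemma schwartz_scaleR:
  fixes z :: "'a::real_normed_vector"
  assumes "f \<in> schwartz" shows "(\<lambda>t. f t *\<^sub>R z) \<in> schwartz"
proof -
  obtain D where D: "D 0 = f" "\<And>n t. (D n has_vector_derivative D (Suc n) t) (at t)"
    "\<And>k n. bounded (range (\<lambda>t. t ^ k *\<^sub>R D n t))"
    using assms unfolding schwartz_def by blast
  have "((\<lambda>t. D n t *\<^sub>R z) has_vector_derivative D (Suc n) t *\<^sub>R z) (at t)" for n t
    by (rule bounded_linear.has_vector_derivative[OF bounded_linear_scaleR_left D(2)])
  moreover have "bounded (range (\<lambda>t. t ^ k *\<^sub>R (D n t *\<^sub>R z)))" for k n
    using bounded_linear_image[OF D(3)[of k n] bounded_linear_scaleR_left[of z]] by (simp add: image_image)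
  ultimately show ?thesis unfolding schwartz_def using D(1) by (auto intro!: exI[of _ "\<lambda>n t. D n t *\<^sub>R z"])
qed

lemma schwartz_zero: "(\<lambda>t. 0) \<in> schwartz"
  unfolding schwartz_def by (auto intro!: exI[of _ "\<lambda>n t. 0"])

lemma schwartz_add:
  assumes "f \<in> schwartz" "g \<in> schwartz" shows "(\<lambda>t. f t + g t) \<in> schwartz"
proof -
  obtain D where D: "D 0 = f" "\<And>n t. (D n has_vector_derivative D (Suc n) t) (at t)"
    "\<And>k n. bounded (range (\<lambda>t. t ^ k *\<^sub>R D n t))"
    using assms unfolding schwartz_def by blast
  obtain E where E: "E 0 = g" "\<And>n t. (E n has_vector_derivative E (Suc n) t) (at t)"
    "\<And>k n. bounded (range (\<lambda>t. t ^ k *\<^sub>R E n t))"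
    using assms unfolding schwartz_def by blast
  have "bounded (range (\<lambda>t. t ^ k *\<^sub>R (D n t + E n t)))" for k n
    using bounded_plus_comp[OF D(3)[of k n] E(3)[of k n]] by (simp add: scaleR_add_right)
  then show ?thesis unfolding schwartz_def using D E
    by (auto intro!: exI[of _ "\<lambda>n t. D n t + E n t"] has_vector_derivative_add)
qed

lemma schwartz_sum:
  "(\<And>k. k \<in> S \<Longrightarrow> f k \<in> schwartz) \<Longrightarrow> (\<lambda>t. \<Sum>k\<in>S. f k t) \<in> schwartz"
  by (induction S rule: infinite_finite_induct) (auto intro: schwartz_add schwartz_zero)

section \<open>The resolvent as a Laplace transform\<close>

lemma has_derivative_imp_difference_quotient:
  fixes F :: "real \<Rightarrow> 'a::real_normed_vector"
  assumes "(F has_vector_derivative y) (at 0 within {0..b})" "b > 0"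
  shows "((\<lambda>h. (F h - F 0) /\<^sub>R h) \<longlongrightarrow> y) (at_right 0)"
proof -
  have "((\<lambda>h. (F h - F 0 - h *\<^sub>R y) /\<^sub>R norm h) \<longlongrightarrow> 0) (at 0 within {0..b})"
    using assms(1) by (simp add: has_vector_derivative_def has_derivative_within inverse_eq_divide diff_diff_eq)
  then have "((\<lambda>h. (F h - F 0 - h *\<^sub>R y) /\<^sub>R norm h + y) \<longlongrightarrow> 0 + y) (at 0 within {0..b})"
    by (intro tendsto_intros)
  moreover have "at 0 within {0..b} = at_right 0" by (rule at_within_Icc_at_right[OF assms(2)])
  ultimately have "((\<lambda>h. (F h - F 0 - h *\<^sub>R y) /\<^sub>R norm h + y) \<longlongrightarrow> y) (at_right 0)" by simp
  moreover have "\<forall>\<^sub>F h in at_right 0. (F h - F 0 - h *\<^sub>R y) /\<^sub>R norm h + y = (F h - F 0) /\<^sub>R h"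
    using eventually_at_right_less[of "0::real"]
    by eventually_elim (simp add: scaleR_diff_right)
  ultimately show ?thesis by (rule Lim_transform_eventually)
qed

lemma C0_semigroupD:
  assumes "C0_semigroup T"
  shows "t \<ge> 0 \<Longrightarrow> bounded_clinear (T t)" "T 0 x = x" "s \<ge> 0 \<Longrightarrow> t \<ge> 0 \<Longrightarrow> T (s + t) x = T s (T t x)"
    "continuous_on {0..} (\<lambda>t. T t x)"
  using assms unfolding C0_semigroup_def by auto

lemma continuous_on_scaleC:
  fixes g :: "'t::topological_space \<Rightarrow> 'a::complex_normed_vector"
  shows "continuous_on S f \<Longrightarrow> continuous_on S g \<Longrightarrow> continuous_on S (\<lambda>t. f t *\<^sub>C g t)"
  using bounded_bilinear.continuous_on[OF bounded_bilinear_scaleC] by blast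

lemma tendsto_scaleC:
  fixes g :: "'t \<Rightarrow> 'a::complex_normed_vector"
  shows "(f \<longlongrightarrow> a) F \<Longrightarrow> (g \<longlongrightarrow> b) F \<Longrightarrow> ((\<lambda>t. f t *\<^sub>C g t) \<longlongrightarrow> a *\<^sub>C b) F"
  using bounded_bilinear.tendsto[OF bounded_bilinear_scaleC] by blast

lemma bounded_linear_scaleC_right: "bounded_linear (\<lambda>x::'a::complex_normed_vector. c *\<^sub>C x)"
  using bounded_bilinear.bounded_linear_right[OF bounded_bilinear_scaleC] .

lemma scaleC_one: "1 *\<^sub>C x = (x::'a::complex_normed_vector)"
  using scaleC_of_real[of 1 x] by simp

text \<open>The integral \<open>Q\<close> of \<open>exp (- \<mu> s) T s z\<close> over the half line converges in norm, although \<open>\<mu>\<close> may lie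
to the left of the growth bound of the semigroup. The semigroup law gives
\<open>T h Q = exp (\<mu> h) (Q - I h)\<close>, where \<open>I h\<close> is the integral up to \<open>h\<close>, and differentiating at \<open>h = 0\<close>
shows that \<open>Q\<close> lies in the domain with \<open>\<mu> Q + A Q = z\<close>. As \<open>- \<mu>\<close> belongs to the resolvent set,
\<open>Q\<close> is the resolvent applied to \<open>z\<close>.

The vector-valued integral is the gauge integral over compact intervals, which exists for
continuous functions with values in any Banach space.\<close>

lemma laplace_transform_resolvent:
  fixes T :: "real \<Rightarrow> 'x::cbanach \<Rightarrow> 'x"
  assumes T: "C0_semigroup T" and gen: "is_generator D (\<lambda>x. - A x) T"
    and res: "- \<mu> \<in> resolvent_set D A" and a: "a = Re \<mu>"
    and int: "integrable lborel (\<lambda>s. indicator {0..} s * (exp (- a * s) * norm (T s z)))"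
    and l: "bounded_linear (l :: 'x \<Rightarrow> complex)"
  shows "l (inv_into D (\<lambda>x. \<mu> *\<^sub>C x + A x) z) = (LBINT s. indicator {0..} s * l (exp (- \<mu> * of_real s) *\<^sub>C T s z))"
proof -
  define f where "f s = exp (- \<mu> * of_real s) *\<^sub>C T s z" for s
  define N where "N s = exp (- a * s) * norm (T s z)" for s
  have Nf: "norm (f s) = N s" for s by (simp add: f_def N_def norm_scaleC a)
  have contf: "continuous_on {0..} f"
    unfolding f_def by (intro continuous_on_scaleC C0_semigroupD[OF T] continuous_intros)
  have contN: "continuous_on {0..} N"
    unfolding Nf[symmetric] by (intro continuous_intros contf)
  define I where "I b = integral {0..b} f" for b
  define \<nu> where "\<nu> b = integral {0..b} N" for b
  have fi: "f integrable_on {c..b}" if "0 \<le> c" for b c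
    by (rule integrable_continuous_interval, rule continuous_on_subset[OF contf]) (use that in auto)
  have Ni: "N integrable_on {c..b}" if "0 \<le> c" for b c
    by (rule integrable_continuous_interval, rule continuous_on_subset[OF contN]) (use that in auto)
  have IN: "norm (I b - I c) \<le> \<nu> b - \<nu> c" if "0 \<le> c" "c \<le> b" for b c
  proof -
    have "I c + integral {c..b} f = I b" unfolding I_def
      by (rule Henstock_Kurzweil_Integration.integral_combine) (use that fi in auto)
    moreover have "\<nu> c + integral {c..b} N = \<nu> b" unfolding \<nu>_def
      by (rule Henstock_Kurzweil_Integration.integral_combine) (use that Ni in auto)
    moreover have "norm (integral {c..b} f) \<le> integral {c..b} N"
      by (rule integral_norm_bound_integral[OF fi Ni]) (use that Nf in auto)
    moreover have "I b - I c = integral {c..b} f" using calculation(1) by (simp add: algebra_simps)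
    ultimately show ?thesis by simp
  qed
  define L where "L = (LBINT s. indicator {0..} s * N s)"
  have intN: "integrable lborel (\<lambda>s. indicator {0..} s * N s)" using int by (simp add: N_def)
  have \<nu>L: "(\<nu> \<longlongrightarrow> L) at_top"
  proof (rule Lim_transform_eventually)
    have "((\<lambda>b. LBINT s. indicator {..b} s *\<^sub>R (indicator {0..} s * N s)) \<longlongrightarrow> L) at_top"
      unfolding L_def by (rule tendsto_integral_at_top) (use intN in auto)
    then show "((\<lambda>b. LINT s:{..b}|lborel. indicator {0..} s * N s) \<longlongrightarrow> L) at_top"
      by (simp add: L_def set_lebesgue_integral_def)
    show "\<forall>\<^sub>F b in at_top. (LINT s:{..b}|lborel. indicator {0..} s * N s) = \<nu> b"
    proof (rule always_eventually, rule allI)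
      fix b
      have si: "set_integrable lborel {0..b} N"
        by (rule borel_integrable_atLeastAtMost') (rule continuous_on_subset[OF contN], auto)
      have "(LINT s:{..b}|lborel. indicator {0..} s * N s) = (LINT s:{0..b}|lborel. N s)"
        unfolding set_lebesgue_integral_def
        by (rule Bochner_Integration.integral_cong) (auto simp: indicator_def)
      also have "\<dots> = \<nu> b" unfolding \<nu>_def
        by (rule set_borel_integral_eq_integral(2)[OF si])
      finally show "(LINT s:{..b}|lborel. indicator {0..} s * N s) = \<nu> b" .
    qed
  qed
  have \<nu>_le: "\<nu> b \<le> L" if "b \<ge> 0" for b
  proof (rule tendsto_lowerbound[OF \<nu>L])
    show "\<forall>\<^sub>F x in at_top. \<nu> b \<le> \<nu> x"
      using eventually_ge_at_top[of b]
      by eventually_elim (use IN[OF that] norm_ge_zero in \<open>smt (verit)\<close>)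
  qed simp
  (* The tails of the vector integral are dominated by those of the integral of the norm. *)
  have tail: "norm (I b - I c) \<le> L - \<nu> m" if "0 \<le> m" "m \<le> b" "m \<le> c" for b c m
  proof -
    have "norm (I b - I c) \<le> \<bar>\<nu> b - \<nu> c\<bar>"
      using IN[of c b] IN[of b c] that by (cases "c \<le> b") (auto simp: norm_minus_commute)
    also have "\<dots> \<le> L - \<nu> m"
      using \<nu>_le[of b] \<nu>_le[of c] order_trans[OF norm_ge_zero IN[of m b]] order_trans[OF norm_ge_zero IN[of m c]] that by auto
    finally show ?thesis .
  qed
  have small: "\<exists>m\<ge>0. L - \<nu> m < e" if "e > 0" for e
  proof -
    have "\<forall>\<^sub>F m in at_top. L - e < \<nu> m" by (rule order_tendstoD(1)[OF \<nu>L]) (use that in simp)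
    then have "\<forall>\<^sub>F m in at_top. L - e < \<nu> m \<and> 0 \<le> m" using eventually_ge_at_top[of "0::real"] by eventually_elim simp
    then obtain m where "L - e < \<nu> m \<and> 0 \<le> m" using eventually_happens[of _ "at_top::real filter"] by auto
    then show ?thesis by (intro exI[of _ m]) auto
  qed
  have "Cauchy (\<lambda>n::nat. I (real n))"
  proof (rule metric_CauchyI)
    fix e :: real assume "e > 0"
    then obtain m where m: "m \<ge> 0" "L - \<nu> m < e" using small by blast
    show "\<exists>M. \<forall>i\<ge>M. \<forall>j\<ge>M. dist (I (real i)) (I (real j)) < e"
    proof (intro exI allI impI)
      fix i j assume "nat \<lceil>m\<rceil> \<le> i" "nat \<lceil>m\<rceil> \<le> j"
      then have "m \<le> real i" "m \<le> real j" by linarith+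
      then show "dist (I (real i)) (I (real j)) < e" using tail[OF m(1)] m(2) by (force simp: dist_norm)
    qed
  qed
  then obtain Q where Q: "(\<lambda>n::nat. I (real n)) \<longlonglongrightarrow> Q" using Cauchy_convergent_iff convergent_def by blast
  have IQ: "(I \<longlongrightarrow> Q) at_top"
  proof (rule tendstoI)
    fix e :: real assume e: "e > 0"
    then obtain m where m: "m \<ge> 0" "L - \<nu> m < e/2" using small[of "e/2"] by auto
    have "norm (I b - Q) \<le> L - \<nu> m" if "b \<ge> m" for b
    proof (rule tendsto_upperbound)
      show "(\<lambda>n::nat. norm (I b - I (real n))) \<longlonglongrightarrow> norm (I b - Q)" by (intro tendsto_intros Q)
      have "\<forall>\<^sub>F n in sequentially. m \<le> real n" by (meson eventually_sequentiallyI nat_ceiling_le_eq)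
      then show "\<forall>\<^sub>F n in sequentially. norm (I b - I (real n)) \<le> L - \<nu> m"
        by eventually_elim (rule tail[OF m(1) that])
    qed simp
    then have "dist (I b) Q < e" if "b \<ge> m" for b using m(2) e that by (fastforce simp: dist_norm)
    then show "\<forall>\<^sub>F b in at_top. dist (I b) Q < e" using eventually_at_top_linorder by blast
  qed
  have TQ: "T h Q = exp (\<mu> * of_real h) *\<^sub>C (Q - I h)" if h: "h \<ge> 0" for h
  proof -
    have blT: "bounded_linear (T h)" using C0_semigroupD(1)[OF T h] by (rule bounded_clinear_bounded_linear)
    have "T h (I b) = exp (\<mu> * of_real h) *\<^sub>C (I (b + h) - I h)" if b: "b \<ge> 0" for b
    proof -
      have "T h (I b) = integral {0..b} (\<lambda>s. T h (f s))"
        unfolding I_def using integral_linear[OF fi blT] by (simp add: o_def)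
      also have "\<dots> = integral {0..b} (\<lambda>s. exp (\<mu> * of_real h) *\<^sub>C f (s + h))"
      proof (rule integral_cong)
        fix s assume "s \<in> {0..b}"
        then have "T (h + s) z = T h (T s z)" using C0_semigroupD(3)[OF T h] by simp
        then show "T h (f s) = exp (\<mu> * of_real h) *\<^sub>C f (s + h)"
          by (simp add: f_def bounded_clinear_scaleC[OF C0_semigroupD(1)[OF T h]] scaleC_scaleC add.commute algebra_simps flip: exp_add)
      qed
      also have "\<dots> = exp (\<mu> * of_real h) *\<^sub>C integral {0..b} (\<lambda>s. f (s + h))"
      proof -
        have "(\<lambda>s. f (s + h)) integrable_on {0..b}"
          by (rule integrable_continuous_interval, rule continuous_on_compose2[OF contf]) (use h in \<open>auto intro!: continuous_intros\<close>)
        from integral_linear[OF this bounded_linear_scaleC_right] show ?thesis by (simp add: o_def)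
      qed
      also have "integral {0..b} (\<lambda>s. f (s + h)) = integral {h..b + h} f"
        using integral_shift_Icc_real[of 0 b f h] by (simp add: o_def add.commute)
      also have "\<dots> = I (b + h) - I h"
      proof -
        have "I h + integral {h..b+h} f = I (b+h)" unfolding I_def
          by (rule Henstock_Kurzweil_Integration.integral_combine) (use h b fi in auto)
        then show ?thesis by (simp add: algebra_simps)
      qed
      finally show ?thesis .
    qed
    then have "\<forall>\<^sub>F b in at_top. T h (I b) = exp (\<mu> * of_real h) *\<^sub>C (I (b + h) - I h)"
      using eventually_at_top_linorder by blast
    moreover have "((\<lambda>b. T h (I b)) \<longlongrightarrow> T h Q) at_top" by (rule bounded_linear.tendsto[OF blT IQ])
    ultimately have 1: "((\<lambda>b. exp (\<mu> * of_real h) *\<^sub>C (I (b + h) - I h)) \<longlongrightarrow> T h Q) at_top"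
      by (rule Lim_transform_eventually[rotated])
    have "((\<lambda>b. I (b + h)) \<longlongrightarrow> Q) at_top"
      using filterlim_compose[OF IQ filterlim_tendsto_add_at_top[OF tendsto_const[of h] filterlim_ident]]
      by (simp add: add.commute)
    then have "((\<lambda>b. exp (\<mu> * of_real h) *\<^sub>C (I (b + h) - I h)) \<longlongrightarrow> exp (\<mu> * of_real h) *\<^sub>C (Q - I h)) at_top"
      by (intro tendsto_scaleC tendsto_intros)
    with 1 show ?thesis by (rule tendsto_unique[rotated]) simp
  qed
  have lim: "((\<lambda>h. (T h Q - Q) /\<^sub>R h) \<longlongrightarrow> \<mu> *\<^sub>C Q - z) (at_right 0)"
  proof (rule Lim_transform_eventually)
    have d1: "((\<lambda>h. (exp (\<mu> * of_real h) - 1) / of_real h) \<longlongrightarrow> \<mu>) (at_right (0::real))"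
    proof -
      have "((\<lambda>h. exp (\<mu> * of_real h)) has_vector_derivative \<mu>) (at (0::real) within {0..1})"
        by (rule has_vector_derivative_real_field[where f="\<lambda>x. exp (\<mu> * x)"]) (auto intro!: derivative_eq_intros)
      from has_derivative_imp_difference_quotient[OF this] show ?thesis
        by (simp add: scaleR_conv_of_real divide_inverse mult.commute)
    qed
    have d2: "((\<lambda>h. (I h - I 0) /\<^sub>R h) \<longlongrightarrow> f 0) (at_right 0)"
    proof (rule has_derivative_imp_difference_quotient[of _ _ 1])
      show "(I has_vector_derivative f 0) (at 0 within {0..1})"
        unfolding I_def by (rule integral_has_vector_derivative) (auto intro: continuous_on_subset[OF contf])
    qed simp
    have d3: "((\<lambda>h. exp (\<mu> * of_real h)) \<longlongrightarrow> exp (\<mu> * of_real 0)) (at_right (0::real))"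
      by (intro tendsto_intros)
    have "((\<lambda>h. ((exp (\<mu> * of_real h) - 1) / of_real h) *\<^sub>C Q - exp (\<mu> * of_real h) *\<^sub>C ((I h - I 0) /\<^sub>R h))
        \<longlongrightarrow> \<mu> *\<^sub>C Q - exp (\<mu> * of_real 0) *\<^sub>C f 0) (at_right 0)"
      by (intro tendsto_diff tendsto_scaleC d1 d2 d3 tendsto_const)
    then show "((\<lambda>h. ((exp (\<mu> * of_real h) - 1) / of_real h) *\<^sub>C Q - exp (\<mu> * of_real h) *\<^sub>C ((I h - I 0) /\<^sub>R h))
        \<longlongrightarrow> \<mu> *\<^sub>C Q - z) (at_right 0)"
      by (simp add: f_def C0_semigroupD(2)[OF T] scaleC_one)
    show "\<forall>\<^sub>F h in at_right 0. ((exp (\<mu> * of_real h) - 1) / of_real h) *\<^sub>C Q - exp (\<mu> * of_real h) *\<^sub>C ((I h - I 0) /\<^sub>R h)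
        = (T h Q - Q) /\<^sub>R h"
      using eventually_at_right_less[of "0::real"]
    proof eventually_elim
      fix h :: real assume h: "0 < h"
      have I0: "I 0 = 0" by (simp add: I_def)
      have sub: "(c - d) *\<^sub>C x = c *\<^sub>C x - d *\<^sub>C x" for c d and x :: 'x
        using bounded_bilinear.diff_left[OF bounded_bilinear_scaleC] .
      have subr: "c *\<^sub>C (x - y) = c *\<^sub>C x - c *\<^sub>C y" for c and x y :: 'x
        using bounded_bilinear.diff_right[OF bounded_bilinear_scaleC] .
      have sR: "c *\<^sub>C (r *\<^sub>R x) = r *\<^sub>R c *\<^sub>C x" for c r and x :: 'x
        using bounded_bilinear.scaleR_right[OF bounded_bilinear_scaleC] .
      have dv: "(w / of_real h) *\<^sub>C x = (w *\<^sub>C x) /\<^sub>R h" for w and x :: 'x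
        using scaleC_scaleC[of "of_real (inverse h)" w x] scaleC_of_real[of "inverse h" "w *\<^sub>C x"]
        by (simp add: divide_inverse mult.commute)
      show "((exp (\<mu> * of_real h) - 1) / of_real h) *\<^sub>C Q - exp (\<mu> * of_real h) *\<^sub>C ((I h - I 0) /\<^sub>R h)
        = (T h Q - Q) /\<^sub>R h"
        using h by (simp add: I0 dv sR TQ sub subr scaleC_one scaleR_diff_right)
    qed
  qed
  have QD: "Q \<in> D" and AQ: "((\<lambda>h. (T h Q - Q) /\<^sub>R h) \<longlongrightarrow> - A Q) (at_right 0)"
    using gen lim unfolding is_generator_def by auto
  have "- A Q = \<mu> *\<^sub>C Q - z" by (rule tendsto_unique[OF _ AQ lim]) simp
  then have eqz: "\<mu> *\<^sub>C Q + A Q = z" by (simp add: algebra_simps eq_neg_iff_add_eq_0)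
  have inj: "inj_on (\<lambda>x. \<mu> *\<^sub>C x + A x) D"
  proof (rule inj_onI)
    fix x y assume xy: "x \<in> D" "y \<in> D" "\<mu> *\<^sub>C x + A x = \<mu> *\<^sub>C y + A y"
    have neg: "(- \<mu>) *\<^sub>C x - A x = - (\<mu> *\<^sub>C x + A x)" for x
      using bounded_bilinear.minus_left[OF bounded_bilinear_scaleC, of \<mu> x] by simp
    have "inj_on (\<lambda>x. (- \<mu>) *\<^sub>C x - A x) D" using res unfolding resolvent_set_def bij_betw_def by simp
    moreover have "(- \<mu>) *\<^sub>C x - A x = (- \<mu>) *\<^sub>C y - A y" by (simp only: neg xy(3))
    ultimately show "x = y" using xy(1,2) by (rule inj_onD)
  qed
  have inv: "inv_into D (\<lambda>x. \<mu> *\<^sub>C x + A x) z = Q" by (rule inv_into_f_eq[OF inj QD eqz])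
  have "(\<lambda>n::nat. l (I (real n))) \<longlonglongrightarrow> l Q" by (rule bounded_linear.tendsto[OF l Q])
  moreover have "(\<lambda>n::nat. l (I (real n))) \<longlonglongrightarrow> (LBINT s. indicator {0..} s * l (f s))"
  proof -
    have contl: "continuous_on {0..} (\<lambda>s. l (f s))"
      using continuous_on_compose2[OF linear_continuous_on[OF l, of UNIV] contf] by simp
    obtain K where K: "\<And>x. norm (l x) \<le> norm x * K" "K > 0" using bounded_linear.pos_bounded[OF l] by blast
    have meas: "(\<lambda>s. indicator {0..} s * l (f s)) \<in> borel_measurable borel"
    proof -
      have "(\<lambda>s. indicator {0..} s *\<^sub>R l (f s)) \<in> borel_measurable borel"
        by (rule borel_measurable_continuous_on_indicator) (use contl in auto)
      moreover have "(\<lambda>s. indicator {0..} s *\<^sub>R l (f s)) = (\<lambda>s. indicator {0..} s * l (f s))" by (auto simp: indicator_def)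
      ultimately show ?thesis by simp
    qed
    have "(\<lambda>n::nat. LBINT s. indicator {0..real n} s * (indicator {0..} s * l (f s))) \<longlonglongrightarrow> (LBINT s. indicator {0..} s * l (f s))"
    proof (rule integral_dominated_convergence[where w="\<lambda>s. (indicator {0..} s * N s) * K"])
      show "AE s in lborel. (\<lambda>n::nat. indicator {0..real n} s * (indicator {0..} s * l (f s))) \<longlonglongrightarrow> indicator {0..} s * l (f s)"
      proof (rule AE_I2)
        fix s :: real
        have "\<forall>\<^sub>F n in sequentially. s \<le> real n" by (meson eventually_sequentiallyI nat_ceiling_le_eq)
        then have "\<forall>\<^sub>F n in sequentially. indicator {0..real n} s * (indicator {0..} s * l (f s)) = indicator {0..} s * l (f s)"
          by eventually_elim (auto simp: indicator_def)
        then show "(\<lambda>n::nat. indicator {0..real n} s * (indicator {0..} s * l (f s))) \<longlonglongrightarrow> indicator {0..} s * l (f s)"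
          by (rule tendsto_eventually)
      qed
      show "AE s in lborel. norm (indicator {0..real n} s * (indicator {0..} s * l (f s))) \<le> (indicator {0..} s * N s) * K" for n :: nat
        using K(1)[of "f _"] K(2) by (auto simp: indicator_def Nf norm_mult N_def intro!: AE_I2 )
    qed (use meas intN in auto)
    moreover have "(LBINT s. indicator {0..real n} s * (indicator {0..} s * l (f s))) = l (I (real n))" for n :: nat
    proof -
      have si: "set_integrable lborel {0..real n} (\<lambda>s. l (f s))"
        by (rule borel_integrable_atLeastAtMost') (rule continuous_on_subset[OF contl], auto)
      have "(LBINT s. indicator {0..real n} s * (indicator {0..} s * l (f s))) = (LINT s:{0..real n}|lborel. l (f s))"
        unfolding set_lebesgue_integral_def
        by (rule Bochner_Integration.integral_cong) (auto simp: indicator_def)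
      also have "\<dots> = integral {0..real n} (\<lambda>s. l (f s))"
        by (rule set_borel_integral_eq_integral(2)[OF si])
      also have "\<dots> = l (I (real n))" unfolding I_def using integral_linear[OF fi l] by (simp add: o_def)
      finally show ?thesis .
    qed
    ultimately show ?thesis by simp
  qed
  ultimately have "l Q = (LBINT s. indicator {0..} s * l (f s))" by (rule LIMSEQ_unique)
  then show ?thesis by (simp add: inv f_def)
qed

section \<open>Lebesgue norms of smoothed step functions\<close>

lemma smooth_ind_add:
  assumes s: "s > 0" and "\<alpha> \<le> \<beta>" "\<beta> \<le> \<gamma>"
  shows "smooth_ind s \<alpha> \<beta> t + smooth_ind s \<beta> \<gamma> t = smooth_ind s \<alpha> \<gamma> t"
proof -
  have i: "integrable lborel (\<lambda>n. std_normal_density n * indicator {a..<b} (t - s * n))" for a b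
    by (rule integrable_std_normal_mult) (auto simp: indicator_def)
  have "smooth_ind s \<alpha> \<beta> t + smooth_ind s \<beta> \<gamma> t = (LBINT n. std_normal_density n * indicator {\<alpha>..<\<beta>} (t - s * n)
      + std_normal_density n * indicator {\<beta>..<\<gamma>} (t - s * n))"
    unfolding smooth_ind_alt[OF s] by (rule Bochner_Integration.integral_add[symmetric]) (rule i)+
  also have "\<dots> = smooth_ind s \<alpha> \<gamma> t"
    unfolding smooth_ind_alt[OF s]
    by (rule Bochner_Integration.integral_cong) (use assms in \<open>auto simp: indicator_def\<close>)
  finally show ?thesis .
qed

lemma sum_smooth_ind:
  assumes s: "s > 0" and d: "d \<ge> 0"
  shows "(\<Sum>l<n. smooth_ind s (c + real l * d) (c + real (Suc l) * d) t) = smooth_ind s c (c + real n * d) t"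
proof (induction n)
  case 0
  have "smooth_ind s c c t = 0" by (simp add: smooth_ind_def)
  then show ?case by simp
next
  case (Suc n)
  have "smooth_ind s c (c + real n * d) t + smooth_ind s (c + real n * d) (c + real (Suc n) * d) t
      = smooth_ind s c (c + real (Suc n) * d) t"
    by (rule smooth_ind_add[OF s]) (use d in \<open>auto simp: algebra_simps\<close>)
  with Suc show ?case by simp
qed

text \<open>This is Young's inequality for the product of \<open>x / N\<close> and 1. Integrated against a weight of total mass 1,
it bounds the mean of \<open>x\<close> by its \<open>Q\<close>-norm \<open>N\<close> without loss of a constant.\<close>

lemma young_scaled:
  fixes x N Q :: real
  assumes "x \<ge> 0" "N > 0" "Q \<ge> 1"
  shows "x \<le> N * ((1/Q) * (x powr Q / N powr Q) + (1 - 1/Q))"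
proof (cases "x = 0")
  case True then show ?thesis using assms by simp
next
  case False
  then have x: "x > 0" using assms by simp
  have "((x/N) powr Q) powr (1/Q) * 1 powr (1 - 1/Q) \<le> (1/Q) * (x/N) powr Q + (1 - 1/Q) * 1"
    by (rule Youngs_inequality_0) (use assms x in \<open>auto simp: field_simps\<close>)
  then have "x / N \<le> (1/Q) * (x powr Q / N powr Q) + (1 - 1/Q)"
    using x assms by (simp add: powr_powr powr_divide)
  then show ?thesis using assms by (simp add: field_simps)
qed

text \<open>Hoelder's inequality for a weight with values in \<open>[0, 1]\<close>. For finite \<open>q\<close> only the total mass 1 is
considered, where the exponent of \<open>\<Lambda>\<close> is irrelevant, so that one formula covers all \<open>q\<close>.\<close>

lemma Lp_weighted_integral_le:
  fixes u :: "real \<Rightarrow> 'a::real_normed_vector"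
  assumes u: "u \<in> Lp q" and q: "1 \<le> q"
    and \<rho>: "\<rho> \<in> borel_measurable borel" "\<And>t. 0 \<le> \<rho> t" "\<And>t. \<rho> t \<le> 1" "integrable lborel \<rho>"
    and \<Lambda>: "(LBINT t. \<rho> t) = \<Lambda>" "q = \<infinity> \<or> \<Lambda> = 1"
  shows "(\<integral>\<^sup>+t. ennreal (\<rho> t * norm (u t)) \<partial>lebesgue) \<le> ennreal (\<Lambda> * Lp_norm q u)"
proof -
  have um: "strongly_measurable u" using u by (simp add: Lp_def)
  have [measurable]: "(\<lambda>t. norm (u t)) \<in> borel_measurable lebesgue" by (rule strongly_measurable_norm[OF um])
  have [measurable]: "\<rho> \<in> borel_measurable lebesgue" using \<rho>(1) by (intro borel_measurable_if_I measurable_completion) auto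
  have \<rho>i: "(\<integral>\<^sup>+t. ennreal (\<rho> t) \<partial>lebesgue) = ennreal \<Lambda>"
    using nn_integral_eq_integral[OF \<rho>(4)] \<rho>(2) \<Lambda>(1) by (simp add: nn_integral_completion)
  have \<Lambda>0: "\<Lambda> \<ge> 0" unfolding \<Lambda>(1)[symmetric] by (rule integral_nonneg_AE) (use \<rho>(2) in auto)
  show ?thesis
  proof (cases "q = \<infinity>")
    case True
    define e where "e = esssup lebesgue (\<lambda>t. ereal (norm (u t)))"
    have e: "e < \<infinity>" using u True by (simp add: Lp_def e_def)
    have ae: "AE t in lebesgue. ereal (norm (u t)) \<le> e" unfolding e_def by (rule esssup_AE)
    have e0: "0 \<le> e"
    proof (rule ccontr)
      assume "\<not> 0 \<le> e"
      then have e_neg: "e < 0" by simp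
      have "AE t in (lebesgue :: real measure). False"
        using ae
      proof eventually_elim
        fix t assume "ereal (norm (u t)) \<le> e"
        then have "ereal (norm (u t)) < 0" using e_neg by (rule le_less_trans)
        then show False by simp
      qed
      then show False by (simp add: eventually_False ae_filter_eq_bot_iff)
    qed
    then obtain r where r: "e = ereal r" "r \<ge> 0" using e by (cases e) auto
    have "(\<integral>\<^sup>+t. ennreal (\<rho> t * norm (u t)) \<partial>lebesgue) \<le> (\<integral>\<^sup>+t. ennreal r * ennreal (\<rho> t) \<partial>lebesgue)"
    proof (rule nn_integral_mono_AE)
      show "AE t in lebesgue. ennreal (\<rho> t * norm (u t)) \<le> ennreal r * ennreal (\<rho> t)"
        using ae
      proof eventually_elim
        fix t assume "ereal (norm (u t)) \<le> e"
        then have "norm (u t) \<le> r" by (simp add: r(1))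
        then show "ennreal (\<rho> t * norm (u t)) \<le> ennreal r * ennreal (\<rho> t)"
          using mult_left_mono[of "norm (u t)" r "\<rho> t"] \<rho>(2)[of t] r(2)
          by (simp add: ennreal_mult[symmetric] mult.commute ennreal_leI)
      qed
    qed
    also have "\<dots> = ennreal r * ennreal \<Lambda>" by (subst nn_integral_cmult) (auto simp: \<rho>i)
    also have "\<dots> = ennreal (\<Lambda> * Lp_norm q u)"
      using True r \<Lambda>0 by (simp add: Lp_norm_def e_def[symmetric] ennreal_mult mult.commute)
    finally show ?thesis .
  next
    case False
    with \<Lambda>(2) have \<Lambda>1: "\<Lambda> = 1" by simp
    define Q where "Q = enn2real q"
    have qQ: "q = ennreal Q" using False unfolding Q_def by (cases q) auto
    have Q1: "Q \<ge> 1"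
    proof -
      have "Q \<ge> 0" by (simp add: Q_def)
      then show ?thesis using q unfolding qQ by (simp flip: ennreal_1)
    qed
    define S where "S = enn2real (\<integral>\<^sup>+t. ennreal (norm (u t) powr Q) \<partial>lebesgue)"
    have fin: "(\<integral>\<^sup>+t. ennreal (norm (u t) powr Q) \<partial>lebesgue) < \<infinity>" using u False by (simp add: Lp_def Q_def)
    have S: "(\<integral>\<^sup>+t. ennreal (norm (u t) powr Q) \<partial>lebesgue) = ennreal S" "S \<ge> 0"
      using fin by (auto simp: S_def)
    define N where "N = S powr (1/Q)"
    have LN: "Lp_norm q u = N" using False by (simp add: Lp_norm_def N_def S_def Q_def)
    show ?thesis
    proof (cases "S = 0")
      case True
      then have "(\<integral>\<^sup>+t. ennreal (norm (u t) powr Q) \<partial>lebesgue) = 0" using S(1) by simp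
      then have "AE t in lebesgue. ennreal (norm (u t) powr Q) = 0"
        by (subst nn_integral_0_iff_AE[symmetric]) auto
      then have "AE t in lebesgue. u t = 0" by eventually_elim (use Q1 in auto)
      then have "(\<integral>\<^sup>+t. ennreal (\<rho> t * norm (u t)) \<partial>lebesgue) = (\<integral>\<^sup>+(t::real). 0 \<partial>lebesgue)"
        by (intro nn_integral_cong_AE) (auto elim!: eventually_mono)
      then show ?thesis by simp
    next
      case False
      with S(2) have Spos: "S > 0" by simp
      then have Npos: "N > 0" by (simp add: N_def)
      have split: "ennreal (a * x + b * y) = ennreal a * ennreal x + ennreal b * ennreal y"
        if "a \<ge> 0" "b \<ge> 0" "x \<ge> 0" "y \<ge> 0" for a b x y :: real
        using that by (simp add: ennreal_mult)
      have NQ: "N powr Q = S" using Q1 Spos by (simp add: N_def powr_powr)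
      have pw: "\<rho> t * norm (u t) \<le> N * ((1/Q) * (norm (u t) powr Q / S)) + N * (1 - 1/Q) * \<rho> t" for t
      proof -
        have "\<rho> t * norm (u t) \<le> \<rho> t * (N * ((1/Q) * (norm (u t) powr Q / S) + (1 - 1/Q)))"
          using young_scaled[OF _ Npos Q1, of "norm (u t)"] NQ by (intro mult_left_mono \<rho>(2)) auto
        also have "\<dots> = \<rho> t * (N * ((1/Q) * (norm (u t) powr Q / S))) + N * (1 - 1/Q) * \<rho> t" by (simp add: algebra_simps)
        also have "\<rho> t * (N * ((1/Q) * (norm (u t) powr Q / S))) \<le> N * ((1/Q) * (norm (u t) powr Q / S))"
          by (rule mult_left_le_one_le) (use \<rho> Npos Q1 Spos in auto)
        finally show ?thesis by simp
      qed
      have "(\<integral>\<^sup>+t. ennreal (\<rho> t * norm (u t)) \<partial>lebesgue)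
          \<le> (\<integral>\<^sup>+t. ennreal (N / (Q * S)) * ennreal (norm (u t) powr Q) + ennreal (N * (1 - 1/Q)) * ennreal (\<rho> t) \<partial>lebesgue)"
      proof (rule nn_integral_mono)
        fix t
        have "ennreal (\<rho> t * norm (u t)) \<le> ennreal (N / (Q * S) * norm (u t) powr Q + N * (1 - 1/Q) * \<rho> t)"
          using pw[of t] by (intro ennreal_leI) (simp add: algebra_simps)
        also have "\<dots> = ennreal (N / (Q * S)) * ennreal (norm (u t) powr Q) + ennreal (N * (1 - 1/Q)) * ennreal (\<rho> t)"
          by (rule split) (use Npos Q1 Spos \<rho>(2)[of t] in auto)
        finally show "ennreal (\<rho> t * norm (u t)) \<le> ennreal (N / (Q * S)) * ennreal (norm (u t) powr Q) + ennreal (N * (1 - 1/Q)) * ennreal (\<rho> t)" .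
      qed
      also have "\<dots> = ennreal (N / (Q * S)) * ennreal S + ennreal (N * (1 - 1/Q)) * ennreal \<Lambda>"
        by (subst nn_integral_add) (auto simp: nn_integral_cmult S \<rho>i)
      also have "\<dots> = ennreal (N / (Q * S) * S + N * (1 - 1/Q) * \<Lambda>)"
        by (rule split[symmetric]) (use Npos Q1 Spos \<Lambda>0 in auto)
      also have "N / (Q * S) * S + N * (1 - 1/Q) * \<Lambda> = N"
        using Spos Q1 by (simp add: \<Lambda>1 field_simps)
      finally show ?thesis by (simp add: LN \<Lambda>1)
    qed
  qed
qed

text \<open>The norm of \<open>F\<close> is at most a function \<open>R\<close> that is bounded by \<open>B\<close> and has integral at most \<open>B\<close>;
interpolating between these two bounds gives the same bound \<open>B\<close> for every \<open>L\<^sup>p\<close> norm. Smoothing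
preserves both bounds.\<close>

lemma Lp_smooth_step:
  fixes z :: "nat \<Rightarrow> 'y::real_normed_vector"
  assumes p: "1 \<le> p" "p < \<infinity>" and s: "s > 0" and h: "h > 0"
    and z: "\<And>k. k < N \<Longrightarrow> norm (z k) \<le> B" "(\<Sum>k<N. h * norm (z k)) \<le> B" and B: "B \<ge> 0"
  defines "F \<equiv> \<lambda>t. \<Sum>k<N. smooth_ind s (real k * h) (real (Suc k) * h) t *\<^sub>R z k"
  shows "F \<in> Lp p" "Lp_norm p F \<le> B"
proof -
  define \<eta> where "\<eta> k = smooth_ind s (real k * h) (real (Suc k) * h)" for k
  have \<eta>i: "integrable lborel (\<eta> k)" for k unfolding \<eta>_def by (rule smooth_ind_integrable(2)[OF s])
  have [measurable]: "\<eta> k \<in> borel_measurable borel" for k using \<eta>i[of k] by auto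
  have \<eta>0: "\<eta> k t \<ge> 0" for k t unfolding \<eta>_def by (rule smooth_ind_nonneg)
  have \<eta>1: "(\<Sum>k<N. \<eta> k t) \<le> 1" for t
    using sum_smooth_ind[OF s, where d=h and n=N and c=0 and t=t] smooth_ind_le_1[OF s] h unfolding \<eta>_def by auto
  define R where "R t = (\<Sum>k<N. \<eta> k t * norm (z k))" for t
  have FR: "norm (F t) \<le> R t" for t
    unfolding F_def R_def \<eta>_def[symmetric] by (rule norm_sum[THEN order_trans]) (simp add: \<eta>0)
  have R0: "R t \<ge> 0" for t unfolding R_def by (intro sum_nonneg mult_nonneg_nonneg \<eta>0) simp
  have RB: "R t \<le> B" for t
  proof -
    have "R t \<le> (\<Sum>k<N. \<eta> k t * B)" unfolding R_def using z(1) \<eta>0 by (intro sum_mono mult_left_mono) auto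
    also have "\<dots> = (\<Sum>k<N. \<eta> k t) * B" by (simp add: sum_distrib_right)
    also have "\<dots> \<le> B" by (rule mult_left_le_one_le) (use \<eta>1 \<eta>0 B in \<open>auto intro: sum_nonneg\<close>)
    finally show ?thesis .
  qed
  have Ri: "integrable lborel R" unfolding R_def by (intro Bochner_Integration.integrable_sum integrable_mult_left \<eta>i)
  have RI: "(LBINT t. R t) \<le> B"
  proof -
    have "(LBINT t. R t) = (\<Sum>k<N. (LBINT t. \<eta> k t) * norm (z k))"
      unfolding R_def by (subst Bochner_Integration.integral_sum) (auto intro!: integrable_mult_left \<eta>i)
    also have "\<dots> = (\<Sum>k<N. h * norm (z k))"
      unfolding \<eta>_def using h by (intro sum.cong refl, subst integral_smooth_ind[OF s]) (auto simp: algebra_simps)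
    finally show ?thesis using z(2) by simp
  qed
  define P where "P = enn2real p"
  have pP: "p = ennreal P" using p(2) unfolding P_def by (cases p) auto
  have P1: "P \<ge> 1"
  proof -
    have "P \<ge> 0" by (simp add: P_def)
    then show ?thesis using p(1) unfolding pP by (simp flip: ennreal_1)
  qed
  have pw: "norm (F t) powr P \<le> B powr (P - 1) * R t" for t
  proof (cases "F t = 0")
    case True then show ?thesis using R0[of t] P1 by simp
  next
    case False
    have "norm (F t) powr P = norm (F t) powr (P - 1) * norm (F t)"
      using False by (simp add: powr_diff)
    also have "\<dots> \<le> B powr (P - 1) * R t"
      using FR[of t] RB[of t] P1 by (intro mult_mono powr_mono2) auto
    finally show ?thesis .
  qed
  have bd: "(\<integral>\<^sup>+t. ennreal (norm (F t) powr P) \<partial>lebesgue) \<le> ennreal (B powr P)"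
  proof -
    have "(\<integral>\<^sup>+t. ennreal (norm (F t) powr P) \<partial>lebesgue) \<le> (\<integral>\<^sup>+t. ennreal (B powr (P - 1) * R t) \<partial>lebesgue)"
      by (intro nn_integral_mono ennreal_leI pw)
    also have "\<dots> = ennreal (LBINT t. B powr (P - 1) * R t)"
      unfolding nn_integral_completion by (rule nn_integral_eq_integral) (use Ri R0 in auto)
    also have "\<dots> \<le> ennreal (B powr (P - 1) * B)"
      using RI by (intro ennreal_leI) (auto intro: mult_left_mono)
    also have "B powr (P - 1) * B = B powr P" using B by (cases "B = 0") (auto simp: powr_diff)
    finally show ?thesis .
  qed
  have Fm: "strongly_measurable F"
  proof -
    have "strongly_measurable (\<lambda>t. \<eta> k t *\<^sub>R z k)" for k
    proof (rule strongly_measurable_compose2[of "\<eta> k" "\<lambda>t. z k" "\<lambda>a b. a *\<^sub>R b"])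
      show "strongly_measurable (\<eta> k)"
        by (rule strongly_measurable_borel) (rule measurable_completion, measurable)
    qed (auto intro: strongly_measurable_const tendsto_scaleR)
    then show ?thesis unfolding F_def \<eta>_def[symmetric] by (intro strongly_measurable_sum)
  qed
  have pinf: "p \<noteq> \<infinity>" using p(2) by auto
  have "(\<integral>\<^sup>+t. ennreal (norm (F t) powr P) \<partial>lebesgue) < \<infinity>" using bd by (rule le_less_trans) simp
  then show "F \<in> Lp p" unfolding Lp_def using Fm pinf by (simp add: P_def)
  have "enn2real (\<integral>\<^sup>+t. ennreal (norm (F t) powr P) \<partial>lebesgue) \<le> B powr P"
    using enn2real_mono[OF bd] by simp
  then have "Lp_norm p F \<le> (B powr P) powr (1 / P)"
    unfolding Lp_norm_def using pinf P1 by (simp add: P_def[symmetric] powr_mono2)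
  also have "\<dots> = B" using B P1 by (simp add: powr_powr)
  finally show "Lp_norm p F \<le> B" .
qed

section \<open>The multiplier operator on smoothed step functions\<close>

lemma integrable_lebesgue_lborel:
  fixes f :: "real \<Rightarrow> 'b::{banach, second_countable_topology}"
  assumes "integrable lborel f"
  shows "integrable lebesgue f" "(\<integral>t. f t \<partial>lebesgue) = (LBINT t. f t)"
proof -
  have m: "f \<in> borel_measurable lborel" using assms by auto
  show "integrable lebesgue f" using assms integrable_completion[OF m] by simp
  show "(\<integral>t. f t \<partial>lebesgue) = (LBINT t. f t)" by (rule integral_completion[OF m])
qed

lemma bochner_complex:
  fixes f :: "real \<Rightarrow> complex"
  assumes "integrable lborel f" shows "bochner f = (LBINT t. f t)"
proof -
  have i: "integrable lebesgue f" by (rule integrable_lebesgue_lborel(1)[OF assms])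
  have m: "strongly_measurable f" by (rule strongly_measurable_borel) (use i in auto)
  have "(\<integral>\<^sup>+t. ennreal (norm (f t)) \<partial>lebesgue) < \<infinity>" using i by (simp add: integrable_iff_bounded)
  from bochner_functional(2)[OF m this bounded_linear_ident] show ?thesis
    by (simp add: integrable_lebesgue_lborel(2)[OF assms])
qed

lemma integrable_smooth_ind_iexp:
  assumes s: "s > 0"
  shows "integrable lborel (\<lambda>t. complex_of_real (smooth_ind s \<alpha> \<beta> t) * iexp (c * t))"
  by (rule Bochner_Integration.integrable_bound[OF smooth_ind_integrable(1)[OF s, of \<alpha> \<beta>]])
     (use smooth_ind_integrable(1)[OF s, of \<alpha> \<beta>] in \<open>auto simp: norm_mult\<close>)

lemma inv_fourier_smooth_ind:
  assumes s: "s > 0"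
  shows "inv_fourier (\<lambda>t. complex_of_real (smooth_ind s \<alpha> \<beta> t)) \<xi>
    = of_real (1 / (2 * pi)) * (of_real (exp (- (s\<^sup>2 * \<xi>\<^sup>2 / 2))) * ft (indicator {\<alpha>..<\<beta>}) (- \<xi>))"
proof -
  have i: "integrable lborel (\<lambda>t. complex_of_real (smooth_ind s \<alpha> \<beta> t) * iexp (\<xi> * t))"
    by (rule integrable_smooth_ind_iexp[OF s])
  have "inv_fourier (\<lambda>t. complex_of_real (smooth_ind s \<alpha> \<beta> t)) \<xi>
      = (1 / (2 * pi)) *\<^sub>R bochner (\<lambda>t. complex_of_real (smooth_ind s \<alpha> \<beta> t) * iexp (\<xi> * t))"
    unfolding inv_fourier_def scaleC_complex_def by (simp add: mult_ac)
  also have "\<dots> = (1 / (2 * pi)) *\<^sub>R ft (\<lambda>t. of_real (smooth_ind s \<alpha> \<beta> t)) (- \<xi>)"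
    unfolding bochner_complex[OF i] ft_def by simp
  also have "\<dots> = of_real (1 / (2 * pi)) * (of_real (exp (- (s\<^sup>2 * \<xi>\<^sup>2 / 2))) * ft (indicator {\<alpha>..<\<beta>}) (- \<xi>))"
    unfolding ft_smooth_ind[OF s] by (simp add: scaleR_conv_of_real)
  finally show ?thesis .
qed

lemma fourier_smooth_step:
  fixes z :: "nat \<Rightarrow> 'y::cbanach"
  assumes s: "s > 0"
  shows "fourier (\<lambda>t. \<Sum>k\<in>S. smooth_ind s (\<alpha> k) (\<beta> k) t *\<^sub>R z k) \<xi>
    = (\<Sum>k\<in>S. (of_real (exp (- (s\<^sup>2 * \<xi>\<^sup>2 / 2))) * ft (indicator {\<alpha> k..<\<beta> k}) \<xi>) *\<^sub>C z k)"
proof -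
  have i: "integrable lborel (\<lambda>t. complex_of_real (smooth_ind s (\<alpha> k) (\<beta> k) t) * iexp (- (\<xi> * t)))" for k
    using integrable_smooth_ind_iexp[OF s, of "\<alpha> k" "\<beta> k" "- \<xi>"] by simp
  have "exp (- \<i> * of_real \<xi> * of_real t) *\<^sub>C (\<Sum>k\<in>S. smooth_ind s (\<alpha> k) (\<beta> k) t *\<^sub>R z k)
      = (\<Sum>k\<in>S. (complex_of_real (smooth_ind s (\<alpha> k) (\<beta> k) t) * iexp (- (\<xi> * t))) *\<^sub>C z k)" for t
    by (simp add: bounded_bilinear.sum_right[OF bounded_bilinear_scaleC] scaleC_of_real[symmetric] scaleC_scaleC mult_ac)
  then have "fourier (\<lambda>t. \<Sum>k\<in>S. smooth_ind s (\<alpha> k) (\<beta> k) t *\<^sub>R z k) \<xi>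
      = bochner (\<lambda>t. \<Sum>k\<in>S. (complex_of_real (smooth_ind s (\<alpha> k) (\<beta> k) t) * iexp (- (\<xi> * t))) *\<^sub>C z k)"
    unfolding fourier_def by simp
  also have "\<dots> = (\<Sum>k\<in>S. (\<integral>t. complex_of_real (smooth_ind s (\<alpha> k) (\<beta> k) t) * iexp (- (\<xi> * t)) \<partial>lebesgue) *\<^sub>C z k)"
    by (rule bochner_sum_scaleC) (rule integrable_lebesgue_lborel(1)[OF i])
  also have "\<dots> = (\<Sum>k\<in>S. ft (\<lambda>t. of_real (smooth_ind s (\<alpha> k) (\<beta> k) t)) \<xi> *\<^sub>C z k)"
    unfolding ft_def by (simp only: integrable_lebesgue_lborel(2)[OF i])
  finally show ?thesis by (simp add: ft_smooth_ind[OF s])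
qed

text \<open>On a smoothed step function, tested with a smoothed indicator, the tempered distribution
\<open>multiplier_op\<close> is an absolutely convergent integral: both Fourier transforms carry the Gaussian
factor \<open>exp (- s\<^sup>2 \<xi>\<^sup>2 / 2)\<close>, and their product is the Gaussian of parameter \<open>sqrt 2 * s\<close>.\<close>

lemma multiplier_op_functional:
  fixes m :: "real \<Rightarrow> 'y::cbanach \<Rightarrow> 'x::cbanach" and l :: "'x \<Rightarrow> complex" and z :: "nat \<Rightarrow> 'y"
  assumes m: "\<And>\<xi>. bounded_clinear (m \<xi>)" "pointwise_strongly_measurable m"
    and b: "\<And>k \<xi>. k < N \<Longrightarrow> norm (m \<xi> (z k)) \<le> c k"
    and l: "bounded_clinear l"
    and \<kappa>: "\<And>k. k < N \<Longrightarrow> integrable lborel (\<kappa> k)" "\<And>k \<xi>. k < N \<Longrightarrow> l (m \<xi> (z k)) = ft (\<kappa> k) \<xi>"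
    and s: "s > 0"
  shows "l (multiplier_op m (\<lambda>t. \<Sum>k<N. smooth_ind s (\<alpha> k) (\<beta> k) t *\<^sub>R z k) (\<lambda>t. complex_of_real (smooth_ind s \<gamma> \<delta> t)))
    = of_real (1 / (2 * pi)) * (\<Sum>k<N. LBINT \<xi>. of_real (exp (- ((sqrt 2 * s)\<^sup>2 * \<xi>\<^sup>2 / 2)))
        * (ft (indicator {\<gamma>..<\<delta>}) (- \<xi>) * ft (indicator {\<alpha> k..<\<beta> k}) \<xi>) * ft (\<kappa> k) \<xi>)"
proof -
  define r where "r = sqrt 2 * s"
  have r: "r > 0" using s by (simp add: r_def)
  define W where "W k \<xi> = of_real (exp (- (r\<^sup>2 * \<xi>\<^sup>2 / 2)))
        * (ft (indicator {\<gamma>..<\<delta>}) (- \<xi>) * ft (indicator {\<alpha> k..<\<beta> k}) \<xi>)" for k \<xi>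
  have fb: "norm (ft (indicator {a..<b}) \<xi>) \<le> (LBINT x. norm (indicator {a..<b} x :: complex))" for a b \<xi>
    by (rule norm_ft_le[OF integrable_indicator_ico(1)])
  have fm[measurable]: "ft (indicator {a..<b}) \<in> borel_measurable borel" for a b
    by (rule ft_measurable[OF integrable_indicator_ico(1)])
  have W: "integrable lborel (W k)" for k
    unfolding W_def mult.assoc[symmetric]
    by (rule integrable_mult_bounded[OF integrable_mult_bounded[OF fourier_gaussian(1)[OF r] _ fb] _ fb]) measurable
  have Wl: "integrable lebesgue (W k)" for k by (rule integrable_lebesgue_lborel(1)[OF W])
  have expand: "inv_fourier (\<lambda>t. complex_of_real (smooth_ind s \<gamma> \<delta> t)) \<xi> *\<^sub>C
      m \<xi> (fourier (\<lambda>t. \<Sum>k<N. smooth_ind s (\<alpha> k) (\<beta> k) t *\<^sub>R z k) \<xi>)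
      = (\<Sum>k<N. (of_real (1 / (2 * pi)) * W k \<xi>) *\<^sub>C m \<xi> (z k))" for \<xi>
  proof -
    have e: "complex_of_real (exp (- (s\<^sup>2 * \<xi>\<^sup>2 / 2))) * complex_of_real (exp (- (s\<^sup>2 * \<xi>\<^sup>2 / 2))) = of_real (exp (- (r\<^sup>2 * \<xi>\<^sup>2 / 2)))"
      by (simp add: r_def power_mult_distrib flip: of_real_mult exp_add)
    have "m \<xi> (fourier (\<lambda>t. \<Sum>k<N. smooth_ind s (\<alpha> k) (\<beta> k) t *\<^sub>R z k) \<xi>)
       = (\<Sum>k<N. (of_real (exp (- (s\<^sup>2 * \<xi>\<^sup>2 / 2))) * ft (indicator {\<alpha> k..<\<beta> k}) \<xi>) *\<^sub>C m \<xi> (z k))"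
      unfolding fourier_smooth_step[OF s]
      using bounded_clinear_bounded_linear[OF m(1)] bounded_clinear_scaleC[OF m(1)]
      by (simp add: linear_sum bounded_linear.linear)
    moreover have "(c * (e * x)) * (e * y) = c * ((e * e) * (x * y))" for c e x y :: complex
      by (simp add: mult_ac)
    ultimately show ?thesis
      unfolding inv_fourier_smooth_ind[OF s] W_def e[symmetric]
      by (simp only: bounded_bilinear.sum_right[OF bounded_bilinear_scaleC] scaleC_scaleC)
  qed
  have mm: "strongly_measurable (\<lambda>\<xi>. m \<xi> (z k))" for k using m(2) unfolding pointwise_strongly_measurable_def by simp
  have sm: "strongly_measurable (\<lambda>\<xi>. \<Sum>k<N. (of_real (1 / (2 * pi)) * W k \<xi>) *\<^sub>C m \<xi> (z k))"
    by (intro strongly_measurable_sum strongly_measurable_scaleC mm borel_measurable_integrable integrable_mult_right Wl)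
  have fin: "(\<integral>\<^sup>+\<xi>. ennreal (norm (\<Sum>k<N. (of_real (1 / (2 * pi)) * W k \<xi>) *\<^sub>C m \<xi> (z k))) \<partial>lebesgue) < \<infinity>"
  proof -
    have "(\<integral>\<^sup>+\<xi>. ennreal (norm (\<Sum>k<N. (of_real (1 / (2 * pi)) * W k \<xi>) *\<^sub>C m \<xi> (z k))) \<partial>lebesgue)
      \<le> (\<integral>\<^sup>+\<xi>. ennreal (\<Sum>k<N. norm (of_real (1 / (2 * pi)) * W k \<xi>) * c k) \<partial>lebesgue)"
      by (intro nn_integral_mono ennreal_leI norm_sum[THEN order_trans] sum_mono)
         (auto simp: norm_scaleC norm_mult intro!: mult_left_mono b)
    also have "\<dots> = ennreal (\<integral>\<xi>. (\<Sum>k<N. norm (of_real (1 / (2 * pi)) * W k \<xi>) * c k) \<partial>lebesgue)"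
      using order_trans[OF norm_ge_zero b]
      by (intro nn_integral_eq_integral Bochner_Integration.integrable_sum integrable_mult_left integrable_norm integrable_mult_right Wl)
         (auto intro!: sum_nonneg mult_nonneg_nonneg)
    also have "\<dots> < \<infinity>" by simp
    finally show ?thesis .
  qed
  have bl: "bounded_linear l" using l by (rule bounded_clinear_bounded_linear)
  have i: "integrable lborel (\<lambda>\<xi>. of_real (1 / (2 * pi)) * (W k \<xi> * ft (\<kappa> k) \<xi>))" if k: "k < N" for k
    by (intro integrable_mult_right integrable_mult_bounded[OF W _ norm_ft_le[OF \<kappa>(1)[OF k]]])
       (use ft_measurable[OF \<kappa>(1)[OF k]] in simp)
  have "l (multiplier_op m (\<lambda>t. \<Sum>k<N. smooth_ind s (\<alpha> k) (\<beta> k) t *\<^sub>R z k) (\<lambda>t. complex_of_real (smooth_ind s \<gamma> \<delta> t)))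
     = l (bochner (\<lambda>\<xi>. \<Sum>k<N. (of_real (1 / (2 * pi)) * W k \<xi>) *\<^sub>C m \<xi> (z k)))"
    unfolding multiplier_op_def inv_fourier_dist_def regular_dist_def expand ..
  also have "\<dots> = (\<integral>\<xi>. l (\<Sum>k<N. (of_real (1 / (2 * pi)) * W k \<xi>) *\<^sub>C m \<xi> (z k)) \<partial>lebesgue)"
    by (rule bochner_functional(2)[OF sm fin bl])
  also have "\<dots> = (\<integral>\<xi>. (\<Sum>k<N. of_real (1 / (2 * pi)) * (W k \<xi> * ft (\<kappa> k) \<xi>)) \<partial>lebesgue)"
    using bl by (intro Bochner_Integration.integral_cong refl)
      (simp add: linear_sum bounded_linear.linear bounded_clinear_scaleC[OF l] scaleC_complex_def \<kappa>(2) mult.assoc)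
  also have "\<dots> = (\<Sum>k<N. \<integral>\<xi>. of_real (1 / (2 * pi)) * (W k \<xi> * ft (\<kappa> k) \<xi>) \<partial>lebesgue)"
    by (rule Bochner_Integration.integral_sum) (use i integrable_lebesgue_lborel(1) in auto)
  also have "\<dots> = (\<Sum>k<N. LBINT \<xi>. of_real (1 / (2 * pi)) * (W k \<xi> * ft (\<kappa> k) \<xi>))"
    by (intro sum.cong refl integrable_lebesgue_lborel(2)) (use i in auto)
  also have "\<dots> = of_real (1 / (2 * pi)) * (\<Sum>k<N. LBINT \<xi>. W k \<xi> * ft (\<kappa> k) \<xi>)"
    by (simp only: integral_mult_right_zero sum_distrib_left)
  finally show ?thesis unfolding W_def r_def .
qed

section \<open>Reflections and Borel representatives\<close>

lemma AE_lebesgue_reflect: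
  fixes P :: "real \<Rightarrow> bool"
  assumes "AE r in lebesgue. P r" shows "AE s in lebesgue. P (t - s)"
proof -
  have "AE r in lborel. P r" using assms by (simp add: AE_completion_iff)
  then obtain N where N: "{r. \<not> P r} \<subseteq> N" "N \<in> null_sets lborel" by (auto elim!: AE_E simp: null_sets_def)
  have "AE s in lborel. t + (-1) * s \<notin> N"
    by (rule AE_borel_affine) (use N AE_not_in[OF N(2)] in auto)
  then have "AE s in lborel. P (t - s)" by eventually_elim (use N(1) in auto)
  then show ?thesis by (simp add: AE_completion_iff)
qed

lemma strongly_measurable_reflect:
  assumes "strongly_measurable g" shows "strongly_measurable (\<lambda>s. g (t - s))"
proof -
  obtain F where F: "\<And>n. simple_function lebesgue (F n)" "AE r in lebesgue. (\<lambda>n. F n r) \<longlonglongrightarrow> g r"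
    using assms unfolding strongly_measurable_def by blast
  have T: "(\<lambda>s. t - s) \<in> lebesgue \<rightarrow>\<^sub>M (lebesgue :: real measure)"
    using lebesgue_affine_measurable[where c="\<lambda>_::real. -1" and t=t] by simp
  have "simple_function lebesgue (\<lambda>s. F n (t - s))" for n by (rule simple_function_comp[OF T F(1)])
  with AE_lebesgue_reflect[OF F(2), of t] show ?thesis
    unfolding strongly_measurable_def by (intro exI[of _ "\<lambda>n s. F n (t - s)"]) auto
qed

lemma nn_integral_reflect:
  assumes "strongly_measurable g"
  shows "(\<integral>\<^sup>+s. ennreal (norm (g (t - s))) \<partial>lebesgue) = (\<integral>\<^sup>+r. ennreal (norm (g r)) \<partial>lebesgue)"
proof -
  have "(\<lambda>r. ennreal (norm (g r))) \<in> borel_measurable lebesgue"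
    using strongly_measurable_norm[OF assms] by measurable
  from nn_integral_real_affine_lebesgue[OF this, of "-1" t] show ?thesis by simp
qed

text \<open>Fubini's theorem is used on the product of two copies of \<open>lborel\<close>, so that Lebesgue measurable
kernels are replaced by Borel representatives first.\<close>

lemma lebesgue_integrable_borel_version:
  fixes f :: "real \<Rightarrow> complex"
  assumes f: "integrable lebesgue f"
  obtains f' where "integrable lborel f'" "AE x in lebesgue. f x = f' x"
proof -
  have "(\<lambda>x. Re (f x)) \<in> borel_measurable lebesgue" "(\<lambda>x. Im (f x)) \<in> borel_measurable lebesgue"
    using f by auto
  then obtain g h where g: "g \<in> borel_measurable lborel" "AE x in lborel. Re (f x) = g x"
    and h: "h \<in> borel_measurable lborel" "AE x in lborel. Im (f x) = h x"
    using completion_ex_borel_measurable_real by metis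
  define f' where "f' x = Complex (g x) (h x)" for x
  have f'm[measurable]: "f' \<in> borel_measurable lborel"
    unfolding f'_def using g(1) h(1) by (simp add: borel_measurable_complex_iff)
  have "AE x in lborel. f x = f' x" using g(2) h(2) by eventually_elim (simp add: f'_def complex_eq_iff)
  then have ae: "AE x in lebesgue. f x = f' x" by (simp add: AE_completion_iff)
  have "integrable lebesgue f'"
    by (rule Bochner_Integration.integrable_cong_AE_imp[OF f measurable_completion[OF f'm]]) (use ae in auto)
  then have "integrable lborel f'" using integrable_completion[OF f'm] by simp
  with ae show ?thesis using that by blast
qed

lemma sum_indicator_ico:
  assumes "h \<ge> 0"
  shows "(\<Sum>k<N. indicator {real k * h..<real (Suc k) * h} s) = (indicator {0..<real N * h} s :: real)"
proof (induction N)
  case (Suc N)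
  have "real N * h \<le> real (Suc N) * h" "0 \<le> real N * h" using assms by (auto simp: mult_right_mono)
  then show ?case using Suc by (auto simp: indicator_def)
qed simp

section \<open>Multiplier bounds for step functions\<close>

text \<open>A step function takes the values \<open>z k\<close> on \<open>N\<close> consecutive intervals of length \<open>h\<close> starting at 0. Its
image under the multiplier is averaged over \<open>n\<close> consecutive intervals of length \<open>d\<close> starting at
\<open>a\<close>, each average being measured by a functional \<open>l j\<close> of its own. For \<open>q = \<infinity>\<close> the averages are
over intervals of any length; for finite \<open>q\<close> the total length is 1. The kernels \<open>\<kappa> j k\<close> have the
functionals of the multiplier as their Fourier transforms, so that the conclusion speaks about
these kernels only.\<close>

context
  fixes m :: "real \<Rightarrow> 'y::cbanach \<Rightarrow> 'x::cbanach" and l :: "nat \<Rightarrow> 'x \<Rightarrow> complex" and z :: "nat \<Rightarrow> 'y"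
    and \<kappa> :: "nat \<Rightarrow> nat \<Rightarrow> real \<Rightarrow> complex" and N n :: nat and h d B :: real
  assumes h: "h > 0" and z: "\<And>k. k < N \<Longrightarrow> norm (z k) \<le> B" and B: "B \<ge> 0" and d: "d > 0"
    and l: "\<And>j. j < n \<Longrightarrow> bounded_clinear (l j)" "\<And>j x. j < n \<Longrightarrow> norm (l j x) \<le> norm x"
    and \<kappa>: "\<And>j k. j < n \<Longrightarrow> k < N \<Longrightarrow> integrable lborel (\<kappa> j k)"
      "\<And>j k \<xi>. j < n \<Longrightarrow> k < N \<Longrightarrow> l j (m \<xi> (z k)) = ft (\<kappa> j k) \<xi>"
begin

text \<open>The kernel \<open>K\<close> of the definition acts on step functions directly. Tested with the functionals, it has
the same Fourier transform as \<open>\<kappa>\<close>, and \<open>gauss_overlap_limit\<close> shows that then all integrals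
against overlap functions agree.\<close>

lemma step_bound_convolution:
  assumes conv: "convolution_bound m C"
  shows "(\<Sum>j<n. norm (\<Sum>k<N. LBINT x. \<kappa> j k x * overlap (real k * h) (real (Suc k) * h)
      (a + real j * d) (a + real (Suc j) * d) x)) \<le> C * B * (real n * d)"
proof -
  obtain K where K: "\<And>t. bounded_clinear (K t)" "pointwise_strongly_measurable K"
    "\<And>y. (\<lambda>t. K t y) \<in> Lp 1" "\<And>y \<xi>. m \<xi> y = fourier (\<lambda>t. K t y) \<xi>"
    "\<And>f. simple_function lebesgue f \<Longrightarrow> (\<lambda>t. bochner (\<lambda>s. K (t - s) (f s))) \<in> Lp \<infinity>"
    "\<And>f. simple_function lebesgue f \<Longrightarrow> Lp_norm \<infinity> (\<lambda>t. bochner (\<lambda>s. K (t - s) (f s))) \<le> C * Lp_norm \<infinity> f"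
    and C: "C \<ge> 0"
    using conv unfolding convolution_bound_def by blast
  define I where "I k = {real k * h..<real (Suc k) * h}" for k
  define f where "f s = (\<Sum>k<N. indicator (I k) s *\<^sub>R z k)" for s
  have fs: "simple_function lebesgue f"
    unfolding f_def by (intro simple_function_sum simple_function_compose1[of _ "indicator (I _)" "\<lambda>c. c *\<^sub>R z _"])
      (auto simp: I_def)
  have fB: "norm (f s) \<le> B" for s
  proof -
    have "norm (f s) \<le> (\<Sum>k<N. indicator (I k) s * B)"
      unfolding f_def by (intro norm_sum[THEN order_trans] sum_mono) (auto intro!: mult_left_mono z)
    also have "\<dots> = indicator {0..<real N * h} s * B"
      using sum_indicator_ico[where h=h and N=N and s=s] h by (simp add: I_def sum_distrib_right[symmetric])
    also have "\<dots> \<le> B" using B by (simp add: indicator_def)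
    finally show ?thesis .
  qed
  have fLp: "Lp_norm \<infinity> f \<le> B"
  proof -
    have "esssup lebesgue (\<lambda>t. ereal (norm (f t))) \<le> ereal B"
      by (rule esssup_I) (use strongly_measurable_norm[OF strongly_measurable_simple[OF fs]] fB in auto)
    then show ?thesis unfolding Lp_norm_def
      using B by (cases "esssup lebesgue (\<lambda>t. ereal (norm (f t)))") auto
  qed
  define w where "w t = bochner (\<lambda>s. K (t - s) (f s))" for t
  have w: "w \<in> Lp \<infinity>" "Lp_norm \<infinity> w \<le> C * B"
    using K(5,6)[OF fs] mult_left_mono[OF fLp C] unfolding w_def by auto
  have wm: "strongly_measurable w" using w(1) by (simp add: Lp_def)
  have Km: "strongly_measurable (\<lambda>r. K r y)" for y using K(2) unfolding pointwise_strongly_measurable_def by simp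
  have Kfin: "(\<integral>\<^sup>+r. ennreal (norm (K r y)) \<partial>lebesgue) < \<infinity>" for y using K(3)[of y] by (simp add: Lp_def)
  have Kf: "K (t - s) (f s) = (\<Sum>k<N. indicator (I k) s *\<^sub>R K (t - s) (z k))" for t s
    unfolding f_def using bounded_clinear_bounded_linear[OF K(1)]
    by (simp add: linear_sum bounded_linear.linear bounded_clinear_scaleR[OF K(1)])
  have Kfm: "strongly_measurable (\<lambda>s. K (t - s) (f s))" for t
    unfolding Kf
    by (intro strongly_measurable_sum strongly_measurable_compose2[of "indicator (I _)" _ "\<lambda>c x. c *\<^sub>R x"]
        strongly_measurable_reflect[OF Km] strongly_measurable_simple simple_function_indicator tendsto_scaleR) (auto simp: I_def)
  have Kffin: "(\<integral>\<^sup>+s. ennreal (norm (K (t - s) (f s))) \<partial>lebesgue) < \<infinity>" for t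
  proof -
    have "(\<integral>\<^sup>+s. ennreal (norm (K (t - s) (f s))) \<partial>lebesgue) \<le> (\<integral>\<^sup>+s. (\<Sum>k<N. ennreal (norm (K (t - s) (z k)))) \<partial>lebesgue)"
    proof (rule nn_integral_mono)
      fix s
      have "norm (K (t - s) (f s)) \<le> (\<Sum>k<N. norm (K (t - s) (z k)))"
        unfolding Kf by (intro norm_sum[THEN order_trans] sum_mono) (auto simp: indicator_def)
      then show "ennreal (norm (K (t - s) (f s))) \<le> (\<Sum>k<N. ennreal (norm (K (t - s) (z k))))"
        by (simp add: sum_ennreal ennreal_leI)
    qed
    also have "\<dots> = (\<Sum>k<N. \<integral>\<^sup>+s. ennreal (norm (K (t - s) (z k))) \<partial>lebesgue)"
      by (rule nn_integral_sum) (use strongly_measurable_norm[OF strongly_measurable_reflect[OF Km]] in measurable)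
    also have "\<dots> < \<infinity>" using Kfin by (simp add: nn_integral_reflect[OF Km])
    finally show ?thesis .
  qed
  have each: "norm (\<Sum>k<N. LBINT x. \<kappa> j k x * overlap (real k * h) (real (Suc k) * h)
      (a + real j * d) (a + real (Suc j) * d) x) \<le> d * (C * B)" if j: "j < n" for j
  proof -
    define J where "J = {a + real j * d..<a + real (Suc j) * d}"
    have bl: "bounded_linear (l j)" using l(1)[OF j] by (rule bounded_clinear_bounded_linear)
    have "\<exists>g. integrable lborel g \<and> (AE r in lebesgue. l j (K r (z k)) = g r)" for k
      using lebesgue_integrable_borel_version[OF bochner_functional(1)[OF Km Kfin bl, of "z k"]] by metis
    then obtain g where g: "\<And>k. integrable lborel (g k)" "\<And>k. AE r in lebesgue. l j (K r (z k)) = g k r"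
      by metis
    have ftg: "ft (g k) \<xi> = ft (\<kappa> j k) \<xi>" if k: "k < N" for k \<xi>
    proof -
      have m1: "strongly_measurable (\<lambda>t. exp (- \<i> * of_real \<xi> * of_real t) *\<^sub>C K t (z k))"
        by (rule strongly_measurable_scaleC[OF _ Km]) (rule measurable_completion, measurable)
      have f1: "(\<integral>\<^sup>+t. ennreal (norm (exp (- \<i> * of_real \<xi> * of_real t) *\<^sub>C K t (z k))) \<partial>lebesgue) < \<infinity>"
        using Kfin[of "z k"] by (simp add: norm_scaleC)
      have "ft (\<kappa> j k) \<xi> = l j (m \<xi> (z k))" using \<kappa>(2)[OF j k] by simp
      also have "\<dots> = (\<integral>t. l j (exp (- \<i> * of_real \<xi> * of_real t) *\<^sub>C K t (z k)) \<partial>lebesgue)"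
        unfolding K(4) fourier_def by (rule bochner_functional(2)[OF m1 f1 bl])
      also have "\<dots> = (\<integral>t. g k t * iexp (- (\<xi> * t)) \<partial>lebesgue)"
      proof (rule integral_cong_AE)
        show "(\<lambda>t. l j (exp (- \<i> * of_real \<xi> * of_real t) *\<^sub>C K t (z k))) \<in> borel_measurable lebesgue"
          using bochner_functional(1)[OF m1 f1 bl] by auto
        have [measurable]: "g k \<in> borel_measurable borel" using g(1)[of k] by auto
        show "(\<lambda>t. g k t * iexp (- (\<xi> * t))) \<in> borel_measurable lebesgue"
          by (rule measurable_completion) measurable
        show "AE t in lebesgue. l j (exp (- \<i> * of_real \<xi> * of_real t) *\<^sub>C K t (z k)) = g k t * iexp (- (\<xi> * t))"
          using g(2)[of k] by eventually_elim (simp add: bounded_clinear_scaleC[OF l(1)[OF j]] scaleC_complex_def mult_ac)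
      qed
      also have "\<dots> = ft (g k) \<xi>" unfolding ft_def
        by (rule integral_completion) (use g(1)[of k] in auto)
      finally show ?thesis by simp
    qed
    have same: "(LBINT x. \<kappa> j k x * overlap \<alpha> \<beta> \<gamma> \<delta> x) = (LBINT x. g k x * overlap \<alpha> \<beta> \<gamma> \<delta> x)"
      if k: "k < N" for k \<alpha> \<beta> \<gamma> \<delta>
    proof -
      have r: "\<And>i. inverse (real (Suc i)) > 0" "(\<lambda>i. inverse (real (Suc i))) \<longlonglongrightarrow> 0" 
        using LIMSEQ_inverse_real_of_nat by auto
      have "of_real (2 * pi) * (LBINT x. \<kappa> j k x * overlap \<alpha> \<beta> \<gamma> \<delta> x) = of_real (2 * pi) * (LBINT x. g k x * overlap \<alpha> \<beta> \<gamma> \<delta> x)"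
        using gauss_overlap_limit[OF \<kappa>(1)[OF j k] r, of \<gamma> \<delta> \<alpha> \<beta>] gauss_overlap_limit[OF g(1)[of k] r, of \<gamma> \<delta> \<alpha> \<beta>]
        unfolding ftg[OF k] by (rule LIMSEQ_unique)
      then show ?thesis by simp
    qed
    have conv_eq: "l j (w t) = (\<Sum>k<N. LBINT s. indicator (I k) s * g k (t - s))" for t
    proof -
      have [measurable]: "(\<lambda>s. g k (t - s)) \<in> borel_measurable borel" for k using g(1)[of k] by measurable
      have gm: "(\<lambda>s. \<Sum>k<N. indicator (I k) s * g k (t - s)) \<in> borel_measurable lborel"
        unfolding I_def by measurable
      have "l j (w t) = (\<integral>s. l j (K (t - s) (f s)) \<partial>lebesgue)"
        unfolding w_def by (rule bochner_functional(2)[OF Kfm Kffin bl])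
      also have "\<dots> = (\<integral>s. (\<Sum>k<N. indicator (I k) s * g k (t - s)) \<partial>lebesgue)"
      proof (rule integral_cong_AE)
        show "(\<lambda>s. l j (K (t - s) (f s))) \<in> borel_measurable lebesgue"
          using bochner_functional(1)[OF Kfm Kffin bl] by auto
        show "(\<lambda>s. \<Sum>k<N. indicator (I k) s * g k (t - s)) \<in> borel_measurable lebesgue"
          by (rule measurable_completion[OF gm])
        have "AE s in lebesgue. \<forall>k\<in>{..<N}. l j (K (t - s) (z k)) = g k (t - s)"
          by (rule AE_finite_allI) (use AE_lebesgue_reflect[OF g(2)] in auto)
        then show "AE s in lebesgue. l j (K (t - s) (f s)) = (\<Sum>k<N. indicator (I k) s * g k (t - s))"
        proof eventually_elim
          fix s assume *: "\<forall>k\<in>{..<N}. l j (K (t - s) (z k)) = g k (t - s)"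
          have "l j (K (t - s) (f s)) = (\<Sum>k<N. indicator (I k) s *\<^sub>R l j (K (t - s) (z k)))"
            unfolding Kf using bl by (simp add: linear_sum bounded_linear.linear bounded_clinear_scaleR[OF l(1)[OF j]])
          also have "\<dots> = (\<Sum>k<N. indicator (I k) s * g k (t - s))"
            by (rule sum.cong) (use * in \<open>auto simp: indicator_def\<close>)
          finally show "l j (K (t - s) (f s)) = (\<Sum>k<N. indicator (I k) s * g k (t - s))" .
        qed
      qed
      also have "\<dots> = (LBINT s. (\<Sum>k<N. indicator (I k) s * g k (t - s)))"
        by (rule integral_completion[OF gm])
      also have "\<dots> = (\<Sum>k<N. LBINT s. indicator (I k) s * g k (t - s))"
      proof (rule Bochner_Integration.integral_sum)
        fix k
        have gi: "integrable lborel (\<lambda>s. g k (t - s))"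
          using lborel_integrable_real_affine[OF g(1)[of k], of "-1" t] by simp
        show "integrable lborel (\<lambda>s. indicator (I k) s * g k (t - s))"
          using integrable_mult_bounded[OF gi, of "indicator (I k)" 1] by (simp add: I_def mult.commute indicator_def)
      qed
      finally show ?thesis .
    qed
    have gi2: "integrable lborel (\<lambda>t. LBINT s. indicator (I k) s * g k (t - s))" for k
      unfolding I_def by (rule Fubini_convolution(2)[OF integrable_indicator_ico(1) g(1), of "\<lambda>_. 0" 0]) auto
    have Ji: "integrable lborel (\<lambda>t. indicator J t * (LBINT s. indicator (I k) s * g k (t - s)))" for k
      using integrable_mult_bounded[OF gi2, of "indicator J" 1 k] by (simp add: J_def mult.commute indicator_def)
    have main: "(\<Sum>k<N. LBINT x. \<kappa> j k x * overlap (real k * h) (real (Suc k) * h) (a + real j * d) (a + real (Suc j) * d) x)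
       = (LBINT t. indicator J t * l j (w t))"
    proof -
      have "(LBINT t. indicator J t * l j (w t)) = (LBINT t. (\<Sum>k<N. indicator J t * (LBINT s. indicator (I k) s * g k (t - s))))"
        unfolding conv_eq by (simp only: sum_distrib_left)
      also have "\<dots> = (\<Sum>k<N. LBINT t. indicator J t * (LBINT s. indicator (I k) s * g k (t - s)))"
        by (rule Bochner_Integration.integral_sum) (rule Ji)
      also have "\<dots> = (\<Sum>k<N. LBINT x. g k x * overlap (real k * h) (real (Suc k) * h) (a + real j * d) (a + real (Suc j) * d) x)"
        unfolding I_def J_def by (intro sum.cong refl integral_overlap g(1))
      finally show ?thesis using same by simp
    qed
    have Jw: "integrable lborel (\<lambda>t. indicator J t * l j (w t))"
      unfolding conv_eq sum_distrib_left by (rule Bochner_Integration.integrable_sum) (rule Ji)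
    have "ennreal (norm (LBINT t. indicator J t * l j (w t))) \<le> (\<integral>\<^sup>+t. ennreal (norm (indicator J t * l j (w t))) \<partial>lborel)"
      by (rule integral_norm_bound_ennreal[OF Jw])
    also have "\<dots> = (\<integral>\<^sup>+t. ennreal (norm (indicator J t * l j (w t))) \<partial>lebesgue)" by (simp add: nn_integral_completion)
    also have "\<dots> \<le> (\<integral>\<^sup>+t. ennreal (indicator J t * norm (w t)) \<partial>lebesgue)"
      using l(2)[OF j] by (intro nn_integral_mono ennreal_leI) (auto simp: indicator_def)
    also have "\<dots> \<le> ennreal (d * Lp_norm \<infinity> w)"
    proof (rule Lp_weighted_integral_le[OF w(1)])
      show "integrable lborel (indicat_real J)" unfolding J_def by (rule integrable_indicator_ico(2))
      show "(LBINT t. indicat_real J t) = d" using d by (simp add: J_def algebra_simps)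
    qed (auto simp: J_def indicator_def)
    also have "\<dots> \<le> ennreal (d * (C * B))" using w(2) d by (intro ennreal_leI mult_left_mono) auto
    finally show ?thesis unfolding main
      using d C B by (subst (asm) ennreal_le_iff) auto
  qed
  have "(\<Sum>j<n. norm (\<Sum>k<N. LBINT x. \<kappa> j k x * overlap (real k * h) (real (Suc k) * h)
      (a + real j * d) (a + real (Suc j) * d) x)) \<le> (\<Sum>j<n. d * (C * B))"
    by (rule sum_mono) (use each in auto)
  then show ?thesis by (simp add: mult_ac)
qed

text \<open>The step function is smoothed to a Schwartz function \<open>F\<close>, on which the extension \<open>U\<close> is given by
the multiplier; testing \<open>U F\<close> with the smoothed indicators \<open>\<eta> j\<close> and the functionals \<open>l j\<close>
gives a bound that is uniform in the smoothing parameter, which then tends to zero.\<close>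

lemma step_bound_extension:
  assumes ext: "extension_bound p q m C" and p: "1 \<le> p" "p < \<infinity>" and q: "1 \<le> q"
    and m: "\<And>\<xi>. bounded_clinear (m \<xi>)" "pointwise_strongly_measurable m"
    and b: "\<And>k \<xi>. k < N \<Longrightarrow> norm (m \<xi> (z k)) \<le> c k"
    and z': "(\<Sum>k<N. h * norm (z k)) \<le> B" and d': "q = \<infinity> \<or> real n * d = 1"
  shows "(\<Sum>j<n. norm (\<Sum>k<N. LBINT x. \<kappa> j k x * overlap (real k * h) (real (Suc k) * h)
      (a + real j * d) (a + real (Suc j) * d) x)) \<le> C * B * (real n * d)"
proof -
  note z = z z' and d = d d'
  define \<Lambda> where "\<Lambda> = real n * d"
  obtain U where U: "\<And>f. f \<in> Lp p \<Longrightarrow> U f \<in> Lp q" "\<And>f. f \<in> Lp p \<Longrightarrow> Lp_norm q (U f) \<le> C * Lp_norm p f"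
    "\<And>f \<phi>. f \<in> schwartz \<Longrightarrow> \<phi> \<in> schwartz \<Longrightarrow> regular_dist (U f) \<phi> = multiplier_op m f \<phi>" and C: "C \<ge> 0"
    using ext unfolding extension_bound_def by blast
  define G where "G s j k = (LBINT \<xi>. of_real (exp (- ((sqrt 2 * s)\<^sup>2 * \<xi>\<^sup>2 / 2)))
        * (ft (indicator {a + real j * d..<a + real (Suc j) * d}) (- \<xi>) * ft (indicator {real k * h..<real (Suc k) * h}) \<xi>)
        * ft (\<kappa> j k) \<xi>)" for s j k
  have bound: "(\<Sum>j<n. norm (of_real (1 / (2 * pi)) * (\<Sum>k<N. G s j k))) \<le> \<Lambda> * (C * B)" if s: "s > 0" for s
  proof -
    define F where "F = (\<lambda>t. \<Sum>k<N. smooth_ind s (real k * h) (real (Suc k) * h) t *\<^sub>R z k)"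
    define \<eta> where "\<eta> j = smooth_ind s (a + real j * d) (a + real (Suc j) * d)" for j
    have F: "F \<in> Lp p" "Lp_norm p F \<le> B"
      unfolding F_def using Lp_smooth_step[OF p s h z B] by auto
    have FS: "F \<in> schwartz"
      unfolding F_def by (intro schwartz_sum schwartz_scaleR smooth_ind_schwartz[OF s]) (use h in \<open>simp add: algebra_simps\<close>)
    have \<eta>S: "(\<lambda>t. complex_of_real (\<eta> j t)) \<in> schwartz" for j
    proof -
      have "(\<lambda>t. \<eta> j t *\<^sub>R (1::complex)) \<in> schwartz"
        unfolding \<eta>_def by (intro schwartz_scaleR smooth_ind_schwartz[OF s]) (use d in \<open>simp add: algebra_simps\<close>)
      then show ?thesis by (simp add: scaleR_conv_of_real)
    qed
    let ?u = "U F"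
    have um: "strongly_measurable ?u" using U(1)[OF F(1)] by (simp add: Lp_def)
    have \<eta>i: "integrable lborel (\<eta> j)" for j unfolding \<eta>_def by (rule smooth_ind_integrable(2)[OF s])
    have [measurable]: "\<eta> j \<in> borel_measurable borel" for j using \<eta>i[of j] by auto
    have [measurable]: "\<eta> j \<in> borel_measurable lebesgue" for j by (rule measurable_completion) simp
    have \<eta>0: "\<eta> j t \<ge> 0" for j t unfolding \<eta>_def by (rule smooth_ind_nonneg)
    have nu[measurable]: "(\<lambda>t. norm (?u t)) \<in> borel_measurable lebesgue" by (rule strongly_measurable_norm[OF um])
    have sum\<eta>: "(\<lambda>t. \<Sum>j<n. \<eta> j t) = smooth_ind s a (a + real n * d)"
    proof
      fix t show "(\<Sum>j<n. \<eta> j t) = smooth_ind s a (a + real n * d) t"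
        unfolding \<eta>_def using d(1) by (intro sum_smooth_ind[OF s]) simp
    qed
    have tot: "(\<integral>\<^sup>+t. ennreal ((\<Sum>j<n. \<eta> j t) * norm (?u t)) \<partial>lebesgue) \<le> ennreal (\<Lambda> * Lp_norm q ?u)"
    proof (rule Lp_weighted_integral_le[OF U(1)[OF F(1)] q])
      show "(\<lambda>t. \<Sum>j<n. \<eta> j t) \<in> borel_measurable borel" by measurable
      show "0 \<le> (\<Sum>j<n. \<eta> j t)" for t by (intro sum_nonneg \<eta>0)
      show "(\<Sum>j<n. \<eta> j t) \<le> 1" for t
        using fun_cong[OF sum\<eta>, of t] smooth_ind_le_1[OF s] by simp
      show "integrable lborel (\<lambda>t. \<Sum>j<n. \<eta> j t)" by (intro Bochner_Integration.integrable_sum \<eta>i)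
      show "(LBINT t. (\<Sum>j<n. \<eta> j t)) = \<Lambda>"
        unfolding sum\<eta> \<Lambda>_def by (subst integral_smooth_ind[OF s]) (use d in auto)
      show "q = \<infinity> \<or> \<Lambda> = 1" using d(2) by (simp add: \<Lambda>_def)
    qed
    (* The weights of the different windows add up to a smoothed indicator, hence to at most 1. *)
    have each: "ennreal (norm (of_real (1 / (2 * pi)) * (\<Sum>k<N. G s j k))) \<le> (\<integral>\<^sup>+t. ennreal (\<eta> j t * norm (?u t)) \<partial>lebesgue)"
      if j: "j < n" for j
    proof -
      have "of_real (1 / (2 * pi)) * (\<Sum>k<N. G s j k) = l j (multiplier_op m F (\<lambda>t. complex_of_real (\<eta> j t)))"
        unfolding F_def \<eta>_def G_def
        by (rule multiplier_op_functional[OF m b l(1)[OF j] _ _ s, symmetric]) (use \<kappa> j in auto)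
      also have "\<dots> = l j (regular_dist ?u (\<lambda>t. complex_of_real (\<eta> j t)))" by (simp add: U(3)[OF FS \<eta>S])
      also have "\<dots> = l j (bochner (\<lambda>t. complex_of_real (\<eta> j t) *\<^sub>C ?u t))" by (simp add: regular_dist_def)
      finally have eq: "of_real (1 / (2 * pi)) * (\<Sum>k<N. G s j k) = l j (bochner (\<lambda>t. complex_of_real (\<eta> j t) *\<^sub>C ?u t))" .
      have sm: "strongly_measurable (\<lambda>t. complex_of_real (\<eta> j t) *\<^sub>C ?u t)"
        by (rule strongly_measurable_scaleC[OF _ um]) measurable
      have nrm: "norm (complex_of_real (\<eta> j t) *\<^sub>C ?u t) = \<eta> j t * norm (?u t)" for t
        using \<eta>0[of j t] by (simp add: norm_scaleC)
      have "(\<integral>\<^sup>+t. ennreal (\<eta> j t * norm (?u t)) \<partial>lebesgue) \<le> (\<integral>\<^sup>+t. ennreal ((\<Sum>j<n. \<eta> j t) * norm (?u t)) \<partial>lebesgue)"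
        by (intro nn_integral_mono ennreal_leI mult_right_mono member_le_sum) (use j \<eta>0 in auto)
      also have "\<dots> < \<infinity>" using tot by (rule le_less_trans) simp
      finally have fin: "(\<integral>\<^sup>+t. ennreal (norm (complex_of_real (\<eta> j t) *\<^sub>C ?u t)) \<partial>lebesgue) < \<infinity>"
        unfolding nrm .
      have bl: "bounded_linear (l j)" using l(1)[OF j] by (rule bounded_clinear_bounded_linear)
      have "ennreal (norm (l j (bochner (\<lambda>t. complex_of_real (\<eta> j t) *\<^sub>C ?u t))))
          \<le> (\<integral>\<^sup>+t. ennreal (norm (l j (complex_of_real (\<eta> j t) *\<^sub>C ?u t))) \<partial>lebesgue)"
        unfolding bochner_functional(2)[OF sm fin bl]
        by (rule integral_norm_bound_ennreal[OF bochner_functional(1)[OF sm fin bl]])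
      also have "\<dots> \<le> (\<integral>\<^sup>+t. ennreal (\<eta> j t * norm (?u t)) \<partial>lebesgue)"
        using l(2)[OF j] by (intro nn_integral_mono ennreal_leI) (simp add: nrm[symmetric])
      finally show ?thesis unfolding eq .
    qed
    have "ennreal (\<Sum>j<n. norm (of_real (1 / (2 * pi)) * (\<Sum>k<N. G s j k)))
        = (\<Sum>j<n. ennreal (norm (of_real (1 / (2 * pi)) * (\<Sum>k<N. G s j k))))"
      by (rule sum_ennreal[symmetric]) simp
    also have "\<dots> \<le> (\<Sum>j<n. \<integral>\<^sup>+t. ennreal (\<eta> j t * norm (?u t)) \<partial>lebesgue)"
      by (rule sum_mono) (use each in auto)
    also have "\<dots> = (\<integral>\<^sup>+t. (\<Sum>j<n. ennreal (\<eta> j t * norm (?u t))) \<partial>lebesgue)"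
      by (rule nn_integral_sum[symmetric]) measurable
    also have "\<dots> = (\<integral>\<^sup>+t. ennreal ((\<Sum>j<n. \<eta> j t) * norm (?u t)) \<partial>lebesgue)"
      using \<eta>0 by (intro nn_integral_cong) (simp add: sum_ennreal sum_distrib_right)
    also have "\<dots> \<le> ennreal (\<Lambda> * Lp_norm q ?u)" by (rule tot)
    also have "\<dots> \<le> ennreal (\<Lambda> * (C * B))"
    proof (rule ennreal_leI, rule mult_left_mono)
      have "Lp_norm q ?u \<le> C * Lp_norm p F" by (rule U(2)[OF F(1)])
      also have "\<dots> \<le> C * B" by (rule mult_left_mono[OF F(2) C])
      finally show "Lp_norm q ?u \<le> C * B" .
      show "0 \<le> \<Lambda>" using d(1) by (simp add: \<Lambda>_def)
    qed
    finally show ?thesis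
      using d(1) C B by (subst (asm) ennreal_le_iff) (auto simp: \<Lambda>_def)
  qed
  define r where "r i = inverse (real (Suc i))" for i
  have r: "r i > 0" "r \<longlonglongrightarrow> 0" for i unfolding r_def using LIMSEQ_inverse_real_of_nat by auto
  (* Smoothing of both factors by s amounts to a Gaussian of parameter sqrt 2 * s. *)
  have lim: "(\<lambda>i. G (r i / sqrt 2) j k) \<longlonglongrightarrow> of_real (2 * pi) * (LBINT x. \<kappa> j k x * overlap (real k * h) (real (Suc k) * h)
      (a + real j * d) (a + real (Suc j) * d) x)" if "j < n" "k < N" for j k
    using gauss_overlap_limit[OF \<kappa>(1)[OF that] r, of "a + real j * d" "a + real (Suc j) * d" "real k * h" "real (Suc k) * h"]
    by (simp add: G_def)
  have "(\<lambda>i. \<Sum>j<n. norm (of_real (1 / (2 * pi)) * (\<Sum>k<N. G (r i / sqrt 2) j k)))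
    \<longlonglongrightarrow> (\<Sum>j<n. norm (of_real (1 / (2 * pi)) * (\<Sum>k<N. of_real (2 * pi) * (LBINT x. \<kappa> j k x * overlap (real k * h) (real (Suc k) * h)
      (a + real j * d) (a + real (Suc j) * d) x))))"
    by (intro tendsto_sum tendsto_norm tendsto_mult tendsto_const lim) auto
  moreover have "of_real (1 / (2 * pi)) * (\<Sum>k<N. of_real (2 * pi) * w k) = (\<Sum>k<N. w k)" for w :: "nat \<Rightarrow> complex"
    by (simp add: sum_distrib_left[symmetric])
  ultimately have L: "(\<lambda>i. \<Sum>j<n. norm (of_real (1 / (2 * pi)) * (\<Sum>k<N. G (r i / sqrt 2) j k)))
    \<longlonglongrightarrow> (\<Sum>j<n. norm (\<Sum>k<N. LBINT x. \<kappa> j k x * overlap (real k * h) (real (Suc k) * h)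
      (a + real j * d) (a + real (Suc j) * d) x))" by simp
  have "(\<Sum>j<n. norm (\<Sum>k<N. LBINT x. \<kappa> j k x * overlap (real k * h) (real (Suc k) * h)
      (a + real j * d) (a + real (Suc j) * d) x)) \<le> \<Lambda> * (C * B)"
    by (rule LIMSEQ_le_const2[OF L]) (use bound r(1) in auto)
  then show ?thesis by (simp add: \<Lambda>_def mult_ac)
qed

lemma step_bound:
  assumes mb: "multiplier_bound p q m C" and pq: "1 \<le> p" "p \<le> q" and m: "m \<in> fourier_multipliers p q"
    and b: "\<And>k \<xi>. k < N \<Longrightarrow> norm (m \<xi> (z k)) \<le> c k"
    and z': "(\<Sum>k<N. h * norm (z k)) \<le> B" and d': "q = \<infinity> \<or> real n * d = 1"
  shows "(\<Sum>j<n. norm (\<Sum>k<N. LBINT x. \<kappa> j k x * overlap (real k * h) (real (Suc k) * h)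
      (a + real j * d) (a + real (Suc j) * d) x)) \<le> C * B * (real n * d)"
proof (cases "p = \<infinity>")
  case True
  then show ?thesis using mb by (intro step_bound_convolution) (simp add: multiplier_bound_def)
next
  case False
  then have e: "extension_bound p q m C" and p: "p < \<infinity>"
    using mb by (auto simp: multiplier_bound_def top.not_eq_extremum)
  have m': "\<And>\<xi>. bounded_clinear (m \<xi>)" "pointwise_strongly_measurable m"
    using m by (auto simp: fourier_multipliers_def)
  show ?thesis
    by (rule step_bound_extension[OF e pq(1) p order_trans[OF pq] m' b z' d'])
qed

end

section \<open>From step functions to orbits\<close>

lemma resolvent_kernel:
  fixes T :: "real \<Rightarrow> 'x::cbanach \<Rightarrow> 'x" and l :: "'x \<Rightarrow> complex"
  assumes T: "C0_semigroup T" and gen: "is_generator D (\<lambda>x. - A x) T"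
    and spec: "{z. Re z < 0} \<subseteq> resolvent_set D A" and a: "a > 0"
    and int: "integrable lborel (\<lambda>s. indicator {0..} s * (exp (- a * s) * norm (T s v)))"
    and l: "bounded_clinear l" "\<And>x. norm (l x) \<le> norm x"
  defines "\<kappa> \<equiv> \<lambda>s. indicator {0..} s * (of_real (exp (- a * s)) * l (T s v))"
  shows "integrable lborel \<kappa>" "l (inv_into D (\<lambda>x. Complex a \<xi> *\<^sub>C x + A x) v) = ft \<kappa> \<xi>"
    "norm (ft \<kappa> \<xi>) \<le> (LBINT s. indicator {0..} s * (exp (- a * s) * norm (T s v)))"
proof -
  have bl: "bounded_linear l" using l(1) by (rule bounded_clinear_bounded_linear)
  have cont: "continuous_on {0..} (\<lambda>s. of_real (exp (- a * s)) * l (T s v))"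
    by (intro continuous_intros continuous_on_compose2[OF linear_continuous_on[OF bl, of UNIV] C0_semigroupD(4)[OF T]]) auto
  have "(\<lambda>s. indicator {0..} s *\<^sub>R (of_real (exp (- a * s)) * l (T s v))) \<in> borel_measurable borel"
    by (rule borel_measurable_continuous_on_indicator) (use cont in auto)
  moreover have "(\<lambda>s. indicator {0..} s *\<^sub>R (of_real (exp (- a * s)) * l (T s v))) = \<kappa>"
    by (auto simp: \<kappa>_def indicator_def)
  ultimately have m: "\<kappa> \<in> borel_measurable borel" by simp
  have le: "norm (\<kappa> s) \<le> indicator {0..} s * (exp (- a * s) * norm (T s v))" for s
    using l(2) by (auto simp: \<kappa>_def indicator_def norm_mult)
  show i: "integrable lborel \<kappa>"
    by (rule Bochner_Integration.integrable_bound[OF int])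
       (use m le in \<open>auto intro!: AE_I2 order_trans[OF le]\<close>)
  have "- Complex a \<xi> \<in> resolvent_set D A" using spec a by auto
  from laplace_transform_resolvent[OF T gen this _ int bl]
  have "l (inv_into D (\<lambda>x. Complex a \<xi> *\<^sub>C x + A x) v)
     = (LBINT s. indicator {0..} s * l (exp (- Complex a \<xi> * of_real s) *\<^sub>C T s v))" by simp
  also have "\<dots> = ft \<kappa> \<xi>" unfolding ft_def
  proof (rule Bochner_Integration.integral_cong[OF refl])
    fix s
    have "exp (- Complex a \<xi> * of_real s) = of_real (exp (- a * s)) * iexp (- (\<xi> * s))"
    proof -
      have "- Complex a \<xi> * of_real s = of_real (- a * s) + \<i> * of_real (- (\<xi> * s))"
        by (simp add: complex_eq_iff)
      then show ?thesis by (simp only: exp_add exp_of_real)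
    qed
    then show "indicator {0..} s * l (exp (- Complex a \<xi> * of_real s) *\<^sub>C T s v) = \<kappa> s * iexp (- (\<xi> * s))"
      by (simp add: \<kappa>_def bounded_clinear_scaleC[OF l(1)] scaleC_complex_def mult_ac)
  qed
  finally show "l (inv_into D (\<lambda>x. Complex a \<xi> *\<^sub>C x + A x) v) = ft \<kappa> \<xi>" .
  show "norm (ft \<kappa> \<xi>) \<le> (LBINT s. indicator {0..} s * (exp (- a * s) * norm (T s v)))"
    by (rule norm_ft_le[OF i, THEN order_trans]) (rule integral_mono[OF integrable_norm[OF i] int le])
qed

lemma sum_indicator_select:
  fixes f :: "nat \<Rightarrow> complex"
  assumes h: "h > 0" and k0: "k0 < N" "real k0 * h \<le> s" "s < real (Suc k0) * h"
  shows "(\<Sum>k<N. indicator {real k * h..<real (Suc k) * h} s * f k) = f k0"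
proof -
  have "indicator {real k * h..<real (Suc k) * h} s * f k = (if k = k0 then f k else 0)" for k
  proof (cases "k = k0")
    case True then show ?thesis using k0 by simp
  next
    case False
    have "\<not> (real k * h \<le> s \<and> s < real (Suc k) * h)"
    proof
      assume *: "real k * h \<le> s \<and> s < real (Suc k) * h"
      then have "real k * h < real (Suc k0) * h" "real k0 * h < real (Suc k) * h" using k0 by linarith+
      then have "k < Suc k0" "k0 < Suc k" using h by (auto simp del: of_nat_Suc)
      with False show False by simp
    qed
    then show ?thesis using False by (auto simp: indicator_def)
  qed
  then show ?thesis using k0(1) by simp
qed

text \<open>A lower Riemann sum of the integral of \<open>exp (- s)\<close> over the half line.\<close>

lemma sum_exp_step_le_1:
  assumes h: "h > 0"
  shows "(\<Sum>k<N. h * exp (- (real (Suc k) * h))) \<le> 1"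
proof -
  have "(\<Sum>k<N. h * exp (- (real (Suc k) * h))) \<le> (\<Sum>k<N. exp (- (real k * h)) - exp (- (real (Suc k) * h)))"
  proof (rule sum_mono)
    fix k
    have e: "exp (- (real k * h)) = exp h * exp (- (real (Suc k) * h))"
      by (simp add: algebra_simps flip: exp_add)
    have "(1 + h) * exp (- (real (Suc k) * h)) \<le> exp h * exp (- (real (Suc k) * h))"
      by (intro mult_right_mono exp_ge_add_one_self) simp
    then show "h * exp (- (real (Suc k) * h)) \<le> exp (- (real k * h)) - exp (- (real (Suc k) * h))"
      unfolding e by (simp add: algebra_simps)
  qed
  also have "\<dots> = 1 - exp (- (real N * h))"
    using sum_lessThan_telescope'[of "\<lambda>k. exp (- (real k * h))" N] by simp
  finally show ?thesis using exp_ge_zero[of "- (real N * h)"] by linarith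
qed

lemma integrable_ico_continuous:
  fixes \<phi> :: "real \<Rightarrow> complex"
  assumes "continuous_on {\<alpha>..\<beta>} \<phi>"
  shows "integrable lborel (\<lambda>t. indicator {\<alpha>..<\<beta>} t * \<phi> t)"
proof -
  have i: "integrable lborel (\<lambda>t. indicator {\<alpha>..\<beta>} t *\<^sub>R \<phi> t)"
    using borel_integrable_atLeastAtMost'[OF assms] unfolding set_integrable_def .
  have "integrable lborel (\<lambda>t. (indicator {\<alpha>..\<beta>} t *\<^sub>R \<phi> t) * indicator {\<alpha>..<\<beta>} t)"
    by (rule integrable_mult_bounded[OF i, of _ 1]) (auto simp: indicator_def)
  moreover have "(\<lambda>t. (indicator {\<alpha>..\<beta>} t *\<^sub>R \<phi> t) * indicator {\<alpha>..<\<beta>} t) = (\<lambda>t. indicator {\<alpha>..<\<beta>} t * \<phi> t)"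
    by (auto simp: indicator_def)
  ultimately show ?thesis by simp
qed

lemma semigroup_functional_continuous:
  assumes "C0_semigroup T" "bounded_linear (l :: 'x::complex_normed_vector \<Rightarrow> complex)"
  shows "continuous_on {0..} (\<lambda>t. l (T t x))"
  by (rule continuous_on_compose2[OF linear_continuous_on[OF assms(2), of UNIV] C0_semigroupD(4)[OF assms(1)]]) auto

lemma integral_exp_window:
  assumes w: "\<omega> > 0" and t: "t \<ge> 0"
  shows "(LBINT s. indicator {0..t} s * of_real (exp (- \<omega> * s))) = complex_of_real ((1 - exp (- \<omega> * t)) / \<omega>)"
proof -
  have "(LBINT s. exp (- \<omega> * s) * indicator {0..t} s) = (- exp (- \<omega> * t) / \<omega>) - (- exp (- \<omega> * 0) / \<omega>)"
  proof (rule integral_FTC_Icc_real[OF t])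
    show "((\<lambda>s. - exp (- \<omega> * s) / \<omega>) has_real_derivative exp (- \<omega> * x)) (at x)" for x
      by (rule derivative_eq_intros refl | use w in simp)+
  qed (intro continuous_intros)
  moreover have "(LBINT s. indicator {0..t} s * of_real (exp (- \<omega> * s)))
      = complex_of_real (LBINT s. exp (- \<omega> * s) * indicator {0..t} s)"
    unfolding integral_complex_of_real[symmetric]
    by (rule Bochner_Integration.integral_cong) (auto simp: indicator_def)
  ultimately show ?thesis by (simp add: diff_divide_distrib)
qed

lemma window_average_lower:
  fixes \<psi> :: "real \<Rightarrow> complex" and w :: "real \<Rightarrow> real"
  assumes d: "d > 0" and \<psi>: "continuous_on {\<alpha>..\<alpha> + d} \<psi>" and w: "continuous_on {\<alpha>..\<alpha> + d} w"
    and wb: "\<And>u. u \<in> {\<alpha>..<\<alpha> + d} \<Longrightarrow> w0 \<le> w u" "\<And>u. u \<in> {\<alpha>..<\<alpha> + d} \<Longrightarrow> \<bar>w u\<bar> \<le> 1"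
    and \<epsilon>: "\<And>u. u \<in> {\<alpha>..<\<alpha> + d} \<Longrightarrow> norm (\<psi> u - \<psi>0) \<le> \<epsilon>"
  shows "d * (w0 * norm \<psi>0 - \<epsilon>) \<le> norm (LBINT t. indicator {\<alpha>..<\<alpha> + d} t * (of_real (w t) * \<psi> t))"
proof -
  let ?J = "{\<alpha>..<\<alpha> + d}"
  have i1: "integrable lborel (\<lambda>t. indicator ?J t * of_real (w t) :: complex)"
    by (rule integrable_ico_continuous) (intro continuous_intros w)
  have i2: "integrable lborel (\<lambda>t. indicator ?J t * (of_real (w t) * (\<psi> t - \<psi>0)))"
    by (rule integrable_ico_continuous) (intro continuous_intros w \<psi>)
  have eq: "(LBINT t. indicator ?J t * (of_real (w t) * \<psi> t))
      = (LBINT t. indicator ?J t * of_real (w t)) * \<psi>0 + (LBINT t. indicator ?J t * (of_real (w t) * (\<psi> t - \<psi>0)))"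
  proof -
    have "(LBINT t. indicator ?J t * (of_real (w t) * \<psi> t))
        = (LBINT t. indicator ?J t * of_real (w t) * \<psi>0 + indicator ?J t * (of_real (w t) * (\<psi> t - \<psi>0)))"
      by (rule Bochner_Integration.integral_cong) (auto simp: algebra_simps)
    also have "\<dots> = (LBINT t. indicator ?J t * of_real (w t) * \<psi>0)
        + (LBINT t. indicator ?J t * (of_real (w t) * (\<psi> t - \<psi>0)))"
      by (rule Bochner_Integration.integral_add[OF integrable_mult_left[OF i1] i2])
    finally show ?thesis by (simp only: integral_mult_left_zero)
  qed
  have J: "integrable lborel (indicat_real ?J)" "(LBINT t. indicat_real ?J t) = d"
    using integrable_indicator_ico(2)[of \<alpha> "\<alpha> + d"] d by auto
  have i1r: "integrable lborel (\<lambda>t. indicator ?J t * w t)"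
  proof -
    have "integrable lborel (\<lambda>t. Re (indicator ?J t * of_real (w t)))" by (rule integrable_Re[OF i1])
    moreover have "(\<lambda>t. Re (indicator ?J t * of_real (w t))) = (\<lambda>t. indicator ?J t * w t)"
      by (auto simp: indicator_def)
    ultimately show ?thesis by simp
  qed
  have I1: "(LBINT t. indicator ?J t * of_real (w t)) = complex_of_real (LBINT t. indicator ?J t * w t)"
    unfolding integral_complex_of_real[symmetric] by (rule Bochner_Integration.integral_cong) (auto simp: indicator_def)
  have "(LBINT t. indicat_real ?J t * w0) \<le> (LBINT t. indicator ?J t * w t)"
  proof (rule integral_mono[OF integrable_mult_left[OF J(1)] i1r])
    show "indicat_real ?J t * w0 \<le> indicat_real ?J t * w t" for t
      using wb(1) by (cases "t \<in> ?J") (auto simp: indicator_def)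
  qed
  then have I1b: "d * w0 \<le> (LBINT t. indicator ?J t * w t)" using J(2) by simp
  have I2: "norm (LBINT t. indicator ?J t * (of_real (w t) * (\<psi> t - \<psi>0))) \<le> d * \<epsilon>"
  proof -
    have "norm (LBINT t. indicator ?J t * (of_real (w t) * (\<psi> t - \<psi>0)))
        \<le> (LBINT t. norm (indicator ?J t * (of_real (w t) * (\<psi> t - \<psi>0))))" by (rule integral_norm_bound)
    also have "\<dots> \<le> (LBINT t. indicat_real ?J t * \<epsilon>)"
    proof (rule integral_mono[OF integrable_norm[OF i2]])
      show "integrable lborel (\<lambda>t. indicat_real ?J t * \<epsilon>)" by (intro integrable_mult_left J(1))
      fix t
      have "\<bar>w t\<bar> * norm (\<psi> t - \<psi>0) \<le> 1 * \<epsilon>" if "t \<in> ?J"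
        using wb(2)[OF that] \<epsilon>[OF that] by (intro mult_mono) auto
      then show "norm (indicator ?J t * (of_real (w t) * (\<psi> t - \<psi>0))) \<le> indicat_real ?J t * \<epsilon>"
        by (auto simp: indicator_def norm_mult)
    qed
    also have "\<dots> = d * \<epsilon>" using J(2) by simp
    finally show ?thesis .
  qed
  have "d * w0 * norm \<psi>0 \<le> (LBINT t. indicator ?J t * w t) * norm \<psi>0"
    using I1b by (rule mult_right_mono) simp
  also have "\<dots> \<le> norm ((LBINT t. indicator ?J t * of_real (w t)) * \<psi>0)"
    unfolding I1 norm_mult norm_of_real by (rule mult_right_mono[OF abs_ge_self norm_ge_zero])
  also have "\<dots> \<le> norm (LBINT t. indicator ?J t * (of_real (w t) * \<psi> t))
      + norm (LBINT t. indicator ?J t * (of_real (w t) * (\<psi> t - \<psi>0)))"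
    unfolding eq using norm_triangle_ineq4[of "x + y" y for x y] by (simp only: add_diff_cancel_right')
  finally show ?thesis using I2 by (simp add: algebra_simps)
qed

text \<open>The function \<open>orb\<close> is the orbit of \<open>y\<close> as a map into the smaller space, with the growth bound that
holds there. It may fail to be measurable as such a map. On the range of \<open>j\<close> the weighted orbit
\<open>exp (- a s) T s\<close> is integrable.\<close>

context
  fixes T :: "real \<Rightarrow> 'x::cbanach \<Rightarrow> 'x" and i :: "'y::cbanach \<Rightarrow> 'x" and j :: "'z \<Rightarrow> 'y"
    and D :: "'x set" and A :: "'x \<Rightarrow> 'x" and \<omega> M' a B C :: real and p q :: ennreal
    and y :: 'y and orb :: "real \<Rightarrow> 'y"
  assumes T: "C0_semigroup T" and gen: "is_generator D (\<lambda>x. - A x) T"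
    and spec: "{z. Re z < 0} \<subseteq> resolvent_set D A"
    and i: "bounded_clinear i" and dense: "closure (range j) = UNIV"
    and growth: "\<omega> \<ge> 1" "\<And>s. s \<ge> 0 \<Longrightarrow> onorm (T s) \<le> M' * exp (s * (\<omega> - 1))"
    and a: "a > 0"
    and int: "\<And>z. integrable lborel (\<lambda>s. indicator {0..} s * (exp (- a * s) * norm (T s (i (j z)))))"
    and orb: "\<And>s. s \<ge> 0 \<Longrightarrow> i (orb s) = T s (i y)" "\<And>s. s \<ge> 0 \<Longrightarrow> norm (orb s) \<le> B * exp (s * (\<omega> - 1))"
    and B: "B > 0" and pq: "1 \<le> p" "p \<le> q"
    and mf: "(\<lambda>\<xi> y. inv_into D (\<lambda>x. Complex a \<xi> *\<^sub>C x + A x) (i y)) \<in> fourier_multipliers p q"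
    and mb: "multiplier_bound p q (\<lambda>\<xi> y. inv_into D (\<lambda>x. Complex a \<xi> *\<^sub>C x + A x) (i y)) C"
begin

text \<open>For \<open>f s = exp (- (\<omega> + a) s) orb s\<close> the semigroup law makes the integrand of the convolution of
\<open>exp (- a s) T s\<close> with \<open>f\<close> equal to \<open>exp (- a t) exp (- \<omega> s) T t (i y)\<close>, and the integral over
\<open>0 \<le> s \<le> t\<close> is the function in the conclusion. As \<open>orb\<close> need not be measurable, \<open>f\<close> is replaced by
step functions of mesh \<open>h N\<close>, whose values in the range of \<open>j\<close> approximate those of \<open>f\<close> at the grid
points. Their images converge because the semigroup is strongly continuous on the larger space,
and their norms are bounded by \<open>B exp (- s)\<close>, whence the constant \<open>B\<close>.\<close>

lemma orbit_window_bound: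
  fixes l :: "nat \<Rightarrow> 'x \<Rightarrow> complex"
  assumes c: "c \<ge> 0" and d: "d > 0" "q = \<infinity> \<or> real n * d = 1" and n: "n > 0"
    and l: "\<And>k. k < n \<Longrightarrow> bounded_clinear (l k)" "\<And>k x. k < n \<Longrightarrow> norm (l k x) \<le> norm x"
  shows "(\<Sum>k<n. norm (LBINT t. indicator {c + real k * d..<c + real (Suc k) * d} t *
      (of_real (exp (- a * t) * ((1 - exp (- \<omega> * t)) / \<omega>)) * l k (T t (i y))))) \<le> C * B * (real n * d)"
proof -
  let ?m = "\<lambda>\<xi> y. inv_into D (\<lambda>x. Complex a \<xi> *\<^sub>C x + A x) (i y)"
  let ?J = "\<lambda>k. {c + real k * d..<c + real (Suc k) * d}"
  define b where "b = c + real n * d"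
  have b: "b > 0" using c d n by (simp add: b_def add_nonneg_pos)
  define h where "h N = b / real (Suc N)" for N
  have h: "h N > 0" for N using b by (simp add: h_def)
  have hb: "real (Suc N) * h N = b" for N by (simp add: h_def)
  have h0: "h \<longlonglongrightarrow> 0"
    unfolding h_def using tendsto_mult[OF tendsto_const[of b] LIMSEQ_inverse_real_of_nat] by (simp add: divide_inverse)
  (* The weight is taken at the right end of the cell, the orbit at the left end. This keeps the norm
     below B * exp (- s) throughout the cell, and strictly below it at the right end, because a > 0. *)
  define Y where "Y N k = exp (- (\<omega> + a) * (real (Suc k) * h N)) *\<^sub>R orb (real k * h N)" for N k
  have Yn: "norm (Y N k) < B * exp (- (real (Suc k) * h N))" for N k
  proof -
    have "norm (Y N k) \<le> exp (- (\<omega> + a) * (real (Suc k) * h N)) * (B * exp (real k * h N * (\<omega> - 1)))"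
      unfolding Y_def using orb(2)[of "real k * h N"] h[of N] by (simp add: mult_left_mono)
    also have "\<dots> = B * exp (- (\<omega> + a) * (real (Suc k) * h N) + real k * h N * (\<omega> - 1))"
      by (simp add: exp_add)
    also have "\<dots> < B * exp (- (real (Suc k) * h N))"
    proof -
      have "(- (\<omega> + a) * (real (Suc k) * h N) + real k * h N * (\<omega> - 1)) + real (Suc k) * h N
          = - ((\<omega> - 1) * h N) - a * (real (Suc k) * h N)" by (simp add: algebra_simps)
      moreover have "(\<omega> - 1) * h N \<ge> 0" "a * (real (Suc k) * h N) > 0" using growth(1) a h[of N] by auto
      ultimately have "- (\<omega> + a) * (real (Suc k) * h N) + real k * h N * (\<omega> - 1) < - (real (Suc k) * h N)" by linarith
      then show ?thesis using B by simp
    qed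
    finally show ?thesis .
  qed
  have ex: "\<exists>x. norm (j x) \<le> B * exp (- (real (Suc k) * h N)) \<and> norm (j x - Y N k) \<le> inverse (real (Suc N))" for N k
  proof -
    (* The strict inequality leaves room for an approximation from the range of j. *)
    define e where "e = min (inverse (real (Suc N))) (B * exp (- (real (Suc k) * h N)) - norm (Y N k))"
    have "e > 0" using Yn[of N k] by (simp add: e_def)
    moreover have "Y N k \<in> closure (range j)" using dense by simp
    ultimately obtain v where "v \<in> range j" "dist v (Y N k) < e" unfolding closure_approachable by blast
    then obtain x where x: "norm (j x - Y N k) < e" by (auto simp: dist_norm)
    have "norm (j x) \<le> norm (j x - Y N k) + norm (Y N k)" using norm_triangle_ineq[of "j x - Y N k" "Y N k"] by simp
    with x show ?thesis by (intro exI[of _ x]) (auto simp: e_def)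
  qed
  have "\<exists>x. \<forall>N. \<forall>k. norm (j (x N k)) \<le> B * exp (- (real (Suc k) * h N)) \<and> norm (j (x N k) - Y N k) \<le> inverse (real (Suc N))"
    by (rule choice, rule allI, rule choice, rule allI, rule ex)
  then obtain x where x: "\<And>N k. norm (j (x N k)) \<le> B * exp (- (real (Suc k) * h N))"
    "\<And>N k. norm (j (x N k) - Y N k) \<le> inverse (real (Suc N))" by blast
  define \<kappa> where "\<kappa> N kk k = (\<lambda>s. indicator {0..} s * (of_real (exp (- a * s)) * l kk (T s (i (j (x N k))))))" for N kk k
  note ker = resolvent_kernel[OF T gen spec a int]
  have \<kappa>i: "integrable lborel (\<kappa> N kk k)" if "kk < n" for N kk k
    unfolding \<kappa>_def by (rule ker(1)[OF l[OF that]])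
  have \<kappa>f: "l kk (?m \<xi> (j (x N k))) = ft (\<kappa> N kk k) \<xi>" if "kk < n" for N kk k \<xi>
    unfolding \<kappa>_def by (rule ker(2)[OF l[OF that]])
  have mbd: "norm (?m \<xi> (j z)) \<le> (LBINT s. indicator {0..} s * (exp (- a * s) * norm (T s (i (j z)))))" for z \<xi>
  proof -
    obtain f :: "'x \<Rightarrow> complex" where f: "bounded_clinear f" "\<And>x. norm (f x) \<le> norm x"
      "f (?m \<xi> (j z)) = norm (?m \<xi> (j z))" using Hahn_Banach_complex by blast
    have "norm (?m \<xi> (j z)) = norm (f (?m \<xi> (j z)))" by (simp add: f(3))
    also have "\<dots> \<le> (LBINT s. indicator {0..} s * (exp (- a * s) * norm (T s (i (j z)))))"
      unfolding ker(2)[OF f(1,2)] by (rule ker(3)[OF f(1,2)])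
    finally show ?thesis .
  qed
  have xB: "norm (j (x N k)) \<le> B" for N k
  proof -
    have "B * exp (- (real (Suc k) * h N)) \<le> B * 1" by (rule mult_left_mono) (use B h[of N] in auto)
    with x(1)[of N k] show ?thesis by simp
  qed
  have xs: "(\<Sum>k<Suc N. h N * norm (j (x N k))) \<le> B" for N
  proof -
    have "(\<Sum>k<Suc N. h N * norm (j (x N k))) \<le> (\<Sum>k<Suc N. B * (h N * exp (- (real (Suc k) * h N))))"
      using x(1) h[of N] by (intro sum_mono) (simp add: mult.left_commute[of B] mult_left_mono del: of_nat_Suc)
    also have "\<dots> = B * (\<Sum>k<Suc N. h N * exp (- (real (Suc k) * h N)))" by (simp only: sum_distrib_left)
    also have "\<dots> \<le> B * 1" by (rule mult_left_mono[OF sum_exp_step_le_1[OF h] less_imp_le[OF B]])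
    finally show ?thesis by simp
  qed
  define \<Phi> where "\<Phi> N kk t s = (\<Sum>k<Suc N. indicator {real k * h N..<real (Suc k) * h N} s * \<kappa> N kk k (t - s))" for N kk t s
  have step: "(\<Sum>kk<n. norm (LBINT t. indicator (?J kk) t * (LBINT s. \<Phi> N kk t s)))
      \<le> C * B * (real n * d)" for N
  proof -
    have eq: "(LBINT t. indicator (?J kk) t * (LBINT s. \<Phi> N kk t s))
      = (\<Sum>k<Suc N. LBINT r. \<kappa> N kk k r * overlap (real k * h N) (real (Suc k) * h N)
          (c + real kk * d) (c + real (Suc kk) * d) r)" if kk: "kk < n" for kk
    proof -
      let ?I = "\<lambda>k. indicator {real k * h N..<real (Suc k) * h N} :: real \<Rightarrow> complex"
      let ?J' = "indicator (?J kk) :: real \<Rightarrow> complex"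
      have 1: "(LBINT s. \<Phi> N kk t s) = (\<Sum>k<Suc N. LBINT s. ?I k s * \<kappa> N kk k (t - s))" for t
        unfolding \<Phi>_def
      proof (rule Bochner_Integration.integral_sum)
        fix k
        have "integrable lborel (\<lambda>s. \<kappa> N kk k (t - s))"
          using lborel_integrable_real_affine[OF \<kappa>i[OF kk, of N k], of "-1" t] by simp
        then show "integrable lborel (\<lambda>s. ?I k s * \<kappa> N kk k (t - s))"
          using integrable_mult_bounded[of lborel "\<lambda>s. \<kappa> N kk k (t - s)" "?I k" 1]
          by (simp add: mult.commute indicator_def)
      qed
      have 2: "integrable lborel (\<lambda>t. ?J' t * (LBINT s. ?I k s * \<kappa> N kk k (t - s)))" for k
      proof -
        have "integrable lborel (\<lambda>t. LBINT s. ?I k s * \<kappa> N kk k (t - s))"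
          by (rule Fubini_convolution(2)[OF integrable_indicator_ico(1) \<kappa>i[OF kk], of "\<lambda>_. 0" 0]) auto
        from integrable_mult_bounded[OF this, of ?J' 1] show ?thesis by (simp add: mult.commute indicator_def)
      qed
      have "(LBINT t. ?J' t * (LBINT s. \<Phi> N kk t s))
          = (LBINT t. (\<Sum>k<Suc N. ?J' t * (LBINT s. ?I k s * \<kappa> N kk k (t - s))))"
        unfolding 1 by (simp only: sum_distrib_left)
      also have "\<dots> = (\<Sum>k<Suc N. LBINT t. ?J' t * (LBINT s. ?I k s * \<kappa> N kk k (t - s)))"
        by (rule Bochner_Integration.integral_sum) (rule 2)
      also have "\<dots> = (\<Sum>k<Suc N. LBINT r. \<kappa> N kk k r * overlap (real k * h N) (real (Suc k) * h N)
          (c + real kk * d) (c + real (Suc kk) * d) r)"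
        by (intro sum.cong refl integral_overlap \<kappa>i kk)
      finally show ?thesis .
    qed
    have "(\<Sum>kk<n. norm (\<Sum>k<Suc N. LBINT r. \<kappa> N kk k r * overlap (real k * h N) (real (Suc k) * h N)
          (c + real kk * d) (c + real (Suc kk) * d) r)) \<le> C * B * (real n * d)"
      by (rule step_bound[OF h xB less_imp_le[OF B] d(1) l \<kappa>i \<kappa>f mb pq mf mbd xs d(2)])
    then show ?thesis using eq by simp
  qed
  have blT: "bounded_linear (T s)" if "s \<ge> 0" for s
    using C0_semigroupD(1)[OF T that] by (rule bounded_clinear_bounded_linear)
  have bli: "bounded_linear i" using i by (rule bounded_clinear_bounded_linear)
  have M'0: "M' \<ge> 0"
    using growth(2)[of 0] onorm_pos_le[OF blT[of 0]] by simp
  define Mb where "Mb = M' * exp (b * (\<omega> - 1))"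
  have Mb: "norm (T s v) \<le> Mb * norm v" if "0 \<le> s" "s \<le> b" for s v
  proof -
    have "norm (T s v) \<le> onorm (T s) * norm v" by (rule onorm[OF blT[OF that(1)]])
    also have "onorm (T s) \<le> M' * exp (s * (\<omega> - 1))" by (rule growth(2)[OF that(1)])
    also have "\<dots> \<le> Mb" unfolding Mb_def using that growth(1) M'0 by (intro mult_left_mono) (auto intro!: mult_right_mono)
    finally show ?thesis by (simp add: mult_right_mono)
  qed
  have Mb0: "Mb \<ge> 0" using M'0 by (simp add: Mb_def)
  define W where "W = Mb * (onorm i * B)"
  have io: "norm (i v) \<le> onorm i * norm v" for v by (rule onorm[OF bli])
  have io0: "onorm i \<ge> 0" by (rule onorm_pos_le[OF bli])
  have W0: "W \<ge> 0" using Mb0 io0 B by (simp add: W_def)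
  (* The cell of mesh h N that contains s. *)
  define kN where "kN N s = nat \<lfloor>s / h N\<rfloor>" for N s
  have kN: "kN N s < Suc N" "real (kN N s) * h N \<le> s" "s < real (Suc (kN N s)) * h N" if "0 \<le> s" "s < b" for N s
  proof -
    have s0: "s / h N \<ge> 0" using that h[of N] by simp
    have k1: "real (kN N s) \<le> s / h N" unfolding kN_def using s0 by (simp add: of_nat_nat)
    have k2: "s / h N < real (Suc (kN N s))" unfolding kN_def using s0 by linarith
    show "real (kN N s) * h N \<le> s" using k1 h[of N] by (simp add: field_simps)
    then have "real (kN N s) * h N < real (Suc N) * h N" using that(2) hb[of N] by linarith
    then show "kN N s < Suc N" using h[of N] by (simp del: of_nat_Suc)
    show "s < real (Suc (kN N s)) * h N" using k2 h[of N] by (simp add: pos_divide_less_eq)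
  qed
  have \<Phi>sel: "\<Phi> N kk t s = \<kappa> N kk (kN N s) (t - s)" if "0 \<le> s" "s < b" for N kk t s
    unfolding \<Phi>_def by (rule sum_indicator_select[OF h kN[OF that]])
  have \<Phi>out: "\<Phi> N kk t s = 0" if "\<not> (0 \<le> s \<and> s < b)" for N kk t s
  proof -
    have "s \<notin> {real k * h N..<real (Suc k) * h N}" if "k < Suc N" for k
    proof
      assume "s \<in> {real k * h N..<real (Suc k) * h N}"
      moreover have "real (Suc k) * h N \<le> real (Suc N) * h N" using that h[of N] by (intro mult_right_mono) auto
      moreover have "0 \<le> real k * h N" using h[of N] by simp
      ultimately show False using \<open>\<not> (0 \<le> s \<and> s < b)\<close> hb[of N] by auto
    qed
    then show ?thesis unfolding \<Phi>_def by (intro sum.neutral) (auto simp: indicator_def)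
  qed
  have \<Phi>bd: "norm (\<Phi> N kk t s) \<le> indicator {0..<b} s * W" if kk: "kk < n" and t: "t \<le> b" for N kk t s
  proof (cases "0 \<le> s \<and> s < b")
    case True
    show ?thesis
    proof (cases "0 \<le> t - s")
      case tr: True
      have "norm (l kk (T (t - s) (i (j (x N (kN N s)))))) \<le> W"
      proof -
        have "norm (l kk (T (t - s) (i (j (x N (kN N s)))))) \<le> Mb * norm (i (j (x N (kN N s))))"
          by (rule order_trans[OF l(2)[OF kk]]) (rule Mb, use tr t True in auto)
        also have "\<dots> \<le> Mb * (onorm i * B)"
          by (intro mult_left_mono Mb0 order_trans[OF io] xB io0)
        finally show ?thesis by (simp add: W_def)
      qed
      moreover have "exp (- a * (t - s)) \<le> 1" using a tr by simp
      ultimately have "exp (- a * (t - s)) * norm (l kk (T (t - s) (i (j (x N (kN N s)))))) \<le> 1 * W"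
        using W0 by (intro mult_mono) auto
      then show ?thesis using True tr by (simp add: \<Phi>sel \<kappa>_def norm_mult)
    next
      case False
      then show ?thesis using True W0 by (simp add: \<Phi>sel \<kappa>_def)
    qed
  next
    case False
    then show ?thesis using W0 by (simp add: \<Phi>out)
  qed
  define \<Psi> where "\<Psi> kk t s = indicator {0..t} s * (of_real (exp (- \<omega> * s)) * (of_real (exp (- a * t)) * l kk (T t (i y))))" for kk t s
  have \<Phi>lim: "(\<lambda>N. \<Phi> N kk t s) \<longlonglongrightarrow> \<Psi> kk t s" if kk: "kk < n" and t: "0 \<le> t" "t < b" for kk t s
  proof (cases "0 \<le> s \<and> s \<le> t")
    case False
    then have "\<Phi> N kk t s = 0" for N
      by (cases "0 \<le> s \<and> s < b") (auto simp: \<Phi>sel \<Phi>out \<kappa>_def)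
    moreover have "\<Psi> kk t s = 0" using False by (auto simp: \<Psi>_def)
    ultimately show ?thesis by simp
  next
    case True
    then have s: "0 \<le> s" "s \<le> t" "s < b" using t by auto
    define \<sigma> where "\<sigma> N = real (kN N s) * h N" for N
    have \<sigma>0: "\<sigma> N \<ge> 0" for N using h[of N] by (simp add: \<sigma>_def)
    have \<sigma>s: "\<sigma> \<longlonglongrightarrow> s"
    proof (rule tendsto_sandwich[of "\<lambda>N. s - h N" _ _ "\<lambda>_. s"])
      show "\<forall>\<^sub>F N in sequentially. s - h N \<le> \<sigma> N"
        using kN(3)[OF s(1,3)] by (auto simp: \<sigma>_def algebra_simps intro!: always_eventually less_imp_le)
      show "\<forall>\<^sub>F N in sequentially. \<sigma> N \<le> s"
        using kN(2)[OF s(1,3)] by (auto simp: \<sigma>_def)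
      show "(\<lambda>N. s - h N) \<longlonglongrightarrow> s" using tendsto_diff[OF tendsto_const[of s] h0] by simp
    qed simp
    define E where "E N = exp (- (\<omega> + a) * (\<sigma> N + h N))" for N
    have Elim: "E \<longlonglongrightarrow> exp (- (\<omega> + a) * (s + 0))"
      unfolding E_def by (intro tendsto_intros \<sigma>s h0)
    (* The semigroup law transports the value at the grid point to time t - s + \<sigma> N, which tends to t. *)
    have iY: "T (t - s) (i (Y N (kN N s))) = E N *\<^sub>R T (t - s + \<sigma> N) (i y)" for N
    proof -
      have "i (Y N (kN N s)) = E N *\<^sub>R T (\<sigma> N) (i y)"
        unfolding Y_def bounded_clinear_scaleR[OF i] E_def \<sigma>_def using orb(1) \<sigma>0[of N]
        by (simp add: \<sigma>_def algebra_simps)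
      then have "T (t - s) (i (Y N (kN N s))) = E N *\<^sub>R T (t - s) (T (\<sigma> N) (i y))"
        using bounded_clinear_scaleR[OF C0_semigroupD(1)[OF T]] s by simp
      then show ?thesis using C0_semigroupD(3)[OF T, of "t - s" "\<sigma> N" "i y"] s \<sigma>0[of N] by simp
    qed
    have "(\<lambda>N. T (t - s + \<sigma> N) (i y)) \<longlonglongrightarrow> T (t - s + s) (i y)"
    proof (rule continuous_on_tendsto_compose[OF C0_semigroupD(4)[OF T]])
      show "(\<lambda>N. t - s + \<sigma> N) \<longlonglongrightarrow> t - s + s" by (intro tendsto_intros \<sigma>s)
    qed (use s t \<sigma>0 in \<open>auto intro!: always_eventually\<close>)
    then have Ylim: "(\<lambda>N. T (t - s) (i (Y N (kN N s)))) \<longlonglongrightarrow> exp (- (\<omega> + a) * s) *\<^sub>R T t (i y)"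
      unfolding iY using tendsto_scaleR[OF Elim] by simp
    have diff: "(\<lambda>N. T (t - s) (i (j (x N (kN N s)))) - T (t - s) (i (Y N (kN N s)))) \<longlonglongrightarrow> 0"
    proof (rule Lim_null_comparison)
      show "\<forall>\<^sub>F N in sequentially. norm (T (t - s) (i (j (x N (kN N s)))) - T (t - s) (i (Y N (kN N s))))
          \<le> Mb * (onorm i * inverse (real (Suc N)))"
      proof (rule always_eventually, rule allI)
        fix N
        have "T (t - s) (i (j (x N (kN N s)))) - T (t - s) (i (Y N (kN N s))) = T (t - s) (i (j (x N (kN N s)) - Y N (kN N s)))"
          using blT[of "t - s"] bli s by (simp add: linear_simps)
        also have "norm \<dots> \<le> Mb * norm (i (j (x N (kN N s)) - Y N (kN N s)))"
          by (rule Mb) (use s t in auto)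
        also have "\<dots> \<le> Mb * (onorm i * norm (j (x N (kN N s)) - Y N (kN N s)))"
          by (intro mult_left_mono io Mb0)
        also have "\<dots> \<le> Mb * (onorm i * inverse (real (Suc N)))"
          by (intro mult_left_mono x(2) Mb0 io0)
        finally show "norm (T (t - s) (i (j (x N (kN N s)))) - T (t - s) (i (Y N (kN N s)))) \<le> Mb * (onorm i * inverse (real (Suc N)))" .
      qed
      have "(\<lambda>N. Mb * (onorm i * inverse (real (Suc N)))) \<longlonglongrightarrow> Mb * (onorm i * 0)"
        by (intro tendsto_intros LIMSEQ_inverse_real_of_nat)
      then show "(\<lambda>N. Mb * (onorm i * inverse (real (Suc N)))) \<longlonglongrightarrow> 0" by simp
    qed
    have "(\<lambda>N. T (t - s) (i (j (x N (kN N s))))) \<longlonglongrightarrow> exp (- (\<omega> + a) * s) *\<^sub>R T t (i y)"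
      using tendsto_add[OF diff Ylim] by simp
    then have "(\<lambda>N. l kk (T (t - s) (i (j (x N (kN N s)))))) \<longlonglongrightarrow> l kk (exp (- (\<omega> + a) * s) *\<^sub>R T t (i y))"
      by (rule bounded_linear.tendsto[OF bounded_clinear_bounded_linear[OF l(1)[OF kk]]])
    then have "(\<lambda>N. of_real (exp (- a * (t - s))) * l kk (T (t - s) (i (j (x N (kN N s))))))
        \<longlonglongrightarrow> of_real (exp (- a * (t - s))) * l kk (exp (- (\<omega> + a) * s) *\<^sub>R T t (i y))"
      by (intro tendsto_intros)
    moreover have "of_real (exp (- a * (t - s))) * l kk (exp (- (\<omega> + a) * s) *\<^sub>R T t (i y)) = \<Psi> kk t s"
    proof -
      have "exp (- a * (t - s)) * exp (- (\<omega> + a) * s) = exp (- \<omega> * s) * exp (- a * t)"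
        by (simp add: algebra_simps flip: exp_add)
      then have "complex_of_real (exp (- a * (t - s))) * complex_of_real (exp (- (\<omega> + a) * s))
          = complex_of_real (exp (- \<omega> * s)) * complex_of_real (exp (- a * t))" by (metis of_real_mult)
      then show ?thesis using True
        by (simp add: \<Psi>_def bounded_clinear_scaleR[OF l(1)[OF kk]] scaleR_conv_of_real mult.assoc[symmetric])
    qed
    moreover have "\<Phi> N kk t s = of_real (exp (- a * (t - s))) * l kk (T (t - s) (i (j (x N (kN N s)))))" for N
      using s by (simp add: \<Phi>sel \<kappa>_def)
    ultimately show ?thesis by (simp only:)
  qed
  define H where "H kk t = of_real (exp (- a * t) * ((1 - exp (- \<omega> * t)) / \<omega>)) * l kk (T t (i y))" for kk t
  have \<Phi>m: "(\<lambda>s. \<Phi> N kk t s) \<in> borel_measurable borel" if "kk < n" for N kk t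
  proof -
    have [measurable]: "\<kappa> N kk k \<in> borel_measurable borel" for k using \<kappa>i[OF that, of N k] by auto
    show ?thesis unfolding \<Phi>_def by measurable
  qed
  have inner: "(\<lambda>N. LBINT s. \<Phi> N kk t s) \<longlonglongrightarrow> H kk t" if kk: "kk < n" and t: "0 \<le> t" "t < b" for kk t
  proof -
    have "(\<lambda>N. LBINT s. \<Phi> N kk t s) \<longlonglongrightarrow> (LBINT s. \<Psi> kk t s)"
    proof (rule integral_dominated_convergence[where w="\<lambda>s. indicator {0..<b} s * W"])
      show "AE s in lborel. norm (\<Phi> N kk t s) \<le> indicator {0..<b} s * W" for N
        using \<Phi>bd[OF kk, of t] t by (intro AE_I2) auto
      show "AE s in lborel. (\<lambda>N. \<Phi> N kk t s) \<longlonglongrightarrow> \<Psi> kk t s" by (intro AE_I2 \<Phi>lim kk t)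
      show "integrable lborel (\<lambda>s. indicator {0..<b} s * W)" by (intro integrable_mult_left integrable_indicator_ico)
    qed (use \<Phi>m[OF kk] in \<open>auto simp: \<Psi>_def\<close>)
    also have "(LBINT s. \<Psi> kk t s) = H kk t"
    proof -
      have "(LBINT s. \<Psi> kk t s) = (LBINT s. (indicator {0..t} s * of_real (exp (- \<omega> * s))) * (of_real (exp (- a * t)) * l kk (T t (i y))))"
        unfolding \<Psi>_def by (simp only: mult.assoc)
      also have "\<dots> = of_real ((1 - exp (- \<omega> * t)) / \<omega>) * (of_real (exp (- a * t)) * l kk (T t (i y)))"
        unfolding integral_mult_left_zero using integral_exp_window[of \<omega> t] growth(1) t by simp
      also have "\<dots> = H kk t" by (simp add: H_def)
      finally show ?thesis .
    qed
    finally show ?thesis .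
  qed
  have outer: "(\<lambda>N. LBINT t. indicator (?J kk) t * (LBINT s. \<Phi> N kk t s))
      \<longlonglongrightarrow> (LBINT t. indicator (?J kk) t * H kk t)" if kk: "kk < n" for kk
  proof -
    have J: "0 \<le> t \<and> t < b" if "t \<in> ?J kk" for t
    proof -
      have "real (Suc kk) * d \<le> real n * d" using kk d by (intro mult_right_mono) auto
      moreover have "0 \<le> real kk * d" using d by simp
      ultimately show ?thesis using that c by (auto simp: b_def)
    qed
    show ?thesis
    proof (rule integral_dominated_convergence[where w="\<lambda>t. indicator (?J kk) t * (LBINT s. indicator {0..<b} s * W)"])
      show "AE t in lborel. (\<lambda>N. indicator (?J kk) t * (LBINT s. \<Phi> N kk t s)) \<longlonglongrightarrow> indicator (?J kk) t * H kk t"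
        using inner[OF kk] J by (intro AE_I2) (auto simp: indicator_def intro!: tendsto_intros)
      show "AE t in lborel. norm (indicator (?J kk) t * (LBINT s. \<Phi> N kk t s)) \<le> indicator (?J kk) t * (LBINT s. indicator {0..<b} s * W)" for N
      proof (rule AE_I2)
        fix t
        have iW: "integrable lborel (\<lambda>s. indicator {0..<b} s * W)" by (intro integrable_mult_left integrable_indicator_ico)
        have "norm (LBINT s. \<Phi> N kk t s) \<le> (LBINT s. indicator {0..<b} s * W)" if "t \<in> ?J kk"
        proof -
          have bd: "norm (\<Phi> N kk t s) \<le> indicator {0..<b} s * W" for s using \<Phi>bd[OF kk] J[OF that] by simp
          have i\<Phi>: "integrable lborel (\<lambda>s. \<Phi> N kk t s)"
            by (rule Bochner_Integration.integrable_bound[OF iW]) (use \<Phi>m[OF kk] bd W0 in \<open>auto simp: abs_mult intro!: AE_I2\<close>)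
          show ?thesis by (rule integral_norm_bound[THEN order_trans]) (rule integral_mono[OF integrable_norm[OF i\<Phi>] iW bd])
        qed
        then show "norm (indicator (?J kk) t * (LBINT s. \<Phi> N kk t s)) \<le> indicator (?J kk) t * (LBINT s. indicator {0..<b} s * W)"
          by (auto simp: indicator_def)
      qed
      show "integrable lborel (\<lambda>t. indicator (?J kk) t * (LBINT s. indicator {0..<b} s * W))"
        by (intro integrable_mult_left integrable_indicator_ico)
      have "continuous_on {c + real kk * d..c + real (Suc kk) * d} (H kk)"
      proof -
        have "continuous_on {0..} (H kk)"
          unfolding H_def using growth(1)
          by (intro continuous_intros semigroup_functional_continuous[OF T] bounded_clinear_bounded_linear l(1) kk) auto
        then show ?thesis by (rule continuous_on_subset) (use c d in auto)
      qed
      from integrable_ico_continuous[OF this]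
      show "(\<lambda>t. indicator (?J kk) t * H kk t) \<in> borel_measurable lborel" by auto
      show "(\<lambda>t. indicator (?J kk) t * (LBINT s. \<Phi> N kk t s)) \<in> borel_measurable lborel" for N
      proof -
        have [measurable]: "\<kappa> N kk k \<in> borel_measurable borel" for k using \<kappa>i[OF kk, of N k] by auto
        have "(\<lambda>t. LBINT s. \<Phi> N kk t s) \<in> borel_measurable lborel"
          unfolding \<Phi>_def by (rule lborel.borel_measurable_lebesgue_integral) measurable
        then show ?thesis by measurable
      qed
    qed
  qed
  have "(\<lambda>N. \<Sum>kk<n. norm (LBINT t. indicator (?J kk) t * (LBINT s. \<Phi> N kk t s)))
      \<longlonglongrightarrow> (\<Sum>kk<n. norm (LBINT t. indicator (?J kk) t * H kk t))"
    by (intro tendsto_sum tendsto_norm outer) auto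
  then have "(\<Sum>kk<n. norm (LBINT t. indicator (?J kk) t * H kk t)) \<le> C * B * (real n * d)"
    by (rule LIMSEQ_le_const2) (use step in auto)
  then show ?thesis unfolding H_def .
qed

text \<open>A value of the orbit is recovered from window averages: on the window that starts at
\<open>c + real k * d\<close> the functional is composed with \<open>T (t - (c + real k * d))\<close>, so that what is averaged
stays close to \<open>T t (i y)\<close>. The operator norms of these transports enter as \<open>M\<close>, and the weight of the
window bound is estimated from below by \<open>w0\<close>.\<close>

lemma orbit_pointwise_bound:
  assumes c: "c \<ge> 0" and d: "d > 0" "q = \<infinity> \<or> real n * d = 1" and n: "n > 0"
    and t: "\<And>k. k < n \<Longrightarrow> c + real k * d \<le> t" and M: "M > 0" "\<And>k. k < n \<Longrightarrow> onorm (T (t - (c + real k * d))) \<le> M"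
    and w0: "\<And>u. u \<in> {c..c + real n * d} \<Longrightarrow> w0 \<le> exp (- a * u) * ((1 - exp (- \<omega> * u)) / \<omega>)"
    and \<epsilon>: "\<And>u. u \<in> {t..<t + d} \<Longrightarrow> norm (T u (i y) - T t (i y)) \<le> \<epsilon>"
  shows "w0 * norm (T t (i y)) - \<epsilon> \<le> M * C * B"
proof -
  obtain f :: "'x \<Rightarrow> complex" where f: "bounded_clinear f" "\<And>x. norm (f x) \<le> norm x" "f (T t (i y)) = norm (T t (i y))"
    using Hahn_Banach_complex by blast
  define r where "r k = t - (c + real k * d)" for k
  have r: "r k \<ge> 0" if "k < n" for k using t[OF that] by (simp add: r_def)
  define l where "l k x = of_real (1 / M) * f (T (r k) x)" for k x
  have fl: "bounded_linear f" using f(1) by (rule bounded_clinear_bounded_linear)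
  have Tl: "bounded_clinear (T (r k))" if "k < n" for k using C0_semigroupD(1)[OF T r[OF that]] .
  have l1: "bounded_clinear (l k)" if k: "k < n" for k
  proof -
    have "bounded_linear (\<lambda>x. f (T (r k) x))"
      using bounded_linear_compose[OF fl bounded_clinear_bounded_linear[OF Tl[OF k]]] .
    then have "bounded_linear (l k)" unfolding l_def by (rule bounded_linear_const_mult)
    then show ?thesis unfolding bounded_clinear_def
      by (simp add: l_def bounded_clinear_scaleC[OF Tl[OF k]] bounded_clinear_scaleC[OF f(1)] scaleC_complex_def)
  qed
  have l2: "norm (l k x) \<le> norm x" if k: "k < n" for k x
  proof -
    have "norm (f (T (r k) x)) \<le> onorm (T (r k)) * norm x"
      by (rule order_trans[OF f(2)]) (rule onorm[OF bounded_clinear_bounded_linear[OF Tl[OF k]]])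
    also have "\<dots> \<le> M * norm x" using M(2)[OF k] by (intro mult_right_mono) (auto simp: r_def)
    finally show ?thesis using M(1) by (simp add: l_def norm_divide divide_le_eq mult.commute)
  qed
  let ?w = "\<lambda>u. exp (- a * u) * ((1 - exp (- \<omega> * u)) / \<omega>)"
  have main: "(\<Sum>k<n. norm (LBINT u. indicator {c + real k * d..<c + real (Suc k) * d} u *
      (of_real (?w u) * l k (T u (i y))))) \<le> C * B * (real n * d)"
    by (rule orbit_window_bound[OF c d n l1 l2])
  have each: "d * (w0 * norm (of_real (1/M) * f (T t (i y))) - \<epsilon> / M)
      \<le> norm (LBINT u. indicator {c + real k * d..<c + real (Suc k) * d} u * (of_real (?w u) * l k (T u (i y))))"
    if k: "k < n" for k
  proof -
    have sd: "c + real (Suc k) * d = c + real k * d + d" by (simp add: algebra_simps)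
    have c0: "c + real k * d \<ge> 0" using c d by simp
    have kn: "c + real k * d + d \<le> c + real n * d"
    proof -
      have "real (Suc k) * d \<le> real n * d" using k d by (intro mult_right_mono) auto
      then show ?thesis by (simp add: algebra_simps)
    qed
    show ?thesis unfolding sd
    proof (rule window_average_lower[OF d(1)])
      show "continuous_on {c + real k * d..c + real k * d + d} (\<lambda>u. l k (T u (i y)))"
        by (rule continuous_on_subset[OF semigroup_functional_continuous[OF T bounded_clinear_bounded_linear[OF l1[OF k]]]])
           (use c0 in auto)
      show "continuous_on {c + real k * d..c + real k * d + d} ?w" using growth(1) by (intro continuous_intros) auto
      fix u assume u: "u \<in> {c + real k * d..<c + real k * d + d}"
      have u0: "u \<ge> 0" using u c0 by simp
      have "0 \<le> real k * d" using d by simp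
      moreover have "c + real k * d \<le> u" "u < c + real k * d + d" using u by auto
      ultimately have "c \<le> u" "u \<le> c + real n * d" using kn by linarith+
      then show "w0 \<le> ?w u" by (intro w0) simp
      show "\<bar>?w u\<bar> \<le> 1"
      proof -
        have e: "0 \<le> 1 - exp (- \<omega> * u)" "1 - exp (- \<omega> * u) \<le> 1" using growth(1) u0 by (auto simp: mult_nonneg_nonneg)
        have 1: "(1 - exp (- \<omega> * u)) / \<omega> \<le> 1"
          by (subst pos_divide_le_eq) (use e growth(1) in linarith)+
        have 0: "0 \<le> (1 - exp (- \<omega> * u)) / \<omega>" using e(1) growth(1) by (intro divide_nonneg_nonneg) linarith+
        have "exp (- a * u) \<le> 1" using a u0 by simp
        then have "?w u \<le> 1" using 0 1 by (rule mult_le_one)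
        moreover have "0 \<le> ?w u" using 0 by (rule mult_nonneg_nonneg[rotated]) simp
        ultimately show ?thesis by (simp only: abs_of_nonneg)
      qed
      have "T (r k) (T u (i y)) = T (r k + u) (i y)" using C0_semigroupD(3)[OF T r[OF k] u0] by simp
      then have "l k (T u (i y)) - of_real (1/M) * f (T t (i y)) = of_real (1/M) * f (T (r k + u) (i y) - T t (i y))"
        by (simp add: l_def linear_diff[OF bounded_linear.linear[OF fl]] diff_divide_distrib)
      also have "norm \<dots> = (1/M) * norm (f (T (r k + u) (i y) - T t (i y)))" using M(1) by (simp add: norm_divide)
      also have "\<dots> \<le> (1/M) * \<epsilon>"
        using M(1) u by (intro mult_left_mono order_trans[OF f(2)] \<epsilon>) (auto simp: r_def)
      finally show "norm (l k (T u (i y)) - of_real (1/M) * f (T t (i y))) \<le> \<epsilon> / M" by simp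
    qed
  qed
  define X where "X = w0 * (norm (T t (i y)) / M) - \<epsilon> / M"
  have nf: "norm (of_real (1/M) * f (T t (i y))) = norm (T t (i y)) / M"
    using M(1) by (simp add: f(3) norm_divide)
  have "real n * (d * X) = (\<Sum>k<n. d * (w0 * norm (of_real (1/M) * f (T t (i y))) - \<epsilon> / M))"
    unfolding nf X_def by simp
  also have "\<dots> \<le> C * B * (real n * d)"
    by (rule order_trans[OF sum_mono main]) (rule each, simp)
  finally have "(real n * d) * X \<le> (real n * d) * (C * B)" by (simp only: mult_ac)
  moreover have "real n * d > 0" using n d(1) by simp
  ultimately have "X \<le> C * B" by (simp only: mult_le_cancel_left_pos)
  then have "M * X \<le> M * (C * B)" using M(1) by (intro mult_left_mono) auto
  moreover have "M * X = w0 * norm (T t (i y)) - \<epsilon>" using M(1) by (simp add: X_def right_diff_distrib)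
  ultimately show ?thesis by (simp only: mult.assoc)
qed

end

section \<open>The growth bound\<close>

lemma kernel_integrable:
  fixes T :: "real \<Rightarrow> 'x::cbanach \<Rightarrow> 'x" and i :: "'y::cbanach \<Rightarrow> 'x" and j :: "'z::cbanach \<Rightarrow> 'y"
  assumes T: "C0_semigroup T" and i: "bounded_clinear i" and j: "bounded_clinear j"
    and int: "set_integrable lebesgue {0<..} (\<lambda>t. exp (- a * t) * onorm (\<lambda>z. T t (i (j z))))"
  shows "integrable lborel (\<lambda>s. indicator {0..} s * (exp (- a * s) * norm (T s (i (j z)))))"
proof -
  have cont: "continuous_on {0..} (\<lambda>s. exp (- a * s) * norm (T s (i (j z))))"
    by (intro continuous_intros C0_semigroupD(4)[OF T])
  have "(\<lambda>s. indicator {0..} s *\<^sub>R (exp (- a * s) * norm (T s (i (j z))))) \<in> borel_measurable borel"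
    by (rule borel_measurable_continuous_on_indicator) (use cont in auto)
  then have m: "(\<lambda>s. indicator {0..} s * (exp (- a * s) * norm (T s (i (j z))))) \<in> borel_measurable lborel" by simp
  have bl: "bounded_linear (\<lambda>z. T t (i (j z)))" if "t \<ge> 0" for t
    using bounded_linear_compose[OF bounded_clinear_bounded_linear[OF C0_semigroupD(1)[OF T that]]
        bounded_linear_compose[OF bounded_clinear_bounded_linear[OF i] bounded_clinear_bounded_linear[OF j]]] .
  have "integrable lebesgue (\<lambda>s. indicator {0..} s * (exp (- a * s) * norm (T s (i (j z)))))"
  proof (rule Bochner_Integration.integrable_bound)
    show "integrable lebesgue (\<lambda>t. (indicator {0<..} t *\<^sub>R (exp (- a * t) * onorm (\<lambda>z. T t (i (j z))))) * norm z)"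
      using int unfolding set_integrable_def by (rule integrable_mult_left)
    show "(\<lambda>s. indicator {0..} s * (exp (- a * s) * norm (T s (i (j z))))) \<in> borel_measurable lebesgue"
      by (rule measurable_completion[OF m])
    have "AE t in lborel. t \<noteq> (0::real)" by (rule AE_lborel_singleton)
    then have "AE t in lebesgue. t \<noteq> (0::real)" by (rule AE_completion)
    then show "AE t in lebesgue. norm (indicator {0..} t * (exp (- a * t) * norm (T t (i (j z)))))
        \<le> norm ((indicator {0<..} t *\<^sub>R (exp (- a * t) * onorm (\<lambda>z. T t (i (j z))))) * norm z)"
    proof eventually_elim
      fix t :: real assume t: "t \<noteq> 0"
      show "norm (indicator {0..} t * (exp (- a * t) * norm (T t (i (j z)))))
        \<le> norm ((indicator {0<..} t *\<^sub>R (exp (- a * t) * onorm (\<lambda>z. T t (i (j z))))) * norm z)"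
      proof (cases "t > 0")
        case True
        have "norm (T t (i (j z))) \<le> onorm (\<lambda>z. T t (i (j z))) * norm z"
          by (rule onorm[OF bl]) (use True in simp)
        moreover have "0 \<le> onorm (\<lambda>z. T t (i (j z)))" by (rule onorm_pos_le[OF bl]) (use True in simp)
        ultimately show ?thesis using True by (simp add: abs_mult mult.assoc)
      qed (use t in auto)
    qed
  qed
  then show ?thesis using integrable_completion[OF m] by simp
qed

theorem theorem3p2:
  fixes D :: "'x::cbanach set" and A :: "'x \<Rightarrow> 'x" and T :: "real \<Rightarrow> 'x \<Rightarrow> 'x"
    and i :: "'y::cbanach \<Rightarrow> 'x" and j :: "'z::cbanach \<Rightarrow> 'y"
    and \<omega> M\<^sub>\<omega> M C\<^sub>T C\<^sub>Y C\<^sub>q :: real and p q :: ennreal and g :: "real \<Rightarrow> real"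
  assumes nonzero: "\<exists>x::'x. x \<noteq> 0" "\<exists>y::'y. y \<noteq> 0" "\<exists>z::'z. z \<noteq> 0"
    and semigroup: "C0_semigroup T" "is_generator D (\<lambda>x. - A x) T"
    and spectrum: "{z. Re z < 0} \<subseteq> resolvent_set D A"
    and growth: "\<omega> \<ge> 1" "M\<^sub>\<omega> \<ge> 1" "\<And>t. t \<ge> 0 \<Longrightarrow> onorm (T t) \<le> M\<^sub>\<omega> * exp (t * (\<omega> - 1))"
    and M: "M = (SUP t\<in>{0..2}. onorm (T t))"
    and Y: "continuous_embedding i"
    and cond1: "C\<^sub>T \<ge> 0"
      "\<And>t. t \<ge> 0 \<Longrightarrow> \<exists>S. bounded_clinear S \<and> (\<forall>y. i (S y) = T t (i y)) \<and>
          onorm S \<le> C\<^sub>T * onorm (T t)"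
    and cond2: "continuous_embedding j" "closure (range j) = UNIV"
      "\<And>a. a > 0 \<Longrightarrow>
         set_integrable lebesgue {0<..} (\<lambda>t. exp (- a * t) * onorm (\<lambda>z. T t (i (j z))))"
    and pq: "1 \<le> p" "p \<le> q"
    and g: "\<And>t. t > 0 \<Longrightarrow> g t > 0" "mono_on {0<..} g"
    and multiplier: "\<And>a. a > 0 \<Longrightarrow>
        (\<lambda>\<xi> y. inv_into D (\<lambda>x. Complex a \<xi> *\<^sub>C x + A x) (i y)) \<in> fourier_multipliers p q"
      "\<And>a. a > 0 \<Longrightarrow>
        multiplier_norm p q (\<lambda>\<xi> y. inv_into D (\<lambda>x. Complex a \<xi> *\<^sub>C x + A x) (i y)) \<le> g (1 / a)"
    and C\<^sub>Y: "C\<^sub>Y = max 1 (onorm i)"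
    and C\<^sub>q: "C\<^sub>q = (if q < \<infinity> then exp 1 * C\<^sub>T * C\<^sub>Y * M\<^sub>\<omega> * (1 + 2 * M * \<omega>)
                  else exp 1 * C\<^sub>T * C\<^sub>Y * M\<^sub>\<omega> * (1 + \<omega>))"
  shows "\<forall>t>0. onorm (\<lambda>y. T t (i y)) \<le> C\<^sub>q * (g t + 1)"
proof (intro allI impI)
  fix t :: real assume t: "t > 0"
  have i: "bounded_clinear i" "inj i" and j: "bounded_clinear j"
    using Y cond2(1) by (auto simp: continuous_embedding_def)
  have bli: "bounded_linear i" using i(1) by (rule bounded_clinear_bounded_linear)
  have blT: "bounded_linear (T s)" if "s \<ge> 0" for s
    using C0_semigroupD(1)[OF semigroup(1) that] by (rule bounded_clinear_bounded_linear)
  have T0: "T 0 x = x" for x by (rule C0_semigroupD(2)[OF semigroup(1)])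
  have onT0: "onorm (T 0) = 1"
  proof (rule antisym)
    show "onorm (T 0) \<le> 1" by (rule onorm_bound) (auto simp: T0)
    obtain x :: 'x where "x \<noteq> 0" using nonzero(1) by blast
    then show "1 \<le> onorm (T 0)" using onorm[OF blT[of 0], of x] T0[of x] by simp
  qed
  (* The embedding is injective, hence the operator on the small space at time 0 is the identity. *)
  have CT1: "C\<^sub>T \<ge> 1"
  proof -
    obtain S where S: "bounded_clinear S" "\<And>y. i (S y) = T 0 (i y)" "onorm S \<le> C\<^sub>T * onorm (T 0)"
      using cond1(2)[of 0] by auto
    obtain y :: 'y where y: "y \<noteq> 0" using nonzero(2) by blast
    have "S y = y" using S(2)[of y] T0 i(2) by (simp add: inj_eq)
    then have "1 \<le> onorm S" using onorm[OF bounded_clinear_bounded_linear[OF S(1)], of y] y by simp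
    then show ?thesis using S(3) onT0 by simp
  qed
  have CY1: "C\<^sub>Y \<ge> 1" and CYi: "onorm i \<le> C\<^sub>Y" by (auto simp: C\<^sub>Y)
  have Mub: "onorm (T s) \<le> M" if "s \<in> {0..2}" for s
  proof -
    have "bdd_above ((\<lambda>s. onorm (T s)) ` {0..2})"
    proof (rule bdd_aboveI2)
      fix s :: real assume s: "s \<in> {0..2}"
      have "onorm (T s) \<le> M\<^sub>\<omega> * exp (s * (\<omega> - 1))" using growth(3) s by simp
      also have "\<dots> \<le> M\<^sub>\<omega> * exp (2 * (\<omega> - 1))"
      proof (rule mult_left_mono[OF iffD2[OF exp_le_cancel_iff]])
        show "s * (\<omega> - 1) \<le> 2 * (\<omega> - 1)" using growth(1) s by (intro mult_right_mono) auto
      qed (use growth(2) in simp)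
      finally show "onorm (T s) \<le> M\<^sub>\<omega> * exp (2 * (\<omega> - 1))" .
    qed
    then show ?thesis unfolding M by (rule cSUP_upper[OF that])
  qed
  have M1: "M \<ge> 1" using Mub[of 0] onT0 by simp
  have iy: "norm (i y) \<le> C\<^sub>Y * norm y" for y
    by (rule order_trans[OF onorm[OF bli]]) (rule mult_right_mono[OF CYi norm_ge_zero])
  have gpos: "g t > 0" by (rule g(1)[OF t])
  define P where "P = C\<^sub>T * C\<^sub>Y * M\<^sub>\<omega>"
  have P1: "C\<^sub>T * M\<^sub>\<omega> \<le> P" "M\<^sub>\<omega> * C\<^sub>Y \<le> P" "C\<^sub>Y \<le> P" "1 \<le> P"
  proof -
    have *: "x \<le> y * x" if "1 \<le> y" "0 \<le> x" for x y :: real using mult_right_mono[OF that] by simp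
    show a: "C\<^sub>T * M\<^sub>\<omega> \<le> P" using *[OF CY1, of "C\<^sub>T * M\<^sub>\<omega>"] CT1 growth(2) by (simp add: P_def mult_ac)
    show b: "M\<^sub>\<omega> * C\<^sub>Y \<le> P" using *[OF CT1, of "M\<^sub>\<omega> * C\<^sub>Y"] CY1 growth(2) by (simp add: P_def mult_ac)
    show c: "C\<^sub>Y \<le> P" using *[OF growth(2) order_trans[OF zero_le_one CY1]] b by linarith
    then show "1 \<le> P" using CY1 by simp
  qed
  have eP: "P \<le> exp 1 * P" using mult_right_mono[of 1 "exp 1" P] P1(4) by simp
  define a where "a = 1 / t"
  have a: "a > 0" "1 / a = t" "a * t = 1" using t by (auto simp: a_def)
  let ?m = "\<lambda>\<xi> y. inv_into D (\<lambda>x. Complex a \<xi> *\<^sub>C x + A x) (i y)"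
  (* The multiplier norm is an infimum, so that bounds are available only up to an error. *)
  have Cex: "\<exists>C. multiplier_bound p q ?m C \<and> C < g t + e" if "e > 0" for e
  proof -
    have ne: "{C. multiplier_bound p q ?m C} \<noteq> {}" using multiplier(1)[OF a(1)] by (auto simp: fourier_multipliers_def)
    have "Inf {C. multiplier_bound p q ?m C} < g t + e"
      using multiplier(2)[OF a(1)] that unfolding multiplier_norm_def a(2) by simp
    from cInf_lessD[OF ne this] show ?thesis by auto
  qed
  have key: "norm (T t (i y)) \<le> C\<^sub>q * (g t + 1) * norm y" for y
  proof (cases "y = 0")
    case True
    then show ?thesis using blT[of t] bli t by (simp add: linear_simps)
  next
    case False
    define B where "B = C\<^sub>T * M\<^sub>\<omega> * norm y"
    have B: "B > 0" using CT1 growth(2) False by (simp add: B_def)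
    have "\<exists>orb. \<forall>s. s \<ge> 0 \<longrightarrow> i (orb s) = T s (i y) \<and> norm (orb s) \<le> B * exp (s * (\<omega> - 1))"
    proof (rule choice, rule allI)
      fix s
      show "\<exists>v. s \<ge> 0 \<longrightarrow> i v = T s (i y) \<and> norm v \<le> B * exp (s * (\<omega> - 1))"
      proof (cases "s \<ge> 0")
        case True
        obtain S where S: "bounded_clinear S" "\<And>y. i (S y) = T s (i y)" "onorm S \<le> C\<^sub>T * onorm (T s)"
          using cond1(2)[OF True] by auto
        have "norm (S y) \<le> onorm S * norm y" by (rule onorm[OF bounded_clinear_bounded_linear[OF S(1)]])
        also have "\<dots> \<le> (C\<^sub>T * (M\<^sub>\<omega> * exp (s * (\<omega> - 1)))) * norm y"
          by (intro mult_right_mono order_trans[OF S(3)] mult_left_mono growth(3)[OF True] cond1(1)) simp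
        finally show ?thesis using S(2) by (intro exI[of _ "S y"]) (simp add: B_def mult_ac)
      qed simp
    qed
    then obtain orb where orb: "\<And>s. s \<ge> 0 \<Longrightarrow> i (orb s) = T s (i y)" "\<And>s. s \<ge> 0 \<Longrightarrow> norm (orb s) \<le> B * exp (s * (\<omega> - 1))"
      by blast
    have bound': "w0 * norm (T t (i y)) - e \<le> L * C * B"
      if "multiplier_bound p q ?m C" "c \<ge> 0" "d > 0" "q = \<infinity> \<or> real n * d = 1" "n > 0"
        "\<And>k. k < n \<Longrightarrow> c + real k * d \<le> t" "L > 0" "\<And>k. k < n \<Longrightarrow> onorm (T (t - (c + real k * d))) \<le> L"
        "\<And>u. u \<in> {c..c + real n * d} \<Longrightarrow> w0 \<le> exp (- a * u) * ((1 - exp (- \<omega> * u)) / \<omega>)"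
        "\<And>u. u \<in> {t..<t + d} \<Longrightarrow> norm (T u (i y) - T t (i y)) \<le> e" for C c d n L w0 e
      by (rule orbit_pointwise_bound[where a=a and j=j and orb=orb and c=c and d=d and n=n and p=p and q=q, OF semigroup spectrum i(1) cond2(2) growth(1)])
        (rule growth(3) a(1) kernel_integrable[OF semigroup(1) i(1) j cond2(3)[OF a(1)]] orb B pq multiplier(1)[OF a(1)] that | assumption)+
    define R where "R = norm (T t (i y))"
    have near: "\<exists>\<delta>>0. \<forall>u\<in>{t..<t + \<delta>}. norm (T u (i y) - T t (i y)) \<le> e" if "e > 0" for e
    proof -
      have "continuous_on {0..} (\<lambda>s. T s (i y))" by (rule C0_semigroupD(4)[OF semigroup(1)])
      then obtain \<delta> where "\<delta> > 0" "\<And>u. u \<in> {0..} \<Longrightarrow> dist u t < \<delta> \<Longrightarrow> dist (T u (i y)) (T t (i y)) \<le> e"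
        using \<open>e > 0\<close> t unfolding continuous_on_iff by (metis atLeast_iff less_eq_real_def)
      then show ?thesis using t by (intro exI[of _ \<delta>]) (auto simp: dist_norm)
    qed
    show ?thesis
    proof (cases "q = \<infinity>")
      case True
      let ?w = "\<lambda>u. exp (- a * u) * ((1 - exp (- \<omega> * u)) / \<omega>)"
      (* A single short window starting at t, where the transport is the identity. *)
      have est: "?w t * R \<le> g t * B"
      proof (rule field_le_epsilon)
        fix e :: real assume e: "e > 0"
        define e' where "e' = e / (R + 1 + B)"
        have R0: "R \<ge> 0" by (simp add: R_def)
        have e': "e' > 0" using e R0 B by (simp add: e'_def)
        obtain \<delta>1 where \<delta>1: "\<delta>1 > 0" "\<And>u. u \<in> {t..<t + \<delta>1} \<Longrightarrow> norm (T u (i y) - T t (i y)) \<le> e'"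
          using near[OF e'] by blast
        have "isCont ?w t" using growth(1) by (intro continuous_intros) auto
        then obtain \<delta>2 where \<delta>2: "\<delta>2 > 0" "\<And>u. dist u t < \<delta>2 \<Longrightarrow> dist (?w u) (?w t) < e'"
          using e' unfolding continuous_at_eps_delta by metis
        define d where "d = min \<delta>1 (\<delta>2 / 2)"
        have d: "d > 0" using \<delta>1 \<delta>2 by (simp add: d_def)
        obtain C where C: "multiplier_bound p q ?m C" "C < g t + e'" using Cex[OF e'] by blast
        have "(?w t - e') * R - e' \<le> 1 * C * B" unfolding R_def
        proof (rule bound'[OF C(1), of t d 1])
          show "onorm (T (t - (t + real k * d))) \<le> 1" if "k < 1" for k using that onT0 by simp
          show "?w t - e' \<le> ?w u" if "u \<in> {t..t + real 1 * d}" for u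
          proof -
            have "dist u t < \<delta>2" using that \<delta>2(1) by (auto simp: dist_real_def d_def min_def split: if_splits)
            then have "\<bar>?w u - ?w t\<bar> < e'" using \<delta>2(2) by (simp add: dist_real_def)
            then show ?thesis by linarith
          qed
          show "norm (T u (i y) - T t (i y)) \<le> e'" if "u \<in> {t..<t + d}" for u
            by (rule \<delta>1(2)) (use that in \<open>auto simp: d_def\<close>)
        qed (use True t d in auto)
        also have "1 * C * B \<le> (g t + e') * B" using C(2) B by simp
        finally have "?w t * R \<le> g t * B + e' * (R + 1 + B)" by (simp add: algebra_simps)
        also have "e' * (R + 1 + B) = e" using R0 B by (simp add: e'_def)
        finally show "?w t * R \<le> g t * B + e" .
      qed
      have e1: "exp (- a * t) = exp (- 1)" using a(3) by simp
      (* This compensates the factor 1 - exp (- \<omega> t) in the weight for small t. *)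
      have tail: "exp (- \<omega> * t) * R \<le> P * norm y"
      proof -
        have "R \<le> onorm (T t) * norm (i y)" unfolding R_def using onorm[OF blT] t by simp
        also have "\<dots> \<le> (M\<^sub>\<omega> * exp (t * (\<omega> - 1))) * (C\<^sub>Y * norm y)"
          using growth(2) t by (intro mult_mono growth(3) iy) auto
        finally have "exp (- \<omega> * t) * R \<le> exp (- \<omega> * t) * ((M\<^sub>\<omega> * exp (t * (\<omega> - 1))) * (C\<^sub>Y * norm y))"
          by (rule mult_left_mono) simp
        also have "\<dots> = exp (- t) * (M\<^sub>\<omega> * C\<^sub>Y * norm y)"
        proof -
          have "exp (- \<omega> * t) * exp (t * (\<omega> - 1)) = exp (- t)" by (simp add: algebra_simps flip: exp_add)
          then show ?thesis by (simp add: mult_ac)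
        qed
        also have "\<dots> \<le> 1 * (P * norm y)"
          using t P1(2) CY1 growth(2) by (intro mult_mono mult_right_mono) auto
        finally show ?thesis by simp
      qed
      have "exp (- 1) * ((1 - exp (- \<omega> * t)) * R) \<le> \<omega> * (g t * B)"
        using est growth(1) unfolding e1 by (simp add: field_simps)
      then have 1: "(1 - exp (- \<omega> * t)) * R \<le> exp 1 * (\<omega> * (g t * B))"
        by (simp add: exp_minus field_simps)
      have BP: "B \<le> P * norm y" unfolding B_def by (rule mult_right_mono[OF P1(1)]) simp
      have "R = (1 - exp (- \<omega> * t)) * R + exp (- \<omega> * t) * R" by (simp add: algebra_simps)
      also have "\<dots> \<le> exp 1 * (\<omega> * (g t * (P * norm y))) + exp 1 * (P * norm y)"
      proof (rule add_mono)
        show "(1 - exp (- \<omega> * t)) * R \<le> exp 1 * (\<omega> * (g t * (P * norm y)))"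
          using growth(1) gpos by (intro order_trans[OF 1] mult_left_mono BP) auto
        show "exp (- \<omega> * t) * R \<le> exp 1 * (P * norm y)"
          using mult_right_mono[OF eP norm_ge_zero[of y]] by (intro order_trans[OF tail]) (simp add: mult.assoc)
      qed
      also have "\<dots> = exp 1 * P * (\<omega> * g t + 1) * norm y" by (simp add: algebra_simps)
      also have "\<dots> \<le> exp 1 * P * ((1 + \<omega>) * (g t + 1)) * norm y"
        using P1(4) growth(1) gpos by (intro mult_right_mono mult_left_mono) (auto simp: algebra_simps)
      also have "\<dots> = C\<^sub>q * (g t + 1) * norm y" using True by (simp add: C\<^sub>q P_def mult_ac)
      finally show ?thesis by (simp add: R_def)
    next
      case False
      then have Cq: "C\<^sub>q = exp 1 * P * (1 + 2 * M * \<omega>)" by (simp add: C\<^sub>q P_def mult_ac top.not_eq_extremum)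
      show ?thesis
      proof (cases "t \<le> 2")
        case True
        have "R \<le> onorm (T t) * norm (i y)" unfolding R_def using onorm[OF blT] t by simp
        also have "\<dots> \<le> M * (C\<^sub>Y * norm y)" using Mub[of t] True t M1 by (intro mult_mono iy) auto
        also have "\<dots> \<le> M * (P * norm y)" using M1 P1(3) by (intro mult_left_mono mult_right_mono) auto
        also have "\<dots> = P * M * norm y" by simp
        also have "\<dots> \<le> (exp 1 * P * (1 + 2 * M * \<omega>)) * (g t + 1) * norm y"
        proof (rule mult_right_mono)
          have "M * 1 \<le> M * \<omega>" using growth(1) M1 by (intro mult_left_mono) auto
          then have m: "M \<le> 1 + 2 * M * \<omega>" using M1 by linarith
          have "P * M \<le> exp 1 * P * (1 + 2 * M * \<omega>)"
            by (intro mult_mono eP m) (use P1(4) M1 in auto)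
          also have "\<dots> = (exp 1 * P * (1 + 2 * M * \<omega>)) * 1" by simp
          also have "\<dots> \<le> (exp 1 * P * (1 + 2 * M * \<omega>)) * (g t + 1)"
            using P1(4) M1 growth(1) gpos by (intro mult_left_mono) auto
          finally show "P * M \<le> (exp 1 * P * (1 + 2 * M * \<omega>)) * (g t + 1)" .
        qed simp
        finally show ?thesis by (simp add: R_def Cq)
      next
        case t2: False
        (* Windows in [t - 1, t]: the transports have times at most 1, and the weight is at least
           exp (- 1) / (2 \<omega>) because \<omega> u \<ge> 1 there. *)
        have est: "exp (- 1) / (2 * \<omega>) * R \<le> M * (g t * B)"
        proof (rule field_le_epsilon)
          fix e :: real assume e: "e > 0"
          define e' where "e' = e / (1 + M * B)"
          have MB: "M * B > 0" using M1 B by simp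
          have e': "e' > 0" using e MB by (simp add: e'_def add_pos_pos)
          obtain \<delta> where \<delta>: "\<delta> > 0" "\<And>u. u \<in> {t..<t + \<delta>} \<Longrightarrow> norm (T u (i y) - T t (i y)) \<le> e'"
            using near[OF e'] by blast
          obtain n where n: "n > 0" "inverse (real n) < \<delta>" using ex_inverse_of_nat_less[OF \<delta>(1)] by blast
          define d where "d = inverse (real n)"
          have d: "d > 0" "real n * d = 1" using n by (auto simp: d_def)
          obtain C where C: "multiplier_bound p q ?m C" "C < g t + e'" using Cex[OF e'] by blast
          have kd: "real k * d \<le> 1" "0 \<le> real k * d" if "k < n" for k
            using mult_right_mono[of "real k" "real n" d] that d by auto
          have "exp (- 1) / (2 * \<omega>) * R - e' \<le> M * C * B" unfolding R_def
          proof (rule bound'[OF C(1), of "t - 1" d n])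
            show "t - 1 + real k * d \<le> t" if "k < n" for k using kd[OF that] by simp
            show "onorm (T (t - (t - 1 + real k * d))) \<le> M" if "k < n" for k
              by (rule Mub) (use kd[OF that] in auto)
            show "exp (- 1) / (2 * \<omega>) \<le> exp (- a * u) * ((1 - exp (- \<omega> * u)) / \<omega>)" if u: "u \<in> {t - 1..t - 1 + real n * d}" for u
            proof -
              have u': "1 \<le> u" "u \<le> t" using u t2 d(2) by auto
              have "a * u \<le> 1" using mult_left_mono[OF u'(2), of a] a by simp
              then have ea: "exp (- 1) \<le> exp (- a * u)" by simp
              have "1 * 1 \<le> \<omega> * u" using growth(1) u' by (intro mult_mono) auto
              then have "exp (- \<omega> * u) \<le> exp (- 1)" by simp
              also have "exp (- 1) \<le> (1 / 2 :: real)"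
              proof -
                have "(2::real) \<le> exp 1" using exp_ge_add_one_self[of 1] by simp
                then show ?thesis by (simp add: exp_minus field_simps)
              qed
              finally have "1 / 2 \<le> 1 - exp (- \<omega> * u)" by simp
              then have "(1 / 2) / \<omega> \<le> (1 - exp (- \<omega> * u)) / \<omega>" using growth(1) by (intro divide_right_mono) auto
              with ea have "exp (- 1) * ((1 / 2) / \<omega>) \<le> exp (- a * u) * ((1 - exp (- \<omega> * u)) / \<omega>)"
                using growth(1) by (intro mult_mono) auto
              then show ?thesis by simp
            qed
            show "norm (T u (i y) - T t (i y)) \<le> e'" if "u \<in> {t..<t + d}" for u
              by (rule \<delta>(2)) (use that n in \<open>auto simp: d_def\<close>)
          qed (use t2 d n M1 in auto)
          also have "M * C * B \<le> M * (g t + e') * B" using C(2) B M1 by simp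
          finally have "exp (- 1) / (2 * \<omega>) * R \<le> M * (g t * B) + e' * (1 + M * B)" by (simp add: algebra_simps)
          also have "e' * (1 + M * B) = e" using MB by (simp add: e'_def)
          finally show "exp (- 1) / (2 * \<omega>) * R \<le> M * (g t * B) + e" .
        qed
        have "R = exp 1 * (2 * \<omega>) * (exp (- 1) / (2 * \<omega>) * R)" using growth(1) by (simp add: exp_minus field_simps)
        also have "\<dots> \<le> exp 1 * (2 * \<omega>) * (M * (g t * B))" using est growth(1) by (intro mult_left_mono) auto
        also have "\<dots> \<le> exp 1 * (2 * \<omega>) * (M * (g t * (P * norm y)))"
          unfolding B_def using growth(1) M1 gpos P1(1) by (intro mult_left_mono mult_right_mono) auto
        also have "\<dots> = (exp 1 * P) * (2 * M * \<omega> * g t) * norm y" by (simp add: mult_ac)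
        also have "\<dots> \<le> (exp 1 * P) * ((1 + 2 * M * \<omega>) * (g t + 1)) * norm y"
        proof (intro mult_right_mono mult_left_mono)
          have "2 * M * \<omega> * g t \<le> (1 + 2 * M * \<omega>) * g t" using gpos by (simp add: mult_right_mono)
          also have "\<dots> \<le> (1 + 2 * M * \<omega>) * (g t + 1)" using M1 growth(1) by (intro mult_left_mono) auto
          finally show "2 * M * \<omega> * g t \<le> (1 + 2 * M * \<omega>) * (g t + 1)" .
        qed (use P1(4) in auto)
        also have "\<dots> = C\<^sub>q * (g t + 1) * norm y" by (simp add: Cq mult_ac)
        finally show ?thesis by (simp add: R_def)
      qed
    qed
  qed
  have "0 \<le> C\<^sub>q * (g t + 1)"
  proof -
    obtain y :: 'y where y: "y \<noteq> 0" using nonzero(2) by blast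
    have "0 \<le> C\<^sub>q * (g t + 1) * norm y" using key[of y] norm_ge_zero order_trans by blast
    then show ?thesis using y by (simp add: zero_le_mult_iff)
  qed
  then show "onorm (\<lambda>y. T t (i y)) \<le> C\<^sub>q * (g t + 1)" by (rule onorm_bound) (rule key)
qed

end
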